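(* Assume that the data $(H,f,g,m_0)$ satisfy Assumptions (M), (H), (F), (G) and the degenerate ellipticity condition (DE) (all listed in the context), and let $H$, $f$, and $g$ be independent of $x$. For $\epsilon>0$ let $(u^\epsilon,m^\epsilon)\in C^{3}(\overline{Q_T})\times C^{2}(\overline{Q_T})$ be the unique classical solution of \[ \begin{cases} -u^\epsilon_t+H(D_xu^\epsilon)=f(m^\epsilon)+\epsilon\log m^\epsilon,\quad u^\epsilon(\cdot,T)=g(m^\epsilon(\cdot,T)),\\ m^\epsilon_t-\mathrm{div}(m^\epsilon D_pH(D_xu^\epsilon))=0,\quad m^\epsilon(\cdot,0)=m_0. \end{cases} \] Then $u^\epsilon$ is uniformly bounded in $C^1(\overline{Q_T})$ as $\epsilon\to0$. In particular, the weak solution $u=\lim_{\epsilon\to0}u^\epsilon$ and the terminal density $m(\cdot,T)$ are globally Lipschitz continuous, where $(u,m)$ is the weak solution (in the sense defined in the context) of the mean field games system (MFG) obtained as the limit of $(u^\epsilon,m^\epsilon)$ as $\epsilon\to0$.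
   Context: Setting. $d\ge 1$ is an integer, $T>0$, $\mathbb{T}^d=\mathbb{R}^d/\mathbb{Z}^d$, $Q_T=\mathbb{T}^d\times(0,T)$. The data are $H:\mathbb{T}^d\times\mathbb{R}^d\to\mathbb{R}$, $f,g:\mathbb{T}^d\times[0,\infty)\to[-\infty,\infty)$, and $m_0:\mathbb{T}^d\to\mathbb{R}$. The system (MFG) is \[-u_t+H(x,D_xu)=f(x,m),\quad m_t-\mathrm{div}(mD_pH(x,D_xu))=0\ \text{ in }Q_T,\qquad m(\cdot,0)=m_0,\ u(\cdot,T)=g(\cdot,m(\cdot,T))\ \text{ on }\mathbb{T}^d.\] Assumptions. $C_0>0$ and $0\le\tau<1$ are fixed constants. For each $x$, $f^{-1}(x,\cdot)$ is the inverse function of $f(x,\cdot)$, and $\chi(x,w)=f^{-1}(x,w)\,f_m(x,f^{-1}(x,w))$. (M) $m_0\in C^4(\mathbb{T}^d)$, $m_0>0$, $\int_{\mathbb{T}^d}m_0=1$. (H) $H$, $D_pH$, $D^2_{pp}H$ are four times continuously differentiable and, for all $(x,p)$: $\frac1{C_0}I\le D^2_{pp}H\le C_0I$; $D_pH\cdot p\ge 2H-C_0$; $|D^3_{ppp}H|\le C_0(1+|p|)^{-1}$; $|D^3_{xxp}H|\le C_0(1+|p|)^{\tau}$; $|D^3_{xpp}H|\le C_0(1+|p|)^{\tau-1}$. (The last two are vacuous when $H$ is independent of $x$.) (F) $f$ is continuous on $\mathbb{T}^d\times[0,\infty)$ (with values in $[-\infty,\infty)$), four times continuously differentiable on $\mathbb{T}^d\times(0,\infty)$,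 strictly increasing in $m$ with $f_m>0$; $\liminf_{x\in\mathbb{T}^d,\,m\to\infty}mf_m(x,m)>0$; $|\chi_w|\le C_0$ (equivalently, up to changing the constant, $|mf_{mm}|\le C_0f_m$); $|m(D_xf)_m|\le C_0|D_xf|$; and $|D_xf|,|D^2_{xx}f|\le C_0(1+|f|^{\tau/2}+|mf_m|^{(1+\tau)/2})$. (The last two are vacuous when $f$ is independent of $x$.) (G) $g$ is continuous on $\mathbb{T}^d\times[0,\infty)$, four times continuously differentiable on $\mathbb{T}^d\times(0,\infty)$, strictly increasing in $m$ with $g_m>0$, and for each $x$, $\lim_{m\to\infty}g(x,m)=\sup g$ and $g(x,0)=\inf g$ (sup and inf over $\mathbb{T}^d\times[0,\infty)$). (DE) $f(x,0)>-\infty$ and $g(x,0)>-\infty$ for all $x\in\mathbb{T}^d$. Weak solution. A pair $(u,m)\in BV(Q_T)\times L^\infty(Q_T)$, $m\ge0$ a.e., is a weak solution to (MFG) if: (1) $D_xu\in L^2(Q_T)$, $u\in L^\infty(Q_T)$, $m\in C^0([0,T];H^{-1}(\mathbb{T}^d))$, $m(\cdot,T)\in L^\infty(\mathbb{T}^d)$; (2) $-u_t+H(\cdot,D_xu)\le f(\cdot,m)$ in $Q_T$ in the distributional sense, with $u(\cdot,T)=g(\cdot,m(\cdot,T))$ in the sense of traces; (3) $m_t-\mathrm{div}(mD_pH(\cdot,D_xu))=0$ in $Q_T$ in the distributional sense, with $m(\cdot,0)=m_0$ in $H^{-1}(\mathbb{T}^d)$; (4) $\iint_{Q_T}m\,(H(x,D_xu)-D_pH(x,D_xu)\cdot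 D_xu-f(x,m))\,dx\,dt=\int_{\mathbb{T}^d}(m(x,T)g(x,m(x,T))-m_0(x)u(x,0))\,dx$. Under the assumptions above, the pairs $(u^\epsilon,m^\epsilon)$ exist and converge a.e. in $Q_T$ to a weak solution $(u,m)$ as $\epsilon\to0$ (along a subsequence), with $m^\epsilon(\cdot,T)\to m(\cdot,T)$ and $u^\epsilon(\cdot,T)\to u(\cdot,T)$ a.e. in $\mathbb{T}^d$. *)

theory Defs
  imports "HOL-Analysis.Analysis"
begin

text \<open>
  The torus \<open>T^d = R^d / Z^d\<close> is treated through \<open>Z^d\<close>-periodic functions on \<open>real ^ 'n\<close>, with
  \<open>d = CARD('n)\<close>; a function on \<open>T^d \<times> [0,T]\<close> is a function on \<open>(real ^ 'n) \<times> real\<close>, used only for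
  times in \<open>[0,T]\<close>. Integrals over the torus are integrals over the unit cell.
\<close>

definition torus_periodic :: "(real ^ 'n \<Rightarrow> 'b) \<Rightarrow> bool" where
  "torus_periodic \<phi> \<longleftrightarrow> (\<forall>x k. (\<forall>i. k $ i \<in> \<int>) \<longrightarrow> \<phi> (x + k) = \<phi> x)"

definition cell :: "(real ^ 'n) set" where
  "cell = cbox 0 One"

abbreviation cyl_cell :: "real \<Rightarrow> ((real ^ 'n) \<times> real) set" where
  "cyl_cell T \<equiv> cell \<times> {0<..<T}"

abbreviation open_cyl :: "real \<Rightarrow> ((real ^ 'n) \<times> real) set" where
  "open_cyl T \<equiv> UNIV \<times> {0<..<T}"

abbreviation closed_cyl :: "real \<Rightarrow> ((real ^ 'n) \<times> real) set" where
  "closed_cyl T \<equiv> UNIV \<times> {0..T}"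

section \<open>Derivatives and classes of continuously differentiable functions\<close>

text \<open>
  Derivatives are taken within a set \<open>S\<close>. For open \<open>S\<close> these are the usual ones; on \<open>closed_cyl T\<close>
  (convex with nonempty interior, so derivatives within it are unique) they are one-sided in time
  at the two ends, and \<open>Ck k (closed_cyl T)\<close> is the class of functions whose partial derivatives up
  to order \<open>k\<close> are continuous up to the boundary.
\<close>

definition dderiv ::
  "'a::real_normed_vector set \<Rightarrow> 'a \<Rightarrow> ('a \<Rightarrow> 'b::real_normed_vector) \<Rightarrow> 'a \<Rightarrow> 'b" where
  "dderiv S v \<phi> z = frechet_derivative \<phi> (at z within S) v"

primrec Ck :: "nat \<Rightarrow> 'a::real_normed_vector set \<Rightarrow> ('a \<Rightarrow> 'b::real_normed_vector) \<Rightarrow> bool" where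
  "Ck 0 S \<phi> \<longleftrightarrow> continuous_on S \<phi>"
| "Ck (Suc k) S \<phi> \<longleftrightarrow> \<phi> differentiable_on S \<and> (\<forall>v. Ck k S (dderiv S v \<phi>))"

definition Dx ::
  "((real ^ 'n) \<times> 'b::real_normed_vector) set \<Rightarrow> ((real ^ 'n) \<times> 'b \<Rightarrow> real) \<Rightarrow> (real ^ 'n) \<times> 'b \<Rightarrow> real ^ 'n"
  where "Dx S \<phi> z = (\<chi> i. dderiv S (axis i 1, 0) \<phi> z)"

text \<open>The derivative in the second, real variable (time \<open>t\<close>, or the density variable \<open>m\<close>).\<close>

definition D2 ::
  "((real ^ 'n) \<times> real) set \<Rightarrow> ((real ^ 'n) \<times> real \<Rightarrow> 'b::real_normed_vector) \<Rightarrow> (real ^ 'n) \<times> real \<Rightarrow> 'b"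
  where "D2 S \<phi> z = dderiv S (0, 1) \<phi> z"

definition divx ::
  "((real ^ 'n) \<times> real) set \<Rightarrow> ((real ^ 'n) \<times> real \<Rightarrow> real ^ 'n) \<Rightarrow> (real ^ 'n) \<times> real \<Rightarrow> real"
  where "divx S V z = (\<Sum>i\<in>UNIV. dderiv S (axis i 1, 0) (\<lambda>y. V y $ i) z)"

definition DpH :: "((real ^ 'n) \<times> (real ^ 'n) \<Rightarrow> real) \<Rightarrow> (real ^ 'n) \<times> (real ^ 'n) \<Rightarrow> real ^ 'n" where
  "DpH H z = (\<chi> i. dderiv UNIV (0, axis i 1) H z)"

section \<open>Assumptions on the data\<close>

definition assumption_M :: "(real ^ 'n \<Rightarrow> real) \<Rightarrow> bool" where
  "assumption_M m0 \<longleftrightarrow>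
     torus_periodic m0 \<and> Ck 4 UNIV m0 \<and> (\<forall>x. m0 x > 0) \<and>
     (LINT x|lebesgue_on cell. m0 x) = 1"

text \<open>
  The first three regularity clauses are for \<open>H\<close>, \<open>D\<^sub>pH\<close> and \<open>D\<^sup>2\<^sub>p\<^sub>pH\<close>. Bounds on third derivatives
  are bounds on the norms of these as trilinear forms.
\<close>

definition assumption_H :: "real \<Rightarrow> real \<Rightarrow> ((real ^ 'n) \<times> (real ^ 'n) \<Rightarrow> real) \<Rightarrow> bool" where
  "assumption_H C0 \<tau> H \<longleftrightarrow>
     (\<forall>p. torus_periodic (\<lambda>x. H (x, p))) \<and>
     Ck 4 UNIV H \<and>
     (\<forall>\<xi>. Ck 4 UNIV (dderiv UNIV (0, \<xi>) H)) \<and>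
     (\<forall>\<xi> \<eta>. Ck 4 UNIV (dderiv UNIV (0, \<eta>) (dderiv UNIV (0, \<xi>) H))) \<and>
     (\<forall>x p \<xi>. 1 / C0 * (\<xi> \<bullet> \<xi>) \<le> dderiv UNIV (0, \<xi>) (dderiv UNIV (0, \<xi>) H) (x, p) \<and>
              dderiv UNIV (0, \<xi>) (dderiv UNIV (0, \<xi>) H) (x, p) \<le> C0 * (\<xi> \<bullet> \<xi>)) \<and>
     (\<forall>x p. DpH H (x, p) \<bullet> p \<ge> 2 * H (x, p) - C0) \<and>
     (\<forall>x p \<xi> \<eta> \<zeta>.
        \<bar>dderiv UNIV (0, \<zeta>) (dderiv UNIV (0, \<eta>) (dderiv UNIV (0, \<xi>) H)) (x, p)\<bar>
          \<le> C0 * (1 + norm p) powr (-1) * norm \<xi> * norm \<eta> * norm \<zeta>) \<and>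
     (\<forall>x p \<xi> \<eta> \<zeta>.
        \<bar>dderiv UNIV (\<zeta>, 0) (dderiv UNIV (\<eta>, 0) (dderiv UNIV (0, \<xi>) H)) (x, p)\<bar>
          \<le> C0 * (1 + norm p) powr \<tau> * norm \<xi> * norm \<eta> * norm \<zeta>) \<and>
     (\<forall>x p \<xi> \<eta> \<zeta>.
        \<bar>dderiv UNIV (\<zeta>, 0) (dderiv UNIV (0, \<eta>) (dderiv UNIV (0, \<xi>) H)) (x, p)\<bar>
          \<le> C0 * (1 + norm p) powr (\<tau> - 1) * norm \<xi> * norm \<eta> * norm \<zeta>)"

text \<open>
  The couplings take values in \<open>[-\<infinity>, \<infinity>)\<close>, the value \<open>-\<infinity>\<close> being possible only at \<open>m = 0\<close>.
\<close>

abbreviation pos_half :: "((real ^ 'n) \<times> real) set" where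
  "pos_half \<equiv> UNIV \<times> {0<..}"

definition coupling_regular :: "((real ^ 'n) \<times> real \<Rightarrow> ereal) \<Rightarrow> bool" where
  "coupling_regular f \<longleftrightarrow>
     (\<forall>m\<ge>0. torus_periodic (\<lambda>x. f (x, m))) \<and>
     (\<forall>x. \<forall>m\<ge>0. f (x, m) \<noteq> \<infinity>) \<and> (\<forall>x. \<forall>m>0. f (x, m) \<noteq> -\<infinity>) \<and>
     continuous_on (UNIV \<times> {0..}) f \<and>
     Ck 4 pos_half (\<lambda>z. real_of_ereal (f z)) \<and>
     (\<forall>x. strict_mono_on {0..} (\<lambda>m. f (x, m))) \<and>
     (\<forall>x. \<forall>m>0. D2 pos_half (\<lambda>z. real_of_ereal (f z)) (x, m) > 0)"

definition chi :: "((real ^ 'n) \<times> real \<Rightarrow> real) \<Rightarrow> real ^ 'n \<Rightarrow> real \<Rightarrow> real" where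
  "chi F x w = (let m = the_inv_into {0<..} (\<lambda>m. F (x, m)) w in m * D2 pos_half F (x, m))"

text \<open>Unlike \<open>powr\<close>, this satisfies \<open>0\<^sup>0 = 1\<close>; the exponent \<open>\<tau>/2\<close> below may be \<open>0\<close>.\<close>

definition rpow :: "real \<Rightarrow> real \<Rightarrow> real" where
  "rpow a b = (if b = 0 then 1 else a powr b)"

text \<open>
  \<open>\<chi>(x, \<cdot>)\<close> lives on the open interval \<open>f(x, (0,\<infinity>))\<close>. The filter in the \<open>Liminf\<close> expresses
  \<open>m \<rightarrow> \<infinity>\<close> uniformly in \<open>x\<close>.
\<close>

definition assumption_F :: "real \<Rightarrow> real \<Rightarrow> ((real ^ 'n) \<times> real \<Rightarrow> ereal) \<Rightarrow> bool" where
  "assumption_F C0 \<tau> f \<longleftrightarrow>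
     coupling_regular f \<and>
     (let F = (\<lambda>z. real_of_ereal (f z));
          Fm = D2 pos_half F;
          bound = (\<lambda>x m. C0 * (1 + rpow \<bar>F (x, m)\<bar> (\<tau> / 2) + \<bar>m * Fm (x, m)\<bar> powr ((1 + \<tau>) / 2)))
      in
       Liminf (top \<times>\<^sub>F at_top) (\<lambda>(x, m). ereal (m * Fm (x, m))) > 0 \<and>
       (\<forall>x. \<forall>w \<in> (\<lambda>m. F (x, m)) ` {0<..}. \<bar>deriv (chi F x) w\<bar> \<le> C0) \<and>
       (\<forall>x. \<forall>m>0. norm (m *\<^sub>R D2 pos_half (Dx pos_half F) (x, m)) \<le> C0 * norm (Dx pos_half F (x, m))) \<and>
       (\<forall>x. \<forall>m>0. norm (Dx pos_half F (x, m)) \<le> bound x m) \<and>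
       (\<forall>x. \<forall>m>0. \<forall>\<xi> \<eta>.
          \<bar>dderiv pos_half (\<eta>, 0) (dderiv pos_half (\<xi>, 0) F) (x, m)\<bar> \<le> bound x m * norm \<xi> * norm \<eta>))"

definition assumption_G :: "((real ^ 'n) \<times> real \<Rightarrow> ereal) \<Rightarrow> bool" where
  "assumption_G g \<longleftrightarrow>
     coupling_regular g \<and>
     (\<forall>x. ((\<lambda>m. g (x, m)) \<longlongrightarrow> (SUP z \<in> UNIV \<times> {0..}. g z)) at_top) \<and>
     (\<forall>x. g (x, 0) = (INF z \<in> UNIV \<times> {0..}. g z))"

definition degenerate_ellipticity ::
  "((real ^ 'n) \<times> real \<Rightarrow> ereal) \<Rightarrow> ((real ^ 'n) \<times> real \<Rightarrow> ereal) \<Rightarrow> bool" where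
  "degenerate_ellipticity f g \<longleftrightarrow> (\<forall>x. f (x, 0) > -\<infinity> \<and> g (x, 0) > -\<infinity>)"

definition x_independent :: "('a \<times> 'b \<Rightarrow> 'c) \<Rightarrow> 'b set \<Rightarrow> bool" where
  "x_independent F B \<longleftrightarrow> (\<forall>x y. \<forall>b\<in>B. F (x, b) = F (y, b))"

section \<open>Classical solutions of the regularized system\<close>

definition classical_solution ::
  "real \<Rightarrow> real \<Rightarrow> ((real ^ 'n) \<times> (real ^ 'n) \<Rightarrow> real) \<Rightarrow> ((real ^ 'n) \<times> real \<Rightarrow> ereal) \<Rightarrow>
   ((real ^ 'n) \<times> real \<Rightarrow> ereal) \<Rightarrow> (real ^ 'n \<Rightarrow> real) \<Rightarrow>
   ((real ^ 'n) \<times> real \<Rightarrow> real) \<Rightarrow> ((real ^ 'n) \<times> real \<Rightarrow> real) \<Rightarrow> bool" where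
  "classical_solution \<epsilon> T H f g m0 u m \<longleftrightarrow>
     (\<forall>t\<in>{0..T}. torus_periodic (\<lambda>x. u (x, t)) \<and> torus_periodic (\<lambda>x. m (x, t))) \<and>
     Ck 3 (closed_cyl T) u \<and> Ck 2 (closed_cyl T) m \<and>
     (\<forall>z \<in> closed_cyl T. m z > 0) \<and>
     (\<forall>x. \<forall>t\<in>{0<..<T}.
        ereal (- D2 (closed_cyl T) u (x, t) + H (x, Dx (closed_cyl T) u (x, t)))
          = f (x, m (x, t)) + ereal (\<epsilon> * ln (m (x, t)))) \<and>
     (\<forall>x. \<forall>t\<in>{0<..<T}.
        D2 (closed_cyl T) m (x, t)
          - divx (closed_cyl T) (\<lambda>z. m z *\<^sub>R DpH H (fst z, Dx (closed_cyl T) u z)) (x, t) = 0) \<and>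
     (\<forall>x. m (x, 0) = m0 x) \<and>
     (\<forall>x. ereal (u (x, T)) = g (x, m (x, T)))"

section \<open>Function spaces for weak solutions\<close>

definition Linf :: "'a::euclidean_space set \<Rightarrow> ('a \<Rightarrow> real) \<Rightarrow> bool" where
  "Linf S \<phi> \<longleftrightarrow> \<phi> \<in> borel_measurable (lebesgue_on S) \<and> (\<exists>K. AE z in lebesgue_on S. \<bar>\<phi> z\<bar> \<le> K)"

definition L2 :: "'a::euclidean_space set \<Rightarrow> ('a \<Rightarrow> 'b::euclidean_space) \<Rightarrow> bool" where
  "L2 S \<phi> \<longleftrightarrow> \<phi> \<in> borel_measurable (lebesgue_on S) \<and> integrable (lebesgue_on S) (\<lambda>z. (norm (\<phi> z))\<^sup>2)"

text \<open>Test functions: compact support in \<open>T^d \<times> (0,T)\<close> only restricts the time variable.\<close>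

definition cyl_supported :: "real \<Rightarrow> ((real ^ 'n) \<times> real \<Rightarrow> 'b::real_normed_vector) \<Rightarrow> bool" where
  "cyl_supported T \<phi> \<longleftrightarrow>
     (\<forall>t. torus_periodic (\<lambda>x. \<phi> (x, t))) \<and>
     (\<exists>a b. 0 < a \<and> a < b \<and> b < T \<and> (\<forall>x t. t \<notin> {a..b} \<longrightarrow> \<phi> (x, t) = 0))"

definition test_function :: "real \<Rightarrow> ((real ^ 'n) \<times> real \<Rightarrow> real) \<Rightarrow> bool" where
  "test_function T \<phi> \<longleftrightarrow> (\<forall>k. Ck k UNIV \<phi>) \<and> cyl_supported T \<phi>"

text \<open>\<open>BV(Q\<^sub>T)\<close>, through finiteness of the total variation of the distributional gradient.\<close>

definition BV_cyl :: "real \<Rightarrow> ((real ^ 'n) \<times> real \<Rightarrow> real) \<Rightarrow> bool" where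
  "BV_cyl T u \<longleftrightarrow>
     integrable (lebesgue_on (cyl_cell T)) u \<and>
     (\<exists>K. \<forall>\<Phi> :: (real ^ 'n) \<times> real \<Rightarrow> (real ^ 'n) \<times> real.
        Ck 1 UNIV \<Phi> \<and> cyl_supported T \<Phi> \<and> (\<forall>z. norm (\<Phi> z) \<le> 1) \<longrightarrow>
        (LINT z|lebesgue_on (cyl_cell T). u z * (\<Sum>b\<in>Basis. dderiv UNIV b \<Phi> z \<bullet> b)) \<le> K)"

text \<open>
  Trace of a BV function on \<open>T^d \<times> {s}\<close>, for \<open>s = 0\<close> or \<open>s = T\<close>: rescaled one-sided \<open>L\<^sup>1\<close>
  oscillations around the trace value vanish at almost every boundary point.
\<close>

definition has_trace ::
  "real \<Rightarrow> ((real ^ 'n) \<times> real \<Rightarrow> real) \<Rightarrow> real \<Rightarrow> (real ^ 'n \<Rightarrow> real) \<Rightarrow> bool" where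
  "has_trace T u s \<theta> \<longleftrightarrow>
     torus_periodic \<theta> \<and> integrable (lebesgue_on cell) \<theta> \<and>
     (AE x in lebesgue.
        ((\<lambda>r. (LINT z|lebesgue_on (open_cyl T \<inter> ball (x, s) r). \<bar>u z - \<theta> x\<bar>) / r ^ (CARD('n) + 1))
           \<longlongrightarrow> 0) (at_right 0))"

text \<open>\<open>w = D\<^sub>xu\<close> in the sense of distributions on \<open>Q\<^sub>T\<close>.\<close>

definition weak_Dx ::
  "real \<Rightarrow> ((real ^ 'n) \<times> real \<Rightarrow> real) \<Rightarrow> ((real ^ 'n) \<times> real \<Rightarrow> real ^ 'n) \<Rightarrow> bool" where
  "weak_Dx T u w \<longleftrightarrow>
     (\<forall>t\<in>{0<..<T}. torus_periodic (\<lambda>x. w (x, t))) \<and>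
     (\<forall>\<phi> i. test_function T \<phi> \<longrightarrow>
        (LINT z|lebesgue_on (cyl_cell T). u z * Dx UNIV \<phi> z $ i)
          = - (LINT z|lebesgue_on (cyl_cell T). w z $ i * \<phi> z))"

text \<open>
  \<open>H\<^sup>1(T^d)\<close>: \<open>H1_grad \<phi> w\<close> says that \<open>\<phi> \<in> H\<^sup>1(T^d)\<close> with weak gradient \<open>w\<close>. \<open>H\<^sup>-\<^sup>1(T^d)\<close> is its dual;
  \<open>Hm1_norm_le L K\<close> says that the dual norm of \<open>L\<close> is at most \<open>K\<close>.
\<close>

definition H1_grad :: "(real ^ 'n \<Rightarrow> real) \<Rightarrow> (real ^ 'n \<Rightarrow> real ^ 'n) \<Rightarrow> bool" where
  "H1_grad \<phi> w \<longleftrightarrow>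
     torus_periodic \<phi> \<and> torus_periodic w \<and> L2 cell \<phi> \<and> L2 cell w \<and>
     (\<forall>\<psi> i. torus_periodic \<psi> \<and> (\<forall>k. Ck k UNIV \<psi>) \<longrightarrow>
        (LINT x|lebesgue_on cell. \<phi> x * dderiv UNIV (axis i 1) \<psi> x)
          = - (LINT x|lebesgue_on cell. w x $ i * \<psi> x))"

definition H1 :: "(real ^ 'n \<Rightarrow> real) \<Rightarrow> bool" where
  "H1 \<phi> \<longleftrightarrow> (\<exists>w. H1_grad \<phi> w)"

definition Hm1_norm_le :: "((real ^ 'n \<Rightarrow> real) \<Rightarrow> real) \<Rightarrow> real \<Rightarrow> bool" where
  "Hm1_norm_le L K \<longleftrightarrow>
     (\<forall>\<phi> w. H1_grad \<phi> w \<longrightarrow>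
        \<bar>L \<phi>\<bar> \<le> K * sqrt (LINT x|lebesgue_on cell. (\<phi> x)\<^sup>2 + (norm (w x))\<^sup>2))"

definition Hm1 :: "((real ^ 'n \<Rightarrow> real) \<Rightarrow> real) \<Rightarrow> bool" where
  "Hm1 L \<longleftrightarrow>
     (\<forall>\<phi> \<psi> a b. H1 \<phi> \<and> H1 \<psi> \<longrightarrow> L (\<lambda>x. a * \<phi> x + b * \<psi> x) = a * L \<phi> + b * L \<psi>) \<and>
     (\<exists>K. Hm1_norm_le L K)"

definition represents :: "((real ^ 'n \<Rightarrow> real) \<Rightarrow> real) \<Rightarrow> (real ^ 'n \<Rightarrow> real) \<Rightarrow> bool" where
  "represents L \<rho> \<longleftrightarrow> (\<forall>\<phi>. H1 \<phi> \<longrightarrow> L \<phi> = (LINT x|lebesgue_on cell. \<rho> x * \<phi> x))"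

text \<open>\<open>\<mu>\<close> is the representative of \<open>m\<close> in \<open>C\<^sup>0([0,T]; H\<^sup>-\<^sup>1(T^d))\<close>.\<close>

definition Hm1_curve ::
  "real \<Rightarrow> ((real ^ 'n) \<times> real \<Rightarrow> real) \<Rightarrow> (real \<Rightarrow> (real ^ 'n \<Rightarrow> real) \<Rightarrow> real) \<Rightarrow> bool" where
  "Hm1_curve T m \<mu> \<longleftrightarrow>
     (\<forall>t\<in>{0..T}. Hm1 (\<mu> t)) \<and>
     (\<forall>t\<in>{0..T}. \<forall>e>0. \<exists>\<delta>>0. \<forall>s\<in>{0..T}. \<bar>s - t\<bar> < \<delta> \<longrightarrow> Hm1_norm_le (\<lambda>\<phi>. \<mu> s \<phi> - \<mu> t \<phi>) e) \<and>
     (AE t in lebesgue_on {0<..<T}. represents (\<mu> t) (\<lambda>x. m (x, t)))"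

section \<open>Weak solutions\<close>

text \<open>
  On \<open>Q\<^sub>T\<close> the functions \<open>u\<close>, \<open>m\<close> are representatives of classes modulo null sets. On the null slices
  \<open>t = 0\<close> and \<open>t = T\<close> we use the convention that \<open>u (\<cdot>, 0)\<close> and \<open>u (\<cdot>, T)\<close> are the traces of \<open>u\<close> and
  \<open>m (\<cdot>, T)\<close> is the value at \<open>T\<close> of the \<open>H\<^sup>-\<^sup>1\<close>-valued curve. The definition is used only when
  \<open>f (x, 0)\<close>, \<open>g (x, 0) > -\<infinity>\<close>, so \<open>real_of_ereal\<close> loses nothing for \<open>m \<ge> 0\<close>, and under the growth
  conditions on the data all integrands are integrable.
\<close>

definition weak_solution ::
  "real \<Rightarrow> ((real ^ 'n) \<times> (real ^ 'n) \<Rightarrow> real) \<Rightarrow> ((real ^ 'n) \<times> real \<Rightarrow> ereal) \<Rightarrow>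
   ((real ^ 'n) \<times> real \<Rightarrow> ereal) \<Rightarrow> (real ^ 'n \<Rightarrow> real) \<Rightarrow>
   ((real ^ 'n) \<times> real \<Rightarrow> real) \<Rightarrow> ((real ^ 'n) \<times> real \<Rightarrow> real) \<Rightarrow> bool" where
  "weak_solution T H f g m0 u m \<longleftrightarrow>
     (\<forall>t\<in>{0..T}. torus_periodic (\<lambda>x. u (x, t)) \<and> torus_periodic (\<lambda>x. m (x, t))) \<and>
     BV_cyl T u \<and> Linf (cyl_cell T) u \<and>
     Linf (cyl_cell T) m \<and> (AE z in lebesgue_on (cyl_cell T). m z \<ge> 0) \<and>
     Linf cell (\<lambda>x. m (x, T)) \<and>
     has_trace T u 0 (\<lambda>x. u (x, 0)) \<and>
     has_trace T u T (\<lambda>x. u (x, T)) \<and>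
     (AE x in lebesgue_on cell. ereal (u (x, T)) = g (x, m (x, T))) \<and>
     (\<exists>\<mu>. Hm1_curve T m \<mu> \<and> represents (\<mu> 0) m0 \<and> represents (\<mu> T) (\<lambda>x. m (x, T))) \<and>
     (\<exists>w. weak_Dx T u w \<and> L2 (cyl_cell T) w \<and>
        (\<forall>\<phi>. test_function T \<phi> \<and> (\<forall>z. \<phi> z \<ge> 0) \<longrightarrow>
           (LINT z|lebesgue_on (cyl_cell T). u z * D2 UNIV \<phi> z + H (fst z, w z) * \<phi> z)
             \<le> (LINT z|lebesgue_on (cyl_cell T). real_of_ereal (f (fst z, m z)) * \<phi> z)) \<and>
        (\<forall>\<phi>. test_function T \<phi> \<longrightarrow>
           (LINT z|lebesgue_on (cyl_cell T).
              - m z * D2 UNIV \<phi> z + m z * (DpH H (fst z, w z) \<bullet> Dx UNIV \<phi> z)) = 0) \<and>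
        (LINT z|lebesgue_on (cyl_cell T).
           m z * (H (fst z, w z) - DpH H (fst z, w z) \<bullet> w z - real_of_ereal (f (fst z, m z))))
          = (LINT x|lebesgue_on cell.
               m (x, T) * real_of_ereal (g (x, m (x, T))) - m0 x * u (x, 0)))"

text \<open>Convergence almost everywhere in \<open>Q\<^sub>T\<close> and, at the terminal time, in \<open>T^d\<close>.\<close>

definition converges_ae ::
  "real \<Rightarrow> (nat \<Rightarrow> (real ^ 'n) \<times> real \<Rightarrow> real) \<Rightarrow> ((real ^ 'n) \<times> real \<Rightarrow> real) \<Rightarrow> bool" where
  "converges_ae T v u \<longleftrightarrow>
     (AE z in lebesgue_on (open_cyl T). (\<lambda>k. v k z) \<longlonglongrightarrow> u z) \<and>
     (AE x in lebesgue. (\<lambda>k. v k (x, T)) \<longlonglongrightarrow> u (x, T))"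

text \<open>
  A function on \<open>T^d\<close> is Lipschitz exactly when its periodic lift is Lipschitz on \<open>R^d\<close>, and likewise
  for \<open>T^d \<times> [0,T]\<close>.
\<close>

definition lipschitz_representative ::
  "'a::euclidean_space set \<Rightarrow> 'a set \<Rightarrow> ('a \<Rightarrow> real) \<Rightarrow> bool" where
  "lipschitz_representative S S' \<phi> \<longleftrightarrow>
     (\<exists>\<psi> K. K-lipschitz_on S' \<psi> \<and> (AE z in lebesgue_on S. \<phi> z = \<psi> z))"

end

theory Submission
  imports Defs
begin

text \<open>
  Since nothing depends on \<open>x\<close>, \<open>u\<close> solves a quasilinear elliptic equation in space-time without
  zero-order terms, and comparing \<open>u\<close> with polynomials of time
  gives \<open>min m\<^sub>0 \<le> m(\<cdot>,T) \<le> max m\<^sub>0\<close> and bounds for \<open>u\<close>. All first derivatives of \<open>u\<close> solve the linearized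
  equation, and \<open>w = H(D\<^sub>xu) - u\<^sub>t\<close>, being a convex function of them, is a subsolution; hence
  \<open>m \<le> max m\<^sub>0\<close> everywhere. The maximum of \<open>|D\<^sub>xu|\<close> is on \<open>t = 0\<close>, where \<open>m = m\<^sub>0\<close> is bounded below
  uniformly in \<open>\<epsilon>\<close>, so a Bernstein argument localized to the region where \<open>m\<close> is not small bounds it
  despite the degeneracy. Then \<open>u\<^sub>t\<close> is bounded on \<open>t = 0\<close> and \<open>t = T\<close>, hence everywhere.
  The Lipschitz bounds pass to almost everywhere limits; since \<open>g\<close> has a Lipschitz inverse on the range
  of \<open>m(\<cdot>,T)\<close>, which stays away from \<open>0\<close>, they are inherited by \<open>m(\<cdot>,T)\<close>.
\<close>

section \<open>Calculus and periodic functions\<close>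

text \<open>The second-order part of the equation is the second derivative along \<open>X\<close>
  plus \<open>ch\<close> times spatial terms, with \<open>ch = m \<phi>'(m)\<close>. Since
  \<open>w\<close> is a subsolution but not a supersolution, the argument has no lower bound for
  \<open>m\<close> in the interior that survives \<epsilon> \<rightarrow> 0, and \<open>ch\<close>
  may degenerate there. Hence the final constants may use the couplings only on densities between
  \<open>\<mu>0 / 2\<close> and \<open>\<mu>1\<close>. At \<open>t = T\<close> the monotonicity of
  both couplings gives the boundary term of \<open>|P|^2\<close> a favourable sign. At
  \<open>t = 0\<close> its sign is open and its size is linear in \<open>P\<close>, while the
  characteristic derivative of \<open>- u\<close> is at least of order \<open>|P|^2\<close> by the
  growth condition and uniform convexity of the Hamiltonian. The correction that exploits this
  creates interior errors, which the squared Hessian of \<open>u\<close> has to absorb. This fixes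
  the order of the constants: first the ellipticity and the error constants, then the small weight
  \<open>c\<close>, and last the threshold \<open>R\<close>, which depends on
  \<open>c\<close>.\<close>

text \<open>The quotient is symmetric in \<open>v\<close> and \<open>w\<close>, so its limit gives
  the symmetry of second derivatives from differentiability of the first derivatives at the single
  point \<open>z\<close>. The mean value theorem is used in the direction \<open>v\<close> only,
  followed by the expansion of \<open>f1\<close> at \<open>z\<close>.\<close>

lemma second_difference_limit:
  fixes f :: "'a::real_normed_vector \<Rightarrow> real"
  assumes "open U" "z \<in> U" and f1: "\<And>y. y \<in> U \<Longrightarrow> (f has_derivative f1 y) (at y)"
    and f2: "((\<lambda>y. f1 y v) has_derivative f2) (at z)"
  shows "((\<lambda>s. (f (z + s *\<^sub>R v + s *\<^sub>R w) - f (z + s *\<^sub>R v) - f (z + s *\<^sub>R w) + f z) / s\<^sup>2)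
           \<longlongrightarrow> f2 w) (at_right 0)"
proof (rule tendstoI)
  fix e0 :: real assume e0: "e0 > 0"
  let ?c = "2 * norm v + norm w"
  \<comment> \<open>The error of the quotient will be at most \<open>e * ?c\<close>; the summand 1
    keeps the division legitimate when \<open>v\<close> and \<open>w\<close> vanish.\<close>
  define e where "e = e0 / (?c + 1)"
  have cpos: "?c + 1 > 0" by (smt (verit) norm_ge_zero)
  have e: "e > 0" using e0 cpos by (simp add: e_def)
  have lin2: "linear f2" using f2 has_derivative_linear by blast
  obtain d where d: "d > 0" "\<And>y. norm (y - z) < d \<Longrightarrow> \<bar>f1 y v - f1 z v - f2 (y - z)\<bar> \<le> e * norm (y - z)"
    using f2 e unfolding has_derivative_at_alt real_norm_def by meson
  obtain r where r: "r > 0" "ball z r \<subseteq> U" using assms(1,2) openE by blast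
  define s0 where "s0 = min d r / (?c + 1)"
  have s0: "s0 > 0" using d(1) r(1) cpos by (simp add: s0_def)
  have main: "dist ((f (z + s *\<^sub>R v + s *\<^sub>R w) - f (z + s *\<^sub>R v) - f (z + s *\<^sub>R w) + f z) / s\<^sup>2) (f2 w) < e0"
    if s: "0 < s" "s < s0" for s
  proof -
    have small: "norm (\<xi> *\<^sub>R v + \<eta> *\<^sub>R w) < min d r"
      if "0 \<le> \<xi>" "\<xi> \<le> s" "0 \<le> \<eta>" "\<eta> \<le> s" for \<xi> \<eta>
    proof -
      have "norm (\<xi> *\<^sub>R v + \<eta> *\<^sub>R w) \<le> \<xi> * norm v + \<eta> * norm w"
        using norm_triangle_ineq[of "\<xi> *\<^sub>R v" "\<eta> *\<^sub>R w"] that by simp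
      also have "\<dots> \<le> s * norm v + s * norm w"
        by (intro add_mono mult_right_mono) (use that in auto)
      also have "\<dots> \<le> s * (?c + 1)" using s by (simp add: algebra_simps)
      also have "\<dots> < s0 * (?c + 1)" using s cpos by simp
      also have "\<dots> = min d r" using cpos by (simp add: s0_def)
      finally show ?thesis .
    qed
    have inU: "z + \<xi> *\<^sub>R v + \<eta> *\<^sub>R w \<in> U"
      if "0 \<le> \<xi>" "\<xi> \<le> s" "0 \<le> \<eta>" "\<eta> \<le> s" for \<xi> \<eta>
    proof -
      have "norm ((z + \<xi> *\<^sub>R v + \<eta> *\<^sub>R w) - z) < r"
        using small[OF that] by (simp add: algebra_simps)
      thus ?thesis using r(2) by (auto simp: dist_norm norm_minus_commute subset_iff)
    qed
    define g where "g \<xi> = f (z + \<xi> *\<^sub>R v + s *\<^sub>R w) - f (z + \<xi> *\<^sub>R v)" for \<xi>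
    have "\<exists>\<xi>. 0 < \<xi> \<and> \<xi> < s \<and> g s - g 0 = (s - 0) * (f1 (z + \<xi> *\<^sub>R v + s *\<^sub>R w) v - f1 (z + \<xi> *\<^sub>R v) v)"
    proof (rule MVT2)
      fix \<xi> assume xi: "0 \<le> \<xi>" "\<xi> \<le> s"
      have gen: "((\<lambda>\<xi>. f (z + \<xi> *\<^sub>R v + \<eta> *\<^sub>R w)) has_real_derivative f1 (z + \<xi> *\<^sub>R v + \<eta> *\<^sub>R w) v) (at \<xi>)"
        if "0 \<le> \<eta>" "\<eta> \<le> s" for \<eta>
      proof -
        have "((\<lambda>\<xi>. z + \<xi> *\<^sub>R v + \<eta> *\<^sub>R w) has_derivative (\<lambda>h. h *\<^sub>R v)) (at \<xi>)"
          by (auto intro!: derivative_eq_intros)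
        from has_derivative_compose[OF this f1[OF inU[OF xi that]]]
        have "((\<lambda>\<xi>. f (z + \<xi> *\<^sub>R v + \<eta> *\<^sub>R w)) has_derivative (\<lambda>h. f1 (z + \<xi> *\<^sub>R v + \<eta> *\<^sub>R w) (h *\<^sub>R v))) (at \<xi>)" .
        moreover have "linear (f1 (z + \<xi> *\<^sub>R v + \<eta> *\<^sub>R w))"
          using f1[OF inU[OF xi that]] has_derivative_linear by blast
        ultimately show ?thesis
          by (simp add: has_field_derivative_def linear_scale mult.commute[of _ "f1 _ _"] fun_eq_iff)
      qed
      show "(g has_real_derivative (f1 (z + \<xi> *\<^sub>R v + s *\<^sub>R w) v - f1 (z + \<xi> *\<^sub>R v) v)) (at \<xi>)"
        unfolding g_def using DERIV_diff[OF gen[of s] gen[of 0]] s by simp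
    qed (use s in auto)
    then obtain \<xi> where xi: "0 < \<xi>" "\<xi> < s"
      and gs: "g s - g 0 = s * (f1 (z + \<xi> *\<^sub>R v + s *\<^sub>R w) v - f1 (z + \<xi> *\<^sub>R v) v)" by auto
    have e1: "\<bar>f1 (z + \<xi> *\<^sub>R v + s *\<^sub>R w) v - f1 z v - f2 (\<xi> *\<^sub>R v + s *\<^sub>R w)\<bar> \<le> e * norm (\<xi> *\<^sub>R v + s *\<^sub>R w)"
      using d(2)[of "z + \<xi> *\<^sub>R v + s *\<^sub>R w"] small[of \<xi> s] xi by (simp add: add.assoc)
    have e2: "\<bar>f1 (z + \<xi> *\<^sub>R v) v - f1 z v - f2 (\<xi> *\<^sub>R v)\<bar> \<le> e * norm (\<xi> *\<^sub>R v)"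
      using d(2)[of "z + \<xi> *\<^sub>R v"] small[of \<xi> 0] xi by simp
    have n1: "norm (\<xi> *\<^sub>R v + s *\<^sub>R w) \<le> s * norm v + s * norm w"
      using norm_triangle_ineq[of "\<xi> *\<^sub>R v" "s *\<^sub>R w"] xi s mult_right_mono[of \<xi> s "norm v"] by simp
    have n2: "norm (\<xi> *\<^sub>R v) \<le> s * norm v" using xi mult_right_mono[of \<xi> s "norm v"] by simp
    have "f2 (\<xi> *\<^sub>R v + s *\<^sub>R w) = f2 (\<xi> *\<^sub>R v) + s * f2 w"
      using lin2 by (simp add: linear_add linear_scale)
    hence "\<bar>f1 (z + \<xi> *\<^sub>R v + s *\<^sub>R w) v - f1 (z + \<xi> *\<^sub>R v) v - s * f2 w\<bar>
        \<le> e * norm (\<xi> *\<^sub>R v + s *\<^sub>R w) + e * norm (\<xi> *\<^sub>R v)"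
      using e1 e2 by linarith
    also have "\<dots> \<le> e * (s * norm v + s * norm w) + e * (s * norm v)"
      using n1 n2 e by (intro add_mono mult_left_mono) auto
    also have "\<dots> = s * (e * ?c)" by (simp add: algebra_simps)
    finally have b: "\<bar>f1 (z + \<xi> *\<^sub>R v + s *\<^sub>R w) v - f1 (z + \<xi> *\<^sub>R v) v - s * f2 w\<bar> \<le> s * (e * ?c)" .
    define A where "A = f1 (z + \<xi> *\<^sub>R v + s *\<^sub>R w) v - f1 (z + \<xi> *\<^sub>R v) v"
    have "(f (z + s *\<^sub>R v + s *\<^sub>R w) - f (z + s *\<^sub>R v) - f (z + s *\<^sub>R w) + f z) / s\<^sup>2 - f2 w = (A - s * f2 w) / s"
    proof -
      have "f (z + s *\<^sub>R v + s *\<^sub>R w) - f (z + s *\<^sub>R v) - f (z + s *\<^sub>R w) + f z = s * A"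
        using gs unfolding A_def g_def by simp
      then show ?thesis using s by (simp add: power2_eq_square field_simps)
    qed
    hence "dist ((f (z + s *\<^sub>R v + s *\<^sub>R w) - f (z + s *\<^sub>R v) - f (z + s *\<^sub>R w) + f z) / s\<^sup>2) (f2 w)
        = \<bar>A - s * f2 w\<bar> / s" using s by (simp add: dist_norm)
    also have "\<dots> \<le> e * ?c" using b s unfolding A_def by (simp add: field_simps)
    also have "\<dots> < e * (?c + 1)" using e by simp
    also have "\<dots> = e0" using cpos by (simp add: e_def)
    finally show ?thesis .
  qed
  show "\<forall>\<^sub>F s in at_right 0. dist ((f (z + s *\<^sub>R v + s *\<^sub>R w) - f (z + s *\<^sub>R v) - f (z + s *\<^sub>R w) + f z) / s\<^sup>2) (f2 w) < e0"
    using s0 main by (auto simp: eventually_at_right_field)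
qed

lemma second_derivative_symmetric:
  fixes f :: "'a::real_normed_vector \<Rightarrow> real"
  assumes "open U" "z \<in> U" "\<And>y. y \<in> U \<Longrightarrow> (f has_derivative f1 y) (at y)"
    and "\<And>v. ((\<lambda>y. f1 y v) has_derivative f2 v) (at z)"
  shows "f2 v w = f2 w v"
proof -
  have 1: "((\<lambda>s. (f (z + s *\<^sub>R v + s *\<^sub>R w) - f (z + s *\<^sub>R v) - f (z + s *\<^sub>R w) + f z) / s\<^sup>2)
           \<longlongrightarrow> f2 v w) (at_right 0)"
    by (rule second_difference_limit[OF assms(1-3)]) (use assms in auto)
  have 2: "((\<lambda>s. (f (z + s *\<^sub>R w + s *\<^sub>R v) - f (z + s *\<^sub>R w) - f (z + s *\<^sub>R v) + f z) / s\<^sup>2)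
           \<longlongrightarrow> f2 w v) (at_right 0)"
    by (rule second_difference_limit[OF assms(1-3)]) (use assms in auto)
  have eq: "(\<lambda>s. (f (z + s *\<^sub>R w + s *\<^sub>R v) - f (z + s *\<^sub>R w) - f (z + s *\<^sub>R v) + f z) / s\<^sup>2)
    = (\<lambda>s. (f (z + s *\<^sub>R v + s *\<^sub>R w) - f (z + s *\<^sub>R v) - f (z + s *\<^sub>R w) + f z) / s\<^sup>2)"
    by (auto simp: fun_eq_iff algebra_simps)
  show ?thesis using tendsto_unique[OF _ 1 2[unfolded eq]] by simp
qed

section \<open>Semidefinite forms as sums of squares\<close>

text \<open>Completing the square in the coordinate \<open>l\<close>: the Schur complement
  \<open>a'\<close> is again semidefinite, and the removed part is one square. If
  \<open>a l l = 0\<close>, then the whole row \<open>l\<close> vanishes, and the convention that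
  division by 0 gives 0 lets the same formulas cover this case.\<close>

lemma psd_sum_of_squares:
  fixes a :: "'i \<Rightarrow> 'i \<Rightarrow> real"
  assumes "finite I" and "\<And>i j. a i j = a j i" and "\<And>x. 0 \<le> (\<Sum>i\<in>I. \<Sum>j\<in>I. a i j * x i * x j)"
  shows "\<exists>(N::nat) b. \<forall>i\<in>I. \<forall>j\<in>I. a i j = (\<Sum>k<N. b k i * b k j)"
  using assms
proof (induction I arbitrary: a rule: finite_induct)
  case empty
  then show ?case by auto
next
  case (insert l I)
  note sym = insert.prems(1) and psd = insert.prems(2)
  have expand: "(\<Sum>i\<in>insert l I. \<Sum>j\<in>insert l I. a i j * x i * x j)
      = (\<Sum>i\<in>I. \<Sum>j\<in>I. a i j * x i * x j) + 2 * x l * (\<Sum>j\<in>I. a l j * x j) + a l l * (x l)\<^sup>2" for x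
  proof -
    have "(\<Sum>i\<in>I. a i l * x i * x l) = x l * (\<Sum>j\<in>I. a l j * x j)"
      unfolding sum_distrib_left by (rule sum.cong) (auto simp: sym[of _ l])
    moreover have "(\<Sum>j\<in>I. a l j * x l * x j) = x l * (\<Sum>j\<in>I. a l j * x j)"
      unfolding sum_distrib_left by (rule sum.cong) auto
    ultimately show ?thesis
      using insert.hyps by (simp add: sum.distrib power2_eq_square)
  qed
  have all: "a l l \<ge> 0"
  proof -
    have "(\<Sum>i\<in>I. \<Sum>j\<in>I. a i j * (if i = l then 1 else 0) * (if j = l then 1 else 0)) = 0"
      "(\<Sum>j\<in>I. a l j * (if j = l then 1 else 0)) = 0"
      using insert.hyps by (auto intro!: sum.neutral)
    then show ?thesis
      using psd[of "\<lambda>i. if i = l then 1 else 0"] by (simp add: expand)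
  qed
  have zero: "a l i = 0" if "a l l = 0" "i \<in> I" for i
  proof (rule ccontr)
    assume nz: "a l i \<noteq> 0"
    define x where "x t j = (if j = l then t else if j = i then 1 else 0 :: real)" for t j
    have ne: "i \<noteq> l" using that insert.hyps by auto
    have "0 \<le> a i i + 2 * t * a l i" for t
    proof -
      have e: "x t j = (if j = i then 1 else 0)" if "j \<in> I" for j
        using that insert.hyps by (auto simp: x_def)
      have "(\<Sum>p\<in>I. \<Sum>j\<in>I. a p j * x t p * x t j) = (\<Sum>p\<in>I. \<Sum>j\<in>I. if p = i then if j = i then a i i else 0 else 0)"
        by (intro sum.cong refl) (auto simp: e)
      also have "\<dots> = (\<Sum>p\<in>I. if p = i then (\<Sum>j\<in>I. if j = i then a i i else 0) else 0)"
        by (intro sum.cong refl) auto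
      also have "\<dots> = a i i" using insert.hyps that by simp
      finally have s1: "(\<Sum>p\<in>I. \<Sum>j\<in>I. a p j * x t p * x t j) = a i i" .
      have "(\<Sum>j\<in>I. a l j * x t j) = (\<Sum>j\<in>I. if j = i then a l i else 0)"
        by (intro sum.cong refl) (auto simp: e)
      also have "\<dots> = a l i" using insert.hyps that by simp
      finally have s2: "(\<Sum>j\<in>I. a l j * x t j) = a l i" .
      show ?thesis using psd[of "x t"] that unfolding expand s1 s2 by (simp add: x_def)
    qed
    \<comment> \<open>At this \<open>t\<close> the form would have the value -1.\<close>
    from this[of "- (a i i + 1) / (2 * a l i)"] show False using nz by (simp add: field_simps)
  qed
  define a' where "a' i j = a i j - a l i * a l j / a l l" for i j
  have "\<exists>(N::nat) b. \<forall>i\<in>I. \<forall>j\<in>I. a' i j = (\<Sum>k<N. b k i * b k j)"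
  proof (rule insert.IH)
    show "a' i j = a' j i" for i j by (simp add: a'_def sym[of i j])
    fix x :: "'i \<Rightarrow> real"
    define S where "S = (\<Sum>j\<in>I. a l j * x j)"
    \<comment> \<open>For \<open>a l l > 0\<close> this coordinate minimizes the form of
      \<open>a\<close> in the direction \<open>l\<close>, and the minimum is the form of
      \<open>a'\<close> at \<open>x\<close>.\<close>
    define y where "y = x(l := - S / a l l)"
    have yx: "y j = x j" if "j \<in> I" for j using that insert.hyps by (auto simp: y_def)
    have 1: "(\<Sum>i\<in>I. \<Sum>j\<in>I. a i j * y i * y j) = (\<Sum>i\<in>I. \<Sum>j\<in>I. a i j * x i * x j)"
      by (intro sum.cong refl) (auto simp: yx)
    have 2: "(\<Sum>j\<in>I. a l j * y j) = S" unfolding S_def by (intro sum.cong refl) (auto simp: yx)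
    have "(\<Sum>i\<in>I. \<Sum>j\<in>I. a' i j * x i * x j)
       = (\<Sum>i\<in>I. \<Sum>j\<in>I. a i j * x i * x j - (a l i * x i) * (a l j * x j) / a l l)"
      by (intro sum.cong refl) (simp add: a'_def field_simps)
    also have "\<dots> = (\<Sum>i\<in>I. \<Sum>j\<in>I. a i j * x i * x j) - S * S / a l l"
      by (simp add: sum_subtractf S_def sum_product sum_divide_distrib)
    also have "\<dots> = (\<Sum>i\<in>I. \<Sum>j\<in>I. a i j * x i * x j) + 2 * y l * S + a l l * (y l)\<^sup>2"
      by (cases "a l l = 0") (simp_all add: y_def field_simps power2_eq_square)
    also have "\<dots> \<ge> 0" using psd[of y] unfolding expand 1 2 .
    finally show "0 \<le> (\<Sum>i\<in>I. \<Sum>j\<in>I. a' i j * x i * x j)" .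
  qed
  then obtain N :: nat and b where b: "\<And>i j. i \<in> I \<Longrightarrow> j \<in> I \<Longrightarrow> a' i j = (\<Sum>k<N. b k i * b k j)" by blast
  \<comment> \<open>The new square has index \<open>N\<close>; the old vectors are extended by 0 in
    the coordinate \<open>l\<close>.\<close>
  define c where "c k i = (if k = N then a l i / sqrt (a l l) else if i = l then 0 else b k i)" for k i
  have "a i j = (\<Sum>k<Suc N. c k i * c k j)" if ij: "i \<in> insert l I" "j \<in> insert l I" for i j
  proof -
    have top: "c N i * c N j = a l i * a l j / a l l" using all by (simp add: c_def)
    have low: "(\<Sum>k<N. c k i * c k j) = (if i = l \<or> j = l then 0 else a' i j)"
    proof (cases "i = l \<or> j = l")
      case False
      hence "(\<Sum>k<N. c k i * c k j) = (\<Sum>k<N. b k i * b k j)"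
        by (intro sum.cong refl) (auto simp: c_def)
      thus ?thesis using b[of i j] False ij by simp
    qed (auto simp: c_def intro!: sum.neutral)
    show ?thesis
    proof (cases "i = l \<or> j = l")
      case True
      have "a i j = a l i * a l j / a l l"
      proof (cases "a l l = 0")
        case True
        thus ?thesis using \<open>i = l \<or> j = l\<close> zero[OF True] ij sym[of i j] by auto
      next
        case False
        thus ?thesis using True sym[of i j] by auto
      qed
      thus ?thesis using True top low by simp
    qed (use top low in \<open>simp add: a'_def\<close>)
  qed
  then show ?case by blast
qed

section \<open>Powers of the positive part and maximum tests\<close>

text \<open>The cube of the positive part is twice differentiable also at 0. This is why the
  truncations in \<open>gradient_bound\<close> enter as cubes: the second-order maximum test then
  applies where they switch on.\<close>

lemma has_real_derivative_pos_cube: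
  "((\<lambda>x::real. (max 0 x) ^ 3) has_real_derivative 3 * (max 0 x)\<^sup>2) (at x)"
proof (cases x "0::real" rule: linorder_cases)
  case less
  have "((\<lambda>x::real. 0) has_real_derivative 3 * (max 0 x)\<^sup>2) (at x)" using less by simp
  then show ?thesis
    by (rule has_field_derivative_transform_within_open[of _ _ _ "{..<0}"]) (use less in auto)
next
  case equal
  have "((\<lambda>h. (max 0 h)\<^sup>2) \<longlongrightarrow> (max 0 0)\<^sup>2) (at (0::real))" by (intro tendsto_intros)
  then have "((\<lambda>h. (max 0 h) ^ 3 / h) \<longlongrightarrow> 0) (at (0::real))"
    by (rule filterlim_cong[THEN iffD1, rotated -1])
      (auto simp: eventually_at_filter max_def power2_eq_square power3_eq_cube)
  then show ?thesis using equal by (simp add: has_field_derivative_iff)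
next
  case greater
  have "((\<lambda>x::real. x ^ 3) has_real_derivative 3 * (max 0 x)\<^sup>2) (at x)"
    using greater by (auto intro!: derivative_eq_intros)
  then show ?thesis
    by (rule has_field_derivative_transform_within_open[of _ _ _ "{0<..}"]) (use greater in auto)
qed

lemma has_real_derivative_pos_square:
  "((\<lambda>x::real. (max 0 x)\<^sup>2) has_real_derivative 2 * max 0 x) (at x)"
proof (cases x "0::real" rule: linorder_cases)
  case less
  have "((\<lambda>x::real. 0) has_real_derivative 2 * max 0 x) (at x)" using less by simp
  then show ?thesis
    by (rule has_field_derivative_transform_within_open[of _ _ _ "{..<0}"]) (use less in auto)
next
  case equal
  have "((\<lambda>h. max 0 h) \<longlongrightarrow> max 0 0) (at (0::real))" by (intro tendsto_intros)
  then have "((\<lambda>h. (max 0 h)\<^sup>2 / h) \<longlongrightarrow> 0) (at (0::real))"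
    by (rule filterlim_cong[THEN iffD1, rotated -1])
      (auto simp: eventually_at_filter max_def power2_eq_square)
  then show ?thesis using equal by (simp add: has_field_derivative_iff)
next
  case greater
  have "((\<lambda>x::real. x\<^sup>2) has_real_derivative 2 * max 0 x) (at x)"
    using greater by (auto intro!: derivative_eq_intros)
  then show ?thesis
    by (rule has_field_derivative_transform_within_open[of _ _ _ "{0<..}"]) (use greater in auto)
qed

text \<open>Here \<open>g1\<close> needs a derivative at 0 only: if it were positive,
  \<open>g1\<close> would be positive just to the right of 0, and the mean value theorem would lift
  \<open>g\<close> above its maximum.\<close>

lemma second_derivative_nonpos_at_max:
  fixes g :: "real \<Rightarrow> real"
  assumes "r > 0" and g: "\<And>s. \<bar>s\<bar> < r \<Longrightarrow> (g has_real_derivative g1 s) (at s)"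
    and g2: "(g1 has_real_derivative g2) (at 0)"
    and mx: "\<And>s. \<bar>s\<bar> < r \<Longrightarrow> g s \<le> g 0"
  shows "g1 0 = 0" "g2 \<le> 0"
proof -
  show z: "g1 0 = 0"
    by (rule DERIV_local_max[OF g[of 0] assms(1)]) (use assms mx in auto)
  show "g2 \<le> 0"
  proof (rule ccontr)
    assume "\<not> g2 \<le> 0"
    then obtain d where d: "d > 0" "\<And>h. 0 < h \<Longrightarrow> h < d \<Longrightarrow> g1 0 < g1 (0 + h)"
      using DERIV_pos_inc_right[OF g2] by auto
    define s where "s = min d r / 2"
    have s: "0 < s" "s < d" "s < r" using d(1) assms(1) by (auto simp: s_def)
    have "\<exists>\<xi>. 0 < \<xi> \<and> \<xi> < s \<and> g s - g 0 = (s - 0) * g1 \<xi>"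
      by (rule MVT2) (use s g in auto)
    then obtain \<xi> where "0 < \<xi>" "\<xi> < s" "g s - g 0 = s * g1 \<xi>" by auto
    then have "g s > g 0" using d(2)[of \<xi>] z s by (smt (verit) mult_pos_pos add_0)
    then show False using mx[of s] s by auto
  qed
qed

lemma has_real_derivative_along_line:
  fixes f :: "'a::real_normed_vector \<Rightarrow> real"
  assumes "(f has_derivative f') (at (z + s *\<^sub>R v))"
  shows "((\<lambda>s. f (z + s *\<^sub>R v)) has_real_derivative f' v) (at s)"
proof -
  have "((\<lambda>s. z + s *\<^sub>R v) has_derivative (\<lambda>h. h *\<^sub>R v)) (at s)"
    by (auto intro!: derivative_eq_intros)
  from has_derivative_compose[OF this assms]
  show ?thesis using has_derivative_linear[OF assms]
    by (simp add: has_field_derivative_def linear_scale mult.commute[of _ "f' _"])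
qed

lemma interior_max_test:
  fixes f :: "'a::real_normed_vector \<Rightarrow> real"
  assumes "open U" "z \<in> U" and f1: "\<And>y. y \<in> U \<Longrightarrow> (f has_derivative f1 y) (at y)"
    and f2: "((\<lambda>y. f1 y v) has_derivative f2) (at z)"
    and mx: "\<And>y. y \<in> U \<Longrightarrow> f y \<le> f z"
  shows "f1 z v = 0" "f2 v \<le> 0"
proof -
  obtain r where r: "r > 0" "ball z r \<subseteq> U" using assms(1,2) openE by blast
  define r' where "r' = r / (norm v + 1)"
  have np: "norm v + 1 > 0" by (smt (verit) norm_ge_zero)
  have r': "r' > 0" using r np by (simp add: r'_def)
  have inU: "z + s *\<^sub>R v \<in> U" if "\<bar>s\<bar> < r'" for s
  proof -
    have "\<bar>s\<bar> * norm v \<le> \<bar>s\<bar> * (norm v + 1)" by (intro mult_left_mono) auto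
    also have "\<dots> < r" using that np by (simp add: r'_def field_simps)
    finally show ?thesis using r(2) by (auto simp: dist_norm subset_iff)
  qed
  have 1: "((\<lambda>s. f (z + s *\<^sub>R v)) has_real_derivative f1 (z + s *\<^sub>R v) v) (at s)" if "\<bar>s\<bar> < r'" for s
    by (rule has_real_derivative_along_line) (rule f1[OF inU[OF that]])
  have 2: "((\<lambda>s. f1 (z + s *\<^sub>R v) v) has_real_derivative f2 v) (at 0)"
    by (rule has_real_derivative_along_line) (use f2 in simp)
  have 3: "f (z + s *\<^sub>R v) \<le> f (z + 0 *\<^sub>R v)" if "\<bar>s\<bar> < r'" for s using mx[OF inU[OF that]] by simp
  show "f1 z v = 0" "f2 v \<le> 0"
    using second_derivative_nonpos_at_max[OF r' 1 2 3] by auto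
qed

section \<open>Periodicity, and Lipschitz limits\<close>

lemma torus_periodic_cell:
  fixes x :: "real ^ 'n"
  obtains k :: "real ^ 'n" where "\<forall>i. k $ i \<in> \<int>" "x + k \<in> cell"
proof
  let ?k = "\<chi> i. - real_of_int \<lfloor>x $ i\<rfloor>"
  show "\<forall>i. ?k $ i \<in> \<int>" by simp
  have bd: "0 \<le> x $ i - real_of_int \<lfloor>x $ i\<rfloor> \<and> x $ i - real_of_int \<lfloor>x $ i\<rfloor> \<le> 1" for i by linarith
  show "x + ?k \<in> cell"
    unfolding cell_def mem_box
  proof
    fix b :: "real ^ 'n" assume b: "b \<in> Basis"
    then obtain i where i: "b = axis i 1" by (auto simp: Basis_vec_def)
    show "0 \<bullet> b \<le> (x + ?k) \<bullet> b \<and> (x + ?k) \<bullet> b \<le> One \<bullet> b"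
    proof -
      have "One \<bullet> b = 1" using b by (simp add: inner_sum_left inner_Basis if_distrib cong: if_cong)
      then show ?thesis using bd[of i] by (simp add: i inner_axis)
    qed
  qed
qed

lemma closed_cyl_max:
  fixes \<psi> :: "(real ^ 'n) \<times> real \<Rightarrow> real"
  assumes "continuous_on (closed_cyl T) \<psi>" "T \<ge> 0"
    and per: "\<And>t. t \<in> {0..T} \<Longrightarrow> torus_periodic (\<lambda>x. \<psi> (x, t))"
  obtains z where "z \<in> closed_cyl T" "\<And>y. y \<in> closed_cyl T \<Longrightarrow> \<psi> y \<le> \<psi> z"
proof -
  have ne: "cell \<times> {0..T} \<noteq> ({} :: ((real^'n) \<times> real) set)"
    using assms(2) torus_periodic_cell[of "0 :: real^'n"] by fastforce
  have comp: "compact (cell \<times> {0..T} :: ((real^'n) \<times> real) set)"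
    unfolding cell_def by (intro compact_Times compact_cbox compact_Icc)
  have "continuous_on (cell \<times> {0..T}) \<psi>" by (rule continuous_on_subset[OF assms(1)]) auto
  from continuous_attains_sup[OF comp ne this]
  obtain z where z: "z \<in> cell \<times> {0..T}" "\<And>y. y \<in> cell \<times> {0..T} \<Longrightarrow> \<psi> y \<le> \<psi> z" by blast
  show ?thesis
  proof (rule that)
    show "z \<in> closed_cyl T" using z(1) by auto
    fix y :: "(real ^ 'n) \<times> real" assume y: "y \<in> closed_cyl T"
    obtain k where k: "\<forall>i. k $ i \<in> \<int>" "fst y + k \<in> cell" using torus_periodic_cell by blast
    have "\<psi> y = \<psi> (fst y + k, snd y)"
      using per[of "snd y"] y k unfolding torus_periodic_def by (cases y) auto
    also have "\<dots> \<le> \<psi> z" using z(2) k y by auto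
    finally show "\<psi> y \<le> \<psi> z" .
  qed
qed

lemma has_derivative_translate_within:
  fixes \<phi> :: "'a::real_normed_vector \<Rightarrow> 'b::real_normed_vector"
  assumes "\<And>y. y \<in> S \<Longrightarrow> y + a \<in> S" "\<And>y. y \<in> S \<Longrightarrow> \<phi> (y + a) = \<phi> y" "z \<in> S"
    and "(\<phi> has_derivative D) (at (z + a) within S)"
  shows "(\<phi> has_derivative D) (at z within S)"
proof -
  have "((\<lambda>y. y + a) has_derivative (\<lambda>h. h)) (at z within S)"
    by (auto intro!: derivative_eq_intros)
  moreover have "(\<phi> has_derivative D) (at (z + a) within ((\<lambda>y. y + a) ` S))"
    by (rule has_derivative_subset[OF assms(4)]) (use assms(1) in auto)
  ultimately have "((\<lambda>y. \<phi> (y + a)) has_derivative (\<lambda>h. D h)) (at z within S)"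
    by (rule has_derivative_in_compose)
  then show ?thesis
    by (rule has_derivative_transform[rotated -1]) (use assms in auto)
qed

text \<open>Both points have exactly the same derivatives within the cylinder, so the choice in
  \<open>frechet_derivative\<close> returns the same value, whether or not the function is
  differentiable there.\<close>

lemma dderiv_periodic:
  fixes \<phi> :: "(real ^ 'n) \<times> real \<Rightarrow> 'b::real_normed_vector"
  assumes per: "\<And>t. t \<in> {0..T} \<Longrightarrow> torus_periodic (\<lambda>x. \<phi> (x, t))" and t: "t \<in> {0..T}"
  shows "torus_periodic (\<lambda>x. dderiv (closed_cyl T) v \<phi> (x, t))"
  unfolding torus_periodic_def
proof (intro allI impI)
  fix x k :: "real ^ 'n" assume k: "\<forall>i. k $ i \<in> \<int>"
  let ?S = "closed_cyl T :: ((real^'n) \<times> real) set"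
  have k': "\<forall>i. (- k) $ i \<in> \<int>" using k by simp
  have sh: "\<phi> (y + (l, 0)) = \<phi> y" if "y \<in> ?S" "\<forall>i. l $ i \<in> \<int>" for y l
    using per[of "snd y"] that unfolding torus_periodic_def by (cases y) auto
  have iff: "(\<phi> has_derivative D) (at (x + k, t) within ?S) \<longleftrightarrow> (\<phi> has_derivative D) (at (x, t) within ?S)" for D
  proof
    assume "(\<phi> has_derivative D) (at (x + k, t) within ?S)"
    then have "(\<phi> has_derivative D) (at ((x, t) + (k, 0)) within ?S)" by simp
    then show "(\<phi> has_derivative D) (at (x, t) within ?S)"
      by (rule has_derivative_translate_within[of ?S "(k, 0)", rotated -1]) (use sh k t in auto)
  next
    assume "(\<phi> has_derivative D) (at (x, t) within ?S)"
    then have "(\<phi> has_derivative D) (at ((x + k, t) + (- k, 0)) within ?S)" by simp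
    then show "(\<phi> has_derivative D) (at (x + k, t) within ?S)"
      by (rule has_derivative_translate_within[of ?S "(- k, 0)", rotated -1]) (use sh k' t in auto)
  qed
  show "dderiv (closed_cyl T) v \<phi> (x + k, t) = dderiv (closed_cyl T) v \<phi> (x, t)"
    unfolding dderiv_def frechet_derivative_def iff ..
qed

text \<open>A nonempty open set is not negligible, so the set \<open>E\<close> of convergence is
  dense in \<open>S\<close>. The Lipschitz bound passes to the limit on \<open>E\<close>, and the
  limit extends from \<open>E\<close> to its closure with the same constant.\<close>

lemma lipschitz_representative_limit:
  fixes v :: "nat \<Rightarrow> 'a::euclidean_space \<Rightarrow> real"
  assumes "open S" "S \<subseteq> S'" "S' \<subseteq> closure S" 
    and lip: "\<forall>\<^sub>F k in sequentially. K-lipschitz_on S' (v k)"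
    and ae: "AE z in lebesgue_on S. (\<lambda>k. v k z) \<longlonglongrightarrow> u z"
  shows "lipschitz_representative S S' u"
proof -
  define E where "E = {z \<in> S. (\<lambda>k. v k z) \<longlonglongrightarrow> u z}"
  have meas: "S \<in> sets lebesgue" using assms(1) by (simp add: borel_open)
  have "AE z in lebesgue. z \<in> S \<longrightarrow> (\<lambda>k. v k z) \<longlonglongrightarrow> u z"
    using ae meas by (subst (asm) AE_restrict_space_iff) auto
  then obtain N where N: "N \<in> null_sets lebesgue" "{z. \<not> (z \<in> S \<longrightarrow> (\<lambda>k. v k z) \<longlonglongrightarrow> u z)} \<subseteq> N"
    unfolding eventually_ae_filter by auto
  have neg: "negligible N" using N(1) by (simp add: negligible_iff_null_sets)
  have "S \<subseteq> closure E"
  proof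
    fix z assume z: "z \<in> S"
    show "z \<in> closure E"
      unfolding closure_iff_nhds_not_empty
    proof (intro allI impI)
      fix A V assume "V \<subseteq> A" "open V" "z \<in> V"
      then have "open (V \<inter> S)" "V \<inter> S \<noteq> {}" using z assms(1) by auto
      then have "\<not> negligible (V \<inter> S)" by (rule open_not_negligible)
      then have "\<not> V \<inter> S \<subseteq> N" using neg negligible_subset by blast
      then obtain y where y: "y \<in> V" "y \<in> S" "y \<notin> N" by auto
      then have "y \<in> E" using N(2) unfolding E_def by auto
      then show "E \<inter> A \<noteq> {}" using y(1) \<open>V \<subseteq> A\<close> by auto
    qed
  qed
  then have cl: "S' \<subseteq> closure E" using assms(3) closure_minimal[of S "closure E"] by auto
  have K: "K \<ge> 0" using eventually_happens'[OF _ lip] lipschitz_on_nonneg by auto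
  have "K-lipschitz_on E u"
  proof (rule lipschitz_onI[OF _ K])
    fix x y assume xy: "x \<in> E" "y \<in> E"
    have "(\<lambda>k. dist (v k x) (v k y)) \<longlonglongrightarrow> dist (u x) (u y)"
      using xy by (intro tendsto_dist) (auto simp: E_def)
    moreover have "\<forall>\<^sub>F k in sequentially. dist (v k x) (v k y) \<le> K * dist x y"
      using lip 
    proof eventually_elim
      case (elim k)
      have "x \<in> S'" "y \<in> S'" using xy assms(2) by (auto simp: E_def)
      then show ?case by (rule lipschitz_onD[OF elim])
    qed
    ultimately show "dist (u x) (u y) \<le> K * dist x y"
      by (rule tendsto_upperbound) simp
  qed
  from lipschitz_extend_closure[OF this]
  obtain g where g: "K-lipschitz_on (closure E) g" "\<And>x. x \<in> E \<Longrightarrow> g x = u x" by blast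
  have "AE z in lebesgue_on S. u z = g z"
    using ae AE_space[of "lebesgue_on S"]
  proof eventually_elim
    case (elim z)
    then have "z \<in> E" by (simp add: E_def)
    then show ?case using g(2) by simp
  qed
  then show ?thesis
    unfolding lipschitz_representative_def using lipschitz_on_subset[OF g(1) cl] by blast
qed

text \<open>The first-order test for points on the faces \<open>t = 0\<close> and
  \<open>t = T\<close>, where only some directions stay in the set.\<close>

lemma derivative_nonpos_at_max_within:
  fixes f :: "'a::real_normed_vector \<Rightarrow> real"
  assumes f': "(f has_derivative f') (at z within S)" and "r > 0"
    and in_S: "\<And>s. 0 \<le> s \<Longrightarrow> s < r \<Longrightarrow> z + s *\<^sub>R v \<in> S"
    and mx: "\<And>y. y \<in> S \<Longrightarrow> f y \<le> f z"
  shows "f' v \<le> 0"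
proof (rule ccontr)
  assume "\<not> f' v \<le> 0"
  have "((\<lambda>s. z + s *\<^sub>R v) has_derivative (\<lambda>h. h *\<^sub>R v)) (at 0 within {0..<r})"
    by (auto intro!: derivative_eq_intros)
  moreover have "(f has_derivative f') (at (z + 0 *\<^sub>R v) within ((\<lambda>s. z + s *\<^sub>R v) ` {0..<r}))"
    using has_derivative_subset[OF f', of "(\<lambda>s. z + s *\<^sub>R v) ` {0..<r}"] in_S by (simp add: image_subset_iff)
  ultimately have "((\<lambda>s. f (z + s *\<^sub>R v)) has_derivative (\<lambda>h. f' (h *\<^sub>R v))) (at 0 within {0..<r})"
    by (rule has_derivative_in_compose)
  then have "((\<lambda>s. f (z + s *\<^sub>R v)) has_real_derivative f' v) (at 0 within {0..<r})"
    using has_derivative_linear[OF f']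
    by (simp add: has_field_derivative_def linear_scale mult.commute[of _ "f' _"])
  from has_real_derivative_pos_inc_right[OF this] \<open>\<not> f' v \<le> 0\<close>
  obtain d where d: "d > 0" "\<And>s. s > 0 \<Longrightarrow> s \<in> {0..<r} \<Longrightarrow> s < d \<Longrightarrow> f z < f (z + s *\<^sub>R v)" by auto
  define s where "s = min d r / 2"
  have "0 < s" "s < d" "s < r" using d(1) assms(2) by (auto simp: s_def)
  then show False using d(2)[of s] mx[OF in_S[of s]] by auto
qed

abbreviation sp :: "real ^ 'n \<Rightarrow> (real ^ 'n) \<times> real" where "sp v \<equiv> (v, 0)"
abbreviation ex :: "'n \<Rightarrow> (real ^ 'n) \<times> real" where "ex i \<equiv> (axis i 1, 0)"

lemma vec_expand: "(v :: real ^ 'n) = (\<Sum>i\<in>UNIV. v $ i *\<^sub>R axis i 1)"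
  using basis_expansion[of v] by (simp add: scalar_mult_eq_scaleR)

lemma linear_expand:
  fixes L :: "real ^ 'n \<Rightarrow> 'b::real_vector"
  assumes "linear L"
  shows "L v = (\<Sum>i\<in>UNIV. v $ i *\<^sub>R L (axis i 1))"
  by (subst vec_expand[of v]) (simp add: linear_sum[OF assms] linear_scale[OF assms])

lemma closed_cyl_shift:
  "z \<in> closed_cyl T \<Longrightarrow> z + s *\<^sub>R (v, 0) \<in> closed_cyl T"
  by (cases z) auto

lemma closed_cyl_subset_closure_open_cyl:
  assumes "T > 0"
  shows "closed_cyl T \<subseteq> closure (open_cyl T :: ((real ^ 'n) \<times> real) set)"
  using assms by (simp add: closure_Times closure_greaterThanLessThan)

lemma has_derivative_vec:
  fixes f :: "'n::finite \<Rightarrow> 'a::real_normed_vector \<Rightarrow> real"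
  assumes "\<And>i. (f i has_derivative f' i) F"
  shows "((\<lambda>z. \<chi> i. f i z) has_derivative (\<lambda>h. \<chi> i. f' i h)) F"
proof -
  have "((\<lambda>z. \<Sum>i\<in>UNIV. f i z *\<^sub>R axis i 1) has_derivative (\<lambda>h. \<Sum>i\<in>UNIV. f' i h *\<^sub>R axis i (1::real))) F"
    by (intro has_derivative_sum has_derivative_scaleR_left assms)
  moreover have "(\<Sum>i\<in>UNIV. c i *\<^sub>R axis i (1::real)) = (\<chi> i. c i)" for c :: "'n \<Rightarrow> real"
    using vec_expand[of "\<chi> i. c i"] by simp
  ultimately show ?thesis by simp
qed

lemma linear_sp:
  fixes L :: "(real ^ 'n) \<times> real \<Rightarrow> 'b::real_vector"
  assumes "linear L"
  shows "linear (\<lambda>v. L (v, 0))"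
  by (rule linearI) (use linear_add[OF assms, of "(_,0)" "(_,0)"] linear_scale[OF assms, of _ "(_,0)"] in auto)

text \<open>The algebra of the interior Bernstein estimate: \<open>a\<close> and \<open>U\<close>
  stand for the Hessian of \<open>u\<close> along \<open>X\<close> and in space,
  \<open>q + s\<close> for the derivative of \<open>Y\<close> along \<open>X\<close>,
  \<open>e\<close> and \<open>r\<close> for the errors. The three smallness conditions pay for
  \<open>s\<close>, \<open>e\<close> and \<open>r\<close> in turn. They spend \<open>k0 / 4\<close>,
  \<open>k0 / 4\<close> and \<open>k0 / 2\<close> of the coefficient \<open>k0\<close> of
  \<open>U\<^sup>2\<close>, so that one is used up entirely.\<close>

lemma bernstein_quadratic_nonneg:
  fixes a U q c :: real
  assumes c: "c \<ge> 0" and Y: "0 \<le> Y" "Y \<le> Ym" and k0: "k0 > 0" "k0 \<le> 1" "k0 \<le> x0"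
    and nonneg: "a \<ge> 0" "U \<ge> 0" "q \<ge> 0" "K2 \<ge> 0" "K3 \<ge> 0" and s: "\<bar>s\<bar> \<le> \<sigma> * U" and r: "r \<le> K2 * (a + U) * q"
    and e: "e \<le> K3 * (a\<^sup>2 + U\<^sup>2)"
    and small: "24 * c * Ym * \<sigma>\<^sup>2 \<le> k0" "12 * c * Ym\<^sup>2 * K3 \<le> k0" "3 * c * Ym ^ 3 * K2\<^sup>2 \<le> k0"
  shows "0 \<le> a\<^sup>2 + x0 * U\<^sup>2 + 6 * c * Y * (q + s)\<^sup>2 - 3 * c * Y\<^sup>2 * (e + r)"
proof -
  have Y2: "Y\<^sup>2 \<le> Ym\<^sup>2" "Y ^ 3 \<le> Ym ^ 3" using Y by (auto intro: power_mono)
  have cY: "0 \<le> c * Y" using c Y by simp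
  have main: "a\<^sup>2 + x0 * U\<^sup>2 \<ge> k0 * a\<^sup>2 + k0 * U\<^sup>2"
    using mult_right_mono[OF k0(2), of "a\<^sup>2"] mult_right_mono[OF k0(3), of "U\<^sup>2"] by simp
  have "s\<^sup>2 \<le> (\<sigma> * U)\<^sup>2" using s by (metis abs_ge_zero power2_abs power_mono)
  moreover have "(q + s)\<^sup>2 \<ge> q\<^sup>2 / 2 - s\<^sup>2"
  proof -
    have "(q + s)\<^sup>2 - (q\<^sup>2 / 2 - s\<^sup>2) = (q + 2 * s)\<^sup>2 / 2" by (simp add: power2_eq_square algebra_simps)
    then show ?thesis by (smt (verit) zero_le_power2 divide_nonneg_pos)
  qed
  ultimately have "(q + s)\<^sup>2 \<ge> q\<^sup>2 / 2 - \<sigma>\<^sup>2 * U\<^sup>2" by (simp add: power_mult_distrib)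
  then have "6 * (c * Y) * (q + s)\<^sup>2 \<ge> 6 * (c * Y) * (q\<^sup>2 / 2 - \<sigma>\<^sup>2 * U\<^sup>2)"
    using cY by (intro mult_left_mono) auto
  moreover have "6 * (c * Y) * (\<sigma>\<^sup>2 * U\<^sup>2) \<le> k0 / 4 * U\<^sup>2"
  proof -
    have "6 * (c * Y) * \<sigma>\<^sup>2 \<le> 6 * (c * Ym) * \<sigma>\<^sup>2"
      using c Y by (intro mult_right_mono mult_left_mono) auto
    also have "\<dots> \<le> k0 / 4" using small(1) by simp
    finally have "6 * (c * Y) * \<sigma>\<^sup>2 \<le> k0 / 4" .
    from mult_right_mono[OF this zero_le_power2[of U]] show ?thesis by (simp add: mult.assoc)
  qed
  ultimately have t1: "6 * c * Y * (q + s)\<^sup>2 \<ge> 3 * c * Y * q\<^sup>2 - k0 / 4 * U\<^sup>2"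
    by (simp add: algebra_simps)
  have t2: "3 * c * Y\<^sup>2 * e \<le> k0 / 4 * (a\<^sup>2 + U\<^sup>2)"
  proof -
    have "3 * c * Y\<^sup>2 * e \<le> 3 * c * Y\<^sup>2 * (K3 * (a\<^sup>2 + U\<^sup>2))" using e c by (intro mult_left_mono) auto
    also have "\<dots> \<le> 3 * c * Ym\<^sup>2 * (K3 * (a\<^sup>2 + U\<^sup>2))"
      using c Y2 nonneg by (intro mult_right_mono mult_left_mono) auto
    also have "\<dots> = (12 * c * Ym\<^sup>2 * K3) / 4 * (a\<^sup>2 + U\<^sup>2)" by simp
    also have "\<dots> \<le> k0 / 4 * (a\<^sup>2 + U\<^sup>2)" by (intro mult_right_mono divide_right_mono small(2)) auto
    finally show ?thesis .
  qed
  \<comment> \<open>Young's inequality is applied to \<open>g * q * a\<close> and to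
    \<open>g * q * U\<close>; the third smallness condition makes the two resulting multiples of
    \<open>q\<^sup>2\<close> together at most \<open>3 * c * Y * q\<^sup>2\<close>, which is what
    \<open>t1\<close> leaves available.\<close>
  define g where "g = 3 * c * Y\<^sup>2 * K2"
  have young: "g * q * y \<le> k0 / 2 * y\<^sup>2 + g\<^sup>2 / (2 * k0) * q\<^sup>2" for y
  proof -
    have "0 \<le> (k0 * y - g * q)\<^sup>2 / (2 * k0)" using k0 by simp
    also have "\<dots> = k0 / 2 * y\<^sup>2 + g\<^sup>2 / (2 * k0) * q\<^sup>2 - g * q * y"
      using k0 by (simp add: power2_eq_square field_simps)
    finally show ?thesis by simp
  qed
  have "g\<^sup>2 / k0 \<le> 3 * c * Y"
  proof -
    have "g\<^sup>2 = 3 * c * Y * (3 * c * Y ^ 3 * K2\<^sup>2)" by (simp add: g_def power2_eq_square power3_eq_cube)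
    also have "\<dots> \<le> 3 * c * Y * k0"
    proof (intro mult_left_mono)
      have "3 * c * Y ^ 3 * K2\<^sup>2 \<le> 3 * c * Ym ^ 3 * K2\<^sup>2"
        using c Y2 by (intro mult_right_mono mult_left_mono) auto
      then show "3 * c * Y ^ 3 * K2\<^sup>2 \<le> k0" using small(3) by linarith
    qed (use c Y in auto)
    finally show ?thesis using k0 by (simp add: field_simps)
  qed
  then have gq: "g\<^sup>2 / (2 * k0) * q\<^sup>2 * 2 \<le> 3 * c * Y * q\<^sup>2"
    using mult_right_mono[of "g\<^sup>2 / k0" "3 * c * Y" "q\<^sup>2"] by simp
  have t3: "3 * c * Y\<^sup>2 * r \<le> k0 / 2 * a\<^sup>2 + k0 / 2 * U\<^sup>2 + 3 * c * Y * q\<^sup>2"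
  proof -
    have "3 * c * Y\<^sup>2 * r \<le> 3 * c * Y\<^sup>2 * (K2 * (a + U) * q)" using r c by (intro mult_left_mono) auto
    also have "\<dots> = g * q * a + g * q * U" by (simp add: g_def algebra_simps)
    finally show ?thesis using young[of a] young[of U] gq by linarith
  qed
  have "0 \<le> k0 / 4 * a\<^sup>2" using k0 by simp
  then show ?thesis using main t1 t2 t3 by (simp only: distrib_left)
qed

section \<open>A priori estimates for classical solutions\<close>

text \<open>
  A classical solution with the derivatives of the data and of the solution as explicit functions:
  \<open>u1 z v\<close>, \<open>u2 z v w\<close>, \<open>u3 z v w y\<close> are iterated directional derivatives of \<open>u\<close>, the last argument
  being the last direction of differentiation, and \<open>h\<close>, \<open>\<phi>\<close>, \<open>G\<close> stand for \<open>H(p)\<close>, \<open>f(m) + \<epsilon> log m\<close>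
  and \<open>g(m)\<close>. Further, \<open>P = D\<^sub>xu\<close>, \<open>\<beta> z W\<close> is the derivative of \<open>P\<close> along \<open>W\<close>, and
  \<open>\<theta> = div D\<^sub>pH(D\<^sub>xu)\<close>.
\<close>

locale mfg_solution =
  fixes T C0 :: real
    and h :: "real ^ 'n \<Rightarrow> real" and hp :: "real ^ 'n \<Rightarrow> real ^ 'n"
    and hpp :: "real ^ 'n \<Rightarrow> real ^ 'n \<Rightarrow> real ^ 'n"
    and hppp :: "real ^ 'n \<Rightarrow> real ^ 'n \<Rightarrow> real ^ 'n \<Rightarrow> real ^ 'n"
    and \<phi> \<phi>1 \<phi>2 G G1 :: "real \<Rightarrow> real"
    and m0 :: "real ^ 'n \<Rightarrow> real" and m01 :: "real ^ 'n \<Rightarrow> real ^ 'n \<Rightarrow> real"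
    and u m :: "(real ^ 'n) \<times> real \<Rightarrow> real"
    and u1 m1 :: "(real ^ 'n) \<times> real \<Rightarrow> (real ^ 'n) \<times> real \<Rightarrow> real"
    and u2 :: "(real ^ 'n) \<times> real \<Rightarrow> (real ^ 'n) \<times> real \<Rightarrow> (real ^ 'n) \<times> real \<Rightarrow> real"
    and u3 :: "(real ^ 'n) \<times> real \<Rightarrow> (real ^ 'n) \<times> real \<Rightarrow> (real ^ 'n) \<times> real \<Rightarrow> (real ^ 'n) \<times> real \<Rightarrow> real"
    and P :: "(real ^ 'n) \<times> real \<Rightarrow> real ^ 'n"
    and \<beta> :: "(real ^ 'n) \<times> real \<Rightarrow> (real ^ 'n) \<times> real \<Rightarrow> real ^ 'n"
    and \<theta> :: "(real ^ 'n) \<times> real \<Rightarrow> real"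
  defines "P \<equiv> \<lambda>z. \<chi> i. u1 z (ex i)"
    and "\<beta> \<equiv> \<lambda>z W. \<chi> i. u2 z (ex i) W"
    and "\<theta> \<equiv> \<lambda>z. \<Sum>i\<in>UNIV. hpp (P z) (\<beta> z (ex i)) $ i"
  assumes T_pos: "T > 0" and C0_pos: "C0 > 0"
    and h_deriv: "\<And>p. (h has_derivative (\<lambda>v. hp p \<bullet> v)) (at p)"
    and hp_deriv: "\<And>p. (hp has_derivative hpp p) (at p)"
    and hpp_deriv: "\<And>p v. ((\<lambda>p. hpp p v) has_derivative hppp p v) (at p)"
    and hpp_sym: "\<And>p v w. hpp p v \<bullet> w = hpp p w \<bullet> v"
    and hpp_lower: "\<And>p v. v \<bullet> v / C0 \<le> hpp p v \<bullet> v"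
    and hpp_upper: "\<And>p v. hpp p v \<bullet> v \<le> C0 * (v \<bullet> v)"
    and h_growth: "\<And>p. hp p \<bullet> p \<ge> 2 * h p - C0"
    and hppp_bound: "\<And>p v v' v''. \<bar>hppp p v v' \<bullet> v''\<bar> * (1 + norm p) \<le> C0 * norm v * norm v' * norm v''"
    and \<phi>_deriv: "\<And>s. s > 0 \<Longrightarrow> (\<phi> has_real_derivative \<phi>1 s) (at s)"
    and \<phi>1_deriv: "\<And>s. s > 0 \<Longrightarrow> (\<phi>1 has_real_derivative \<phi>2 s) (at s)"
    and \<phi>2_cont: "continuous_on {0<..} \<phi>2"
    and \<phi>1_pos: "\<And>s. s > 0 \<Longrightarrow> \<phi>1 s > 0"
    and G_deriv: "\<And>s. s > 0 \<Longrightarrow> (G has_real_derivative G1 s) (at s)"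
    and G1_pos: "\<And>s. s > 0 \<Longrightarrow> G1 s > 0"
    and u_deriv: "\<And>z. z \<in> closed_cyl T \<Longrightarrow> (u has_derivative u1 z) (at z within closed_cyl T)"
    and u1_deriv: "\<And>z v. z \<in> closed_cyl T \<Longrightarrow> ((\<lambda>z. u1 z v) has_derivative u2 z v) (at z within closed_cyl T)"
    and u2_deriv: "\<And>z v w. z \<in> closed_cyl T \<Longrightarrow> ((\<lambda>z. u2 z v w) has_derivative u3 z v w) (at z within closed_cyl T)"
    and m_deriv: "\<And>z. z \<in> closed_cyl T \<Longrightarrow> (m has_derivative m1 z) (at z within closed_cyl T)"
    and m0_deriv: "\<And>x. (m0 has_derivative m01 x) (at x)"
    and u_per: "\<And>t. t \<in> {0..T} \<Longrightarrow> torus_periodic (\<lambda>x. u (x, t))"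
    and m_per: "\<And>t. t \<in> {0..T} \<Longrightarrow> torus_periodic (\<lambda>x. m (x, t))"
    and u1_per: "\<And>t v. t \<in> {0..T} \<Longrightarrow> torus_periodic (\<lambda>x. u1 (x, t) v)"
    and u2_per: "\<And>t v w. t \<in> {0..T} \<Longrightarrow> torus_periodic (\<lambda>x. u2 (x, t) v w)"
    and m_pos: "\<And>z. z \<in> closed_cyl T \<Longrightarrow> m z > 0"
    and hjb: "\<And>z. z \<in> open_cyl T \<Longrightarrow> h (P z) - u1 z (0, 1) = \<phi> (m z)"
    and transport: "\<And>z. z \<in> open_cyl T \<Longrightarrow> m1 z (- hp (P z), 1) = m z * \<theta> z"
    and initial: "\<And>x. m (x, 0) = m0 x"
    and terminal: "\<And>x. u (x, T) = G (m (x, T))"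
begin

section \<open>Differential calculus of the solution\<close>

abbreviation "S \<equiv> closed_cyl T :: ((real ^ 'n) \<times> real) set"
abbreviation "U \<equiv> open_cyl T :: ((real ^ 'n) \<times> real) set"

lemma U_open: "open U" by (simp add: open_Times)
lemma U_S: "z \<in> U \<Longrightarrow> z \<in> S" by auto

lemma at_U: "z \<in> U \<Longrightarrow> at z within S = at z"
  by (rule at_within_open_subset[OF _ U_open]) auto

text \<open>The equations and the symmetry of derivatives are first known in the interior; this
  carries identities between continuous functions to the faces \<open>t = 0\<close> and
  \<open>t = T\<close>.\<close>

lemma eq_on_closure:
  fixes f g :: "(real ^ 'n) \<times> real \<Rightarrow> real"
  assumes "continuous_on S f" "continuous_on S g" "\<And>z. z \<in> U \<Longrightarrow> f z = g z" "z \<in> S"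
  shows "f z = g z"
proof -
  have "closure U = S" using T_pos by (simp add: closure_Times closure_greaterThanLessThan)
  then show ?thesis
    using continuous_constant_on_closure[of U "\<lambda>z. f z - g z" 0 z] assms
    by (auto intro: continuous_intros)
qed

lemma differentiable_continuous_on:
  assumes "\<And>z. z \<in> S \<Longrightarrow> (f has_derivative f' z) (at z within S)"
  shows "continuous_on S f"
  using assms by (meson continuous_on_eq_continuous_within has_derivative_continuous)

lemma u1_linear: "z \<in> S \<Longrightarrow> linear (u1 z)"
  using u_deriv has_derivative_linear by blast

lemma u2_linear: "z \<in> S \<Longrightarrow> linear (u2 z v)"
  using u1_deriv has_derivative_linear by blast

lemma u3_linear: "z \<in> S \<Longrightarrow> linear (u3 z v w)"
  using u2_deriv has_derivative_linear by blast

lemma hpp_linear: "linear (hpp p)"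
  using hp_deriv has_derivative_linear by blast

lemma u2_sym: assumes "z \<in> S" shows "u2 z v w = u2 z w v"
proof (rule eq_on_closure[OF _ _ _ assms])
  show "continuous_on S (\<lambda>z. u2 z v w)" "continuous_on S (\<lambda>z. u2 z w v)"
    by (rule differentiable_continuous_on[OF u2_deriv]; assumption)+
  fix z assume z: "z \<in> U"
  show "u2 z v w = u2 z w v"
  proof (rule second_derivative_symmetric[OF U_open z])
    show "(u has_derivative u1 y) (at y)" if "y \<in> U" for y
      using u_deriv[OF U_S[OF that]] at_U[OF that] by simp
    show "((\<lambda>y. u1 y v) has_derivative u2 z v) (at z)" for v
      using u1_deriv[OF U_S[OF z]] at_U[OF z] by simp
  qed
qed

lemma u3_sym12: assumes z: "z \<in> U" shows "u3 z v w = u3 z w v"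
proof -
  have 1: "((\<lambda>z. u2 z v w) has_derivative u3 z v w) (at z)" "((\<lambda>z. u2 z w v) has_derivative u3 z w v) (at z)"
    using u2_deriv[OF U_S[OF z]] at_U[OF z] by simp_all
  have "((\<lambda>z. u2 z v w) has_derivative u3 z w v) (at z)"
    by (rule has_derivative_transform_within_open[OF 1(2) U_open z]) (use u2_sym U_S in blast)
  then show ?thesis using has_derivative_unique[OF 1(1)] by blast
qed

lemma u3_sym23: assumes z: "z \<in> U" shows "u3 z v w y = u3 z v y w"
proof (rule second_derivative_symmetric[OF U_open z])
  show "((\<lambda>z. u1 z v) has_derivative u2 x v) (at x)" if "x \<in> U" for x
    using u1_deriv[OF U_S[OF that]] at_U[OF that] by simp
  show "((\<lambda>y. u2 y v w) has_derivative u3 z v w) (at z)" for w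
    using u2_deriv[OF U_S[OF z]] at_U[OF z] by simp
qed

lemma u3_sym13: "z \<in> U \<Longrightarrow> u3 z v w y = u3 z y w v"
  by (metis u3_sym12 u3_sym23)

lemma split_linear:
  assumes "linear (L :: (real ^ 'n) \<times> real \<Rightarrow> real)"
  shows "L (x, s) = (\<chi> i. L (ex i)) \<bullet> x + s * L (0, 1)"
proof -
  have lx: "linear (\<lambda>x. L (x, 0))"
    by (rule linearI) (use linear_add[OF assms, of "(_,0)" "(_,0)"] linear_scale[OF assms, of _ "(_,0)"] in auto)
  have "L (x, s) = L (x, 0) + L (0, s)" using linear_add[OF assms, of "(x,0)" "(0,s)"] by simp
  moreover have "L (0, s) = s * L (0, 1)" using linear_scale[OF assms, of s "(0,1)"] by simp
  moreover have "L (x, 0) = (\<chi> i. L (ex i)) \<bullet> x"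
    by (subst linear_expand[OF lx]) (simp add: inner_vec_def mult.commute)
  ultimately show ?thesis by simp
qed

lemma u1_split: "z \<in> S \<Longrightarrow> u1 z (x, s) = P z \<bullet> x + s * u1 z (0, 1)"
  unfolding P_def by (rule split_linear[OF u1_linear])

lemma u2_linear1: "z \<in> S \<Longrightarrow> linear (\<lambda>v. u2 z v w)"
  using u2_linear[of z w] by (simp add: u2_sym[of z _ w])

lemma u2_split: "z \<in> S \<Longrightarrow> u2 z (x, s) W = x \<bullet> \<beta> z W + s * u2 z (0, 1) W"
  unfolding \<beta>_def using split_linear[OF u2_linear1, of z x s W] by (simp add: inner_commute[of x])

lemma u3_linear1: "z \<in> U \<Longrightarrow> linear (\<lambda>v. u3 z v W Y)"
  using u3_linear[OF U_S, of z Y W] by (simp add: u3_sym13[of z _ W Y])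

lemma u3_linear2: "z \<in> U \<Longrightarrow> linear (\<lambda>v. u3 z V v Y)"
  using u3_linear[OF U_S, of z V Y] by (simp add: u3_sym23[of z V _ Y])

text \<open>The second derivative of \<open>P\<close>, along \<open>V\<close> and then
  \<open>W\<close>.\<close>

definition "\<gamma> z V W = (\<chi> i. u3 z (ex i) V W)"

lemma u3_split: "z \<in> U \<Longrightarrow> u3 z (x, s) V W = x \<bullet> \<gamma> z V W + s * u3 z (0, 1) V W"
  unfolding \<gamma>_def using split_linear[OF u3_linear1, of z x s V W] by (simp add: inner_commute[of x])

lemma \<beta>_linear: assumes "z \<in> S" shows "linear (\<beta> z)"
  by (rule linearI) (auto simp: \<beta>_def vec_eq_iff linear_add[OF u2_linear[OF assms]] linear_scale[OF u2_linear[OF assms]])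

lemma P_deriv: "z \<in> S \<Longrightarrow> (P has_derivative \<beta> z) (at z within S)"
  unfolding P_def \<beta>_def by (intro has_derivative_vec u1_deriv)

lemma \<beta>_deriv: "z \<in> S \<Longrightarrow> ((\<lambda>z. \<beta> z V) has_derivative \<gamma> z V) (at z within S)"
  unfolding \<gamma>_def[abs_def] \<beta>_def by (intro has_derivative_vec u2_deriv)

text \<open>Linearity in the first increment is not part of \<open>hpp_deriv\<close>; it is
  inherited from \<open>hpp\<close> by uniqueness of the derivative.\<close>

lemma hppp_linear: "linear (\<lambda>v. hppp p v w)"
proof (rule linearI)
  fix a b
  have "((\<lambda>p. hpp p a + hpp p b) has_derivative (\<lambda>w. hppp p a w + hppp p b w)) (at p)"
    by (intro derivative_intros hpp_deriv)
  then have "((\<lambda>p. hpp p (a + b)) has_derivative (\<lambda>w. hppp p a w + hppp p b w)) (at p)"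
    by (simp add: linear_add[OF hpp_linear])
  then show "hppp p (a + b) w = hppp p a w + hppp p b w"
    using has_derivative_unique[OF hpp_deriv] by metis
next
  fix r :: real and b
  have "((\<lambda>p. r *\<^sub>R hpp p b) has_derivative (\<lambda>w. r *\<^sub>R hppp p b w)) (at p)"
    by (intro derivative_intros hpp_deriv)
  then have "((\<lambda>p. hpp p (r *\<^sub>R b)) has_derivative (\<lambda>w. r *\<^sub>R hppp p b w)) (at p)"
    by (simp add: linear_scale[OF hpp_linear])
  then show "hppp p (r *\<^sub>R b) w = r *\<^sub>R hppp p b w"
    using has_derivative_unique[OF hpp_deriv] by metis
qed

text \<open>Since \<open>hpp_deriv\<close> differentiates in \<open>p\<close> for a fixed vector,
  \<open>g\<close> is expanded in the standard basis and the product rule is applied to each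
  term.\<close>

lemma hpp_comp_deriv:
  fixes f g :: "(real ^ 'n) \<times> real \<Rightarrow> real ^ 'n"
  assumes f: "(f has_derivative f') (at z within A)" and g: "(g has_derivative g') (at z within A)"
  shows "((\<lambda>z. hpp (f z) (g z)) has_derivative (\<lambda>e. hppp (f z) (g z) (f' e) + hpp (f z) (g' e))) (at z within A)"
proof -
  have gi: "((\<lambda>z. g z $ i) has_derivative (\<lambda>e. g' e $ i)) (at z within A)" for i
    by (rule bounded_linear.has_derivative[OF bounded_linear_vec_nth g])
  have hi: "((\<lambda>z. hpp (f z) v) has_derivative (\<lambda>e. hppp (f z) v (f' e))) (at z within A)" for v
    by (rule has_derivative_compose[OF f hpp_deriv])
  have "((\<lambda>z. \<Sum>i\<in>UNIV. g z $ i *\<^sub>R hpp (f z) (axis i 1)) has_derivative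
     (\<lambda>e. \<Sum>i\<in>UNIV. g z $ i *\<^sub>R hppp (f z) (axis i 1) (f' e) + g' e $ i *\<^sub>R hpp (f z) (axis i 1))) (at z within A)"
    by (intro has_derivative_sum has_derivative_scaleR gi hi)
  moreover have "(\<Sum>i\<in>UNIV. g z $ i *\<^sub>R hppp (f z) (axis i 1) (f' e) + g' e $ i *\<^sub>R hpp (f z) (axis i 1))
     = hppp (f z) (g z) (f' e) + hpp (f z) (g' e)" for e
    by (simp add: sum.distrib linear_expand[OF hppp_linear, of "f z" "g z"] linear_expand[OF hpp_linear, of "f z" "g' e"])
  moreover have "(\<Sum>i\<in>UNIV. g z $ i *\<^sub>R hpp (f z) (axis i 1)) = hpp (f z) (g z)" for z
    by (simp add: linear_expand[OF hpp_linear, of "f z" "g z"])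
  ultimately show ?thesis by simp
qed

text \<open>
  \<open>X\<close> is the characteristic direction and \<open>w = \<phi>(m)\<close>; the continuity equation becomes
  \<open>X w = m \<phi>'(m) \<theta>\<close>.
\<close>

definition "X z = (- hp (P z), 1 :: real)"
definition "w z = h (P z) - u1 z (0, 1)"
definition "w1 z W = - u2 z (X z) W"
text \<open>The Hessian of \<open>w\<close> in the interior. The first term comes from
  differentiating the direction \<open>X\<close> and is the convexity term; the second is the third
  derivative of \<open>u\<close> with \<open>X z\<close> frozen.\<close>

definition "w2 z V W = hpp (P z) (\<beta> z W) \<bullet> \<beta> z V - u3 z (X z) V W"

lemma w1_eq: "z \<in> S \<Longrightarrow> w1 z W = hp (P z) \<bullet> \<beta> z W - u2 z (0, 1) W"
  by (simp add: w1_def X_def u2_split[of z "- hp (P z)" 1])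

lemma w_deriv: assumes "z \<in> S" shows "(w has_derivative w1 z) (at z within S)"
proof -
  have "((\<lambda>z. h (P z)) has_derivative (\<lambda>W. hp (P z) \<bullet> \<beta> z W)) (at z within S)"
    by (rule has_derivative_compose[OF P_deriv[OF assms] h_deriv])
  from has_derivative_diff[OF this u1_deriv[OF assms, of "(0,1)"]]
  show ?thesis unfolding w_def[abs_def] by (simp add: w1_eq[OF assms, abs_def])
qed

lemma w1_deriv: assumes "z \<in> S" shows "((\<lambda>z. w1 z V) has_derivative (\<lambda>W. hpp (P z) (\<beta> z W) \<bullet> \<beta> z V + hp (P z) \<bullet> \<gamma> z V W - u3 z (0, 1) V W)) (at z within S)"
proof -
  have "((\<lambda>z. hp (P z)) has_derivative (\<lambda>W. hpp (P z) (\<beta> z W))) (at z within S)"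
    by (rule has_derivative_compose[OF P_deriv[OF assms] hp_deriv])
  from has_derivative_inner[OF this \<beta>_deriv[OF assms, of V]]
  have "((\<lambda>z. hp (P z) \<bullet> \<beta> z V - u2 z (0, 1) V) has_derivative
    (\<lambda>W. hp (P z) \<bullet> \<gamma> z V W + hpp (P z) (\<beta> z W) \<bullet> \<beta> z V - u3 z (0, 1) V W)) (at z within S)"
    by (intro has_derivative_diff u2_deriv[OF assms])
  then have "((\<lambda>z. hp (P z) \<bullet> \<beta> z V - u2 z (0, 1) V) has_derivative
    (\<lambda>W. hpp (P z) (\<beta> z W) \<bullet> \<beta> z V + hp (P z) \<bullet> \<gamma> z V W - u3 z (0, 1) V W)) (at z within S)"
    by (simp add: add.commute)
  then show ?thesis by (rule has_derivative_transform[rotated -1]) (use assms w1_eq in auto)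
qed

lemma w2_eq: "z \<in> U \<Longrightarrow> w2 z V W = hpp (P z) (\<beta> z W) \<bullet> \<beta> z V + hp (P z) \<bullet> \<gamma> z V W - u3 z (0, 1) V W"
  by (simp add: w2_def X_def u3_split[of z "- hp (P z)" 1])

lemma w1_deriv_U: assumes "z \<in> U" shows "((\<lambda>z. w1 z V) has_derivative w2 z V) (at z)"
proof -
  have "w2 z V = (\<lambda>W. hpp (P z) (\<beta> z W) \<bullet> \<beta> z V + hp (P z) \<bullet> \<gamma> z V W - u3 z (0, 1) V W)"
    by (rule ext) (rule w2_eq[OF assms])
  then show ?thesis using w1_deriv[OF U_S[OF assms], of V] at_U[OF assms] by simp
qed

lemma w1_linear: "z \<in> S \<Longrightarrow> linear (w1 z)"
  using w_deriv has_derivative_linear by blast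

lemma w_\<phi>: assumes "z \<in> S" shows "w z = \<phi> (m z)"
proof (rule eq_on_closure[OF _ _ _ assms])
  show "continuous_on S w" by (rule differentiable_continuous_on[OF w_deriv])
  have "continuous_on {0<..} \<phi>"
    by (meson DERIV_continuous_on \<phi>_deriv greaterThan_iff has_field_derivative_at_within)
  moreover have "continuous_on S m" by (rule differentiable_continuous_on[OF m_deriv])
  ultimately show "continuous_on S (\<lambda>z. \<phi> (m z))"
    by (rule continuous_on_compose2) (use m_pos in auto)
  show "w z = \<phi> (m z)" if "z \<in> U" for z using hjb[OF that] by (simp add: w_def)
qed

lemma \<phi>m_deriv: "z \<in> S \<Longrightarrow> ((\<lambda>z. \<phi> (m z)) has_derivative (\<lambda>W. \<phi>1 (m z) * m1 z W)) (at z within S)"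
  using has_derivative_compose[OF m_deriv \<phi>_deriv[OF m_pos, unfolded has_field_derivative_def]] by blast

lemma w1_m1: assumes "z \<in> U" shows "w1 z W = \<phi>1 (m z) * m1 z W"
proof -
  have a: "((\<lambda>z. \<phi> (m z)) has_derivative (\<lambda>W. \<phi>1 (m z) * m1 z W)) (at z)"
    using \<phi>m_deriv[OF U_S[OF assms]] at_U[OF assms] by simp
  have "(w has_derivative (\<lambda>W. \<phi>1 (m z) * m1 z W)) (at z)"
    by (rule has_derivative_transform_within_open[OF a U_open assms]) (use w_\<phi> U_S in force)
  moreover have "(w has_derivative w1 z) (at z)" using w_deriv[OF U_S[OF assms]] at_U[OF assms] by simp
  ultimately show ?thesis using has_derivative_unique by metis
qed

section \<open>The continuity equation and its linearization\<close>

text \<open>The function \<open>chi\<close> of the assumptions, for \<phi> in place of the coupling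
  and evaluated along the solution; it is the weight of the spatial second-order terms.\<close>

definition "ch z = m z * \<phi>1 (m z)"
text \<open>The derivative of \<open>ch\<close> with respect to the value
  \<open>w = \<phi>(m)\<close>.\<close>

definition "chw z = (\<phi>1 (m z) + m z * \<phi>2 (m z)) / \<phi>1 (m z)"

lemma ch_pos: "z \<in> S \<Longrightarrow> ch z > 0"
  unfolding ch_def using m_pos \<phi>1_pos by simp

lemma w1_X: "z \<in> U \<Longrightarrow> w1 z (X z) = ch z * \<theta> z"
  using w1_m1[of z "X z"] transport[of z] by (simp add: X_def ch_def)

lemma ch_deriv: assumes "z \<in> S"
  shows "(ch has_derivative (\<lambda>W. (\<phi>1 (m z) + m z * \<phi>2 (m z)) * m1 z W)) (at z within S)"
proof -
  have "((\<lambda>z. \<phi>1 (m z)) has_derivative (\<lambda>W. \<phi>2 (m z) * m1 z W)) (at z within S)"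
    using has_derivative_compose[OF m_deriv[OF assms] \<phi>1_deriv[OF m_pos[OF assms], unfolded has_field_derivative_def]] .
  from has_derivative_mult[OF m_deriv[OF assms] this]
  show ?thesis unfolding ch_def[abs_def] by (simp add: algebra_simps)
qed

definition "\<theta>1 z e = (\<Sum>i\<in>UNIV. (hppp (P z) (\<beta> z (ex i)) (\<beta> z e) + hpp (P z) (\<gamma> z (ex i) e)) $ i)"

lemma \<theta>_deriv: assumes "z \<in> S" shows "(\<theta> has_derivative \<theta>1 z) (at z within S)"
  unfolding \<theta>_def \<theta>1_def
  by (intro has_derivative_sum bounded_linear.has_derivative[OF bounded_linear_vec_nth]
      hpp_comp_deriv P_deriv \<beta>_deriv assms)

text \<open>The identity \<open>w1 z (X z) = ch z * \<theta> z\<close> is differentiated along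
  \<open>e\<close>. This costs one derivative of \<open>m\<close> and three of \<open>u\<close>. The
  direction \<open>X\<close> varies with the point, so the left side is first split into components;
  its variation gives the term with \<open>hpp\<close>.\<close>

lemma linearized:
  assumes "z \<in> U"
  shows "w2 z (X z) e - hpp (P z) (\<beta> z e) \<bullet> (\<chi> i. w1 z (ex i))
    = chw z * w1 z e * \<theta> z + ch z * \<theta>1 z e"
proof -
  let ?L = "\<lambda>z. w1 z (0, 1) - hp (P z) \<bullet> (\<chi> i. w1 z (ex i))"
  have z: "z \<in> S" using assms by (rule U_S)
  have L: "?L y = ch y * \<theta> y" if "y \<in> U" for y
    using w1_X[OF that] split_linear[OF w1_linear[OF U_S[OF that]], of "- hp (P y)" 1]
    by (simp add: X_def inner_commute[of _ "hp _"])
  have "((\<lambda>z. hp (P z)) has_derivative (\<lambda>W. hpp (P z) (\<beta> z W))) (at z)"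
    using has_derivative_compose[OF P_deriv[OF z] hp_deriv] at_U[OF assms] by simp
  then have dL: "(?L has_derivative (\<lambda>e. w2 z (0,1) e - (hp (P z) \<bullet> (\<chi> i. w2 z (ex i) e) + hpp (P z) (\<beta> z e) \<bullet> (\<chi> i. w1 z (ex i))))) (at z)"
    by (intro has_derivative_diff has_derivative_inner has_derivative_vec w1_deriv_U assms)
  have "((\<lambda>z. ch z * \<theta> z) has_derivative (\<lambda>e. ch z * \<theta>1 z e + (\<phi>1 (m z) + m z * \<phi>2 (m z)) * m1 z e * \<theta> z)) (at z)"
    using has_derivative_mult[OF ch_deriv[OF z] \<theta>_deriv[OF z]] at_U[OF assms] by simp
  then have "(?L has_derivative (\<lambda>e. ch z * \<theta>1 z e + (\<phi>1 (m z) + m z * \<phi>2 (m z)) * m1 z e * \<theta> z)) (at z)"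
    by (rule has_derivative_transform_within_open[OF _ U_open assms]) (simp add: L)
  from fun_cong[OF has_derivative_unique[OF dL this], of e]
  have 1: "w2 z (0,1) e - (hp (P z) \<bullet> (\<chi> i. w2 z (ex i) e) + hpp (P z) (\<beta> z e) \<bullet> (\<chi> i. w1 z (ex i)))
     = ch z * \<theta>1 z e + (\<phi>1 (m z) + m z * \<phi>2 (m z)) * m1 z e * \<theta> z" .
  have "linear (\<lambda>V. w2 z V e)"
  proof -
    have "linear (\<lambda>V. hpp (P z) (\<beta> z e) \<bullet> \<beta> z V)"
      by (rule linearI) (simp_all add: linear_add[OF \<beta>_linear[OF z]] linear_scale[OF \<beta>_linear[OF z]] inner_add_right)
    from linear_compose_sub[OF this u3_linear2[OF assms]] show ?thesis unfolding w2_def .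
  qed
  from split_linear[OF this, of "- hp (P z)" 1]
  have 2: "w2 z (X z) e = w2 z (0,1) e - hp (P z) \<bullet> (\<chi> i. w2 z (ex i) e)"
    by (simp add: X_def inner_commute)
  have 3: "(\<phi>1 (m z) + m z * \<phi>2 (m z)) * m1 z e = chw z * w1 z e"
    using \<phi>1_pos[OF m_pos[OF z]] by (simp add: chw_def w1_m1[OF assms])
  show ?thesis using 1 unfolding 2 3 by simp
qed

section \<open>The elliptic operator and the equations for \<open>u\<close>, its derivatives and
  \<open>w\<close>\<close>

text \<open>The number of squares and their vectors are chosen separately for each \<open>p\<close>,
  with no regularity in \<open>p\<close>: they serve at one point at a time and are never
  differentiated.\<close>

definition "hpp_squares p = (SOME Nb :: nat \<times> (nat \<Rightarrow> real ^ 'n).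
   \<forall>v w. hpp p v \<bullet> w = (\<Sum>k<fst Nb. (snd Nb k \<bullet> v) * (snd Nb k \<bullet> w)))"

abbreviation "dN z \<equiv> fst (hpp_squares (P z))"
abbreviation "db z \<equiv> snd (hpp_squares (P z))"

lemma hpp_psd: "0 \<le> hpp p v \<bullet> v"
  using hpp_lower[of v p] C0_pos by (smt (verit) divide_nonneg_pos inner_ge_zero)

lemma hpp_squares: "hpp p v \<bullet> y = (\<Sum>k<fst (hpp_squares p). (snd (hpp_squares p) k \<bullet> v) * (snd (hpp_squares p) k \<bullet> y))"
proof -
  define a where "a i j = hpp p (axis i 1) $ j" for i j
  have a: "(\<Sum>i\<in>UNIV. \<Sum>j\<in>UNIV. a i j * v $ i * w $ j) = hpp p v \<bullet> w" for v w
  proof -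
    have "hpp p v \<bullet> w = (\<Sum>i\<in>UNIV. v $ i * (hpp p (axis i 1) \<bullet> w))"
      by (subst linear_expand[OF hpp_linear]) (simp add: inner_sum_left)
    then show ?thesis by (simp add: a_def inner_vec_def sum_distrib_left algebra_simps)
  qed
  have sym: "a i j = a j i" for i j
    using hpp_sym[of p "axis i 1" "axis j 1"] by (simp add: a_def inner_axis)
  have "\<exists>(N::nat) c. \<forall>i\<in>UNIV. \<forall>j\<in>UNIV. a i j = (\<Sum>k<N. c k i * c k j)"
  proof (rule psd_sum_of_squares)
    fix x :: "'n \<Rightarrow> real"
    show "0 \<le> (\<Sum>i\<in>UNIV. \<Sum>j\<in>UNIV. a i j * x i * x j)"
      using a[of "\<chi> i. x i" "\<chi> i. x i"] hpp_psd[of p "\<chi> i. x i"] by simp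
  qed (use sym in auto)
  then obtain N :: nat and c where c: "\<And>i j. a i j = (\<Sum>k<N. c k i * c k j)" by auto
  have "hpp p v \<bullet> w = (\<Sum>k<N. ((\<chi> i. c k i) \<bullet> v) * ((\<chi> i. c k i) \<bullet> w))" for v w
  proof -
    have "hpp p v \<bullet> w = (\<Sum>i\<in>UNIV. \<Sum>j\<in>UNIV. \<Sum>k<N. (c k i * v $ i) * (c k j * w $ j))"
      unfolding a[symmetric] c by (simp add: sum_distrib_left sum_distrib_right algebra_simps)
    also have "\<dots> = (\<Sum>i\<in>UNIV. \<Sum>k<N. \<Sum>j\<in>UNIV. (c k i * v $ i) * (c k j * w $ j))"
      by (intro sum.cong refl sum.swap)
    also have "\<dots> = (\<Sum>k<N. \<Sum>i\<in>UNIV. \<Sum>j\<in>UNIV. (c k i * v $ i) * (c k j * w $ j))"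
      by (rule sum.swap)
    also have "\<dots> = (\<Sum>k<N. ((\<chi> i. c k i) \<bullet> v) * ((\<chi> i. c k i) \<bullet> w))"
      by (simp add: inner_vec_def sum_product)
    finally show ?thesis .
  qed
  then have "\<exists>Nb :: nat \<times> (nat \<Rightarrow> real ^ 'n). \<forall>v w. hpp p v \<bullet> w = (\<Sum>k<fst Nb. (snd Nb k \<bullet> v) * (snd Nb k \<bullet> w))"
    by (intro exI[of _ "(N, \<lambda>k. \<chi> i. c k i)"]) simp
  from someI_ex[OF this] show ?thesis unfolding hpp_squares_def by blast
qed

text \<open>A trace against \<open>hpp\<close> becomes a sum of values of a form on pairs of equal
  vectors. In this shape the sign of a Hessian at a maximum passes to the operator.\<close>

lemma trace_squares:
  assumes "linear g"
  shows "(\<Sum>i\<in>UNIV. hpp p (g (axis i 1)) $ i) = (\<Sum>k<fst (hpp_squares p). snd (hpp_squares p) k \<bullet> g (snd (hpp_squares p) k))"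
proof -
  let ?b = "snd (hpp_squares p)" and ?N = "fst (hpp_squares p)"
  have "hpp p (g (axis i 1)) $ i = (\<Sum>k<?N. (?b k \<bullet> g (axis i 1)) * ?b k $ i)" for i
    using hpp_squares[of p "g (axis i 1)" "axis i 1"] by (simp add: inner_axis)
  then have "(\<Sum>i\<in>UNIV. hpp p (g (axis i 1)) $ i) = (\<Sum>k<?N. \<Sum>i\<in>UNIV. (?b k \<bullet> g (axis i 1)) * ?b k $ i)"
    by (simp only:) (rule sum.swap)
  also have "\<dots> = (\<Sum>k<?N. ?b k \<bullet> g (?b k))"
  proof (intro sum.cong refl)
    fix k
    have "g (?b k) = (\<Sum>i\<in>UNIV. ?b k $ i *\<^sub>R g (axis i 1))" by (rule linear_expand[OF assms])
    then show "(\<Sum>i\<in>UNIV. (?b k \<bullet> g (axis i 1)) * ?b k $ i) = ?b k \<bullet> g (?b k)"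
      by (simp add: inner_sum_right mult.commute)
  qed
  finally show ?thesis .
qed

text \<open>
  With \<open>D\<^sup>2\<^sub>p\<^sub>pH\<close> decomposed into squares, \<open>ellip\<close> applied to a Hessian is the second-order part of the
  linearized quasilinear equation for \<open>u\<close>, and \<open>drift\<close> applied to a differential is the opposite of its
  first-order part.
\<close>

definition "ellip z Q = Q (X z) (X z) + ch z * (\<Sum>k<dN z. Q (sp (db z k)) (sp (db z k)))"

definition "drift z \<xi> = 2 * (hpp (P z) (\<chi> i. \<xi> (ex i)) \<bullet> \<beta> z (X z)) + chw z * \<theta> z * \<xi> (X z)
   - ch z * (\<Sum>i\<in>UNIV. hppp (P z) (\<beta> z (ex i)) (\<chi> i. \<xi> (ex i)) $ i)"

lemma ellip_add: "ellip z (\<lambda>V W. Q V W + R V W) = ellip z Q + ellip z R"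
  by (simp add: ellip_def sum.distrib algebra_simps)

lemma ellip_diff: "ellip z (\<lambda>V W. Q V W - R V W) = ellip z Q - ellip z R"
  by (simp add: ellip_def sum_subtractf algebra_simps)

lemma ellip_cmult: "ellip z (\<lambda>V W. c * Q V W) = c * ellip z Q"
  by (simp add: ellip_def sum_distrib_left algebra_simps)

lemma ellip_ge_X: "z \<in> S \<Longrightarrow> (\<And>W. Q W W \<ge> 0) \<Longrightarrow> ellip z Q \<ge> Q (X z) (X z)"
  using ch_pos[of z] unfolding ellip_def by (simp add: sum_nonneg)

lemma ellip_nonneg: "z \<in> S \<Longrightarrow> (\<And>W. Q W W \<ge> 0) \<Longrightarrow> ellip z Q \<ge> 0"
  using ellip_ge_X[of z Q] by (meson order_trans)

lemma ellip_nonpos: "z \<in> S \<Longrightarrow> (\<And>W. Q W W \<le> 0) \<Longrightarrow> ellip z Q \<le> 0"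
  using ellip_nonneg[of z "\<lambda>V W. (- 1) * Q V W"] unfolding ellip_cmult by simp

lemma ellip_time: "ellip z (\<lambda>V W. snd V * snd W) = 1"
  by (simp add: ellip_def X_def)

lemma hppp_linear2: "linear (hppp p v)"
  using hpp_deriv has_derivative_linear by blast

lemma drift_add: "drift z (\<lambda>W. \<xi> W + \<eta> W) = drift z \<xi> + drift z \<eta>"
proof -
  have "(\<chi> i. \<xi> (ex i) + \<eta> (ex i)) = (\<chi> i. \<xi> (ex i)) + (\<chi> i. \<eta> (ex i))" by (simp add: vec_eq_iff)
  then show ?thesis
    by (simp add: drift_def linear_add[OF hpp_linear] linear_add[OF hppp_linear2] sum.distrib
        inner_add_left algebra_simps)
qed

lemma drift_cmult: "drift z (\<lambda>W. c * \<xi> W) = c * drift z \<xi>"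
proof -
  have "(\<chi> i. c * \<xi> (ex i)) = c *\<^sub>R (\<chi> i. \<xi> (ex i))" by (simp add: vec_eq_iff)
  then show ?thesis
    by (simp add: drift_def linear_scale[OF hpp_linear] linear_scale[OF hppp_linear2] sum_distrib_left
        algebra_simps)
qed

lemma drift_minus: "drift z (\<lambda>W. - \<xi> W) = - drift z \<xi>"
  using drift_cmult[of z "-1" \<xi>] by simp

lemma drift_time: "drift z snd = chw z * \<theta> z"
proof -
  have "(\<chi> i. snd (ex i)) = (0 :: real ^ 'n)" by (simp add: vec_eq_iff)
  then show ?thesis
    by (simp add: drift_def linear_0[OF hpp_linear] linear_0[OF hppp_linear2] X_def)
qed

lemma u2_sp: "z \<in> S \<Longrightarrow> u2 z (sp v) W = v \<bullet> \<beta> z W"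
  using u2_split[of z v 0 W] by simp

lemma u3_sp: "z \<in> U \<Longrightarrow> u3 z (sp v) V W = v \<bullet> \<gamma> z V W"
  using u3_split[of z v 0 V W] by simp

lemma \<theta>_squares: assumes "z \<in> S" shows "\<theta> z = (\<Sum>k<dN z. u2 z (sp (db z k)) (sp (db z k)))"
proof -
  have "linear (\<lambda>v. \<beta> z (sp v))"
    by (rule linear_sp[OF \<beta>_linear[OF assms]])
  from trace_squares[OF this] show ?thesis unfolding \<theta>_def by (simp add: u2_sp[OF assms])
qed

text \<open>The quasilinear equation for \<open>u\<close>: it is \<open>w1_X\<close>, because
  \<open>w1 z (X z)\<close> is minus the second derivative of \<open>u\<close> along
  \<open>X\<close> and \<theta> is a sum over the squares.\<close>

lemma ellip_u2: assumes "z \<in> U" shows "ellip z (u2 z) = 0"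
  using w1_X[OF assms] \<theta>_squares[OF U_S[OF assms]] by (simp add: ellip_def w1_def)

lemma \<theta>1_squares: assumes "z \<in> U"
  shows "\<theta>1 z e = (\<Sum>i\<in>UNIV. hppp (P z) (\<beta> z (ex i)) (\<beta> z e) $ i)
     + (\<Sum>k<dN z. u3 z (sp (db z k)) (sp (db z k)) e)"
proof -
  have "linear (\<lambda>V. \<gamma> z V e)"
    by (rule linearI) (auto simp: \<gamma>_def vec_eq_iff linear_add[OF u3_linear2[OF assms]]
        linear_scale[OF u3_linear2[OF assms]])
  then have "linear (\<lambda>v. \<gamma> z (sp v) e)" by (rule linear_sp)
  from trace_squares[OF this] show ?thesis
    unfolding \<theta>1_def by (simp add: u3_sp[OF assms] sum.distrib)
qed

lemma grad_w: assumes "z \<in> S" shows "(\<chi> i. w1 z (ex i)) = - \<beta> z (X z)"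
  by (simp add: vec_eq_iff w1_def \<beta>_def u2_sym[OF assms, of "X z"])

text \<open>The linearized equation for the first derivative of \<open>u\<close> along
  \<open>e\<close>, obtained by solving \<open>linearized\<close> for the third derivative along
  \<open>X\<close>, \<open>X\<close>, \<open>e\<close>. The terms from differentiating the
  coefficients make up \<open>drift\<close>; its factor 2 reflects the two slots filled by
  \<open>X\<close>.\<close>

lemma ellip_u3: assumes "z \<in> U" shows "ellip z (\<lambda>V W. u3 z V W e) = drift z (u2 z e)"
proof -
  have z: "z \<in> S" using assms by (rule U_S)
  have 1: "(\<chi> i. u2 z e (ex i)) = \<beta> z e" by (simp add: \<beta>_def vec_eq_iff u2_sym[OF z, of e])
  have 2: "w1 z e = - u2 z e (X z)" by (simp add: w1_def u2_sym[OF z, of "X z"])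
  have 3: "u3 z (X z) (X z) e = 2 * (hpp (P z) (\<beta> z e) \<bullet> \<beta> z (X z)) - chw z * w1 z e * \<theta> z - ch z * \<theta>1 z e"
    using linearized[OF assms, of e] by (simp add: grad_w[OF z] w2_def)
  show ?thesis
    unfolding ellip_def drift_def 1 3 unfolding 2 \<theta>1_squares[OF assms] by (simp add: algebra_simps)
qed

lemma u3_rotate: "z \<in> U \<Longrightarrow> u3 z e V W = u3 z V W e"
  by (metis u3_sym12 u3_sym23)

text \<open>With \<open>X z\<close> frozen, the third-order part of \<open>w2\<close> obeys the
  linearized equation and contributes exactly \<open>drift z (w1 z)\<close>. What remains is the
  convexity term, which is nonnegative.\<close>

lemma ellip_w2: assumes "z \<in> U" shows "ellip z (w2 z) \<ge> drift z (w1 z)"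
proof -
  have "ellip z (w2 z) = ellip z (\<lambda>V W. hpp (P z) (\<beta> z W) \<bullet> \<beta> z V) - ellip z (\<lambda>V W. u3 z (X z) V W)"
    unfolding ellip_diff[symmetric] w2_def[abs_def] ..
  also have "ellip z (\<lambda>V W. u3 z (X z) V W) = drift z (u2 z (X z))"
    using ellip_u3[OF assms, of "X z"] by (simp add: u3_rotate[OF assms, of "X z"])
  also have "\<dots> = - drift z (w1 z)"
    unfolding w1_def[abs_def] by (simp add: drift_minus)
  finally show ?thesis
    using ellip_nonneg[OF U_S[OF assms], of "\<lambda>V W. hpp (P z) (\<beta> z W) \<bullet> \<beta> z V"] hpp_psd by auto
qed

section \<open>Maximum tests along the solution\<close>

lemma P_per: "t \<in> {0..T} \<Longrightarrow> torus_periodic (\<lambda>x. P (x, t))"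
  using u1_per unfolding torus_periodic_def P_def by auto

lemma w_per: "t \<in> {0..T} \<Longrightarrow> torus_periodic (\<lambda>x. w (x, t))"
  using u1_per P_per unfolding torus_periodic_def w_def by auto

lemma \<theta>_per: "t \<in> {0..T} \<Longrightarrow> torus_periodic (\<lambda>x. \<theta> (x, t))"
  using u2_per P_per unfolding torus_periodic_def \<theta>_def \<beta>_def by auto

text \<open>This bound depends on the solution and need not be uniform in \<epsilon>. It does no
  harm, since \<alpha> enters later only through a product \<open>\<delta> * \<alpha>\<close> with
  \<delta> at free choice.\<close>

lemma drift_bounded:
  obtains \<alpha> where "\<alpha> > 0" "\<And>z. z \<in> S \<Longrightarrow> \<bar>chw z * \<theta> z\<bar> < \<alpha>"
proof -
  have m: "continuous_on S m" by (rule differentiable_continuous_on[OF m_deriv])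
  have \<phi>1: "continuous_on {0<..} \<phi>1"
    by (meson DERIV_continuous_on \<phi>1_deriv greaterThan_iff has_field_derivative_at_within)
  have 1: "continuous_on S (\<lambda>z. \<phi>1 (m z))" "continuous_on S (\<lambda>z. \<phi>2 (m z))"
    using m_pos by (auto intro: continuous_on_compose2[OF \<phi>1 m] continuous_on_compose2[OF \<phi>2_cont m])
  have 2: "continuous_on S \<theta>" by (rule differentiable_continuous_on[OF \<theta>_deriv])
  have nz: "\<forall>z\<in>S. \<phi>1 (m z) \<noteq> 0" using \<phi>1_pos m_pos by (metis less_irrefl)
  have cont: "continuous_on S (\<lambda>z. \<bar>chw z * \<theta> z\<bar>)"
    unfolding chw_def by (intro continuous_intros 1 2 m nz)
  have per: "torus_periodic (\<lambda>x. \<bar>chw (x, t) * \<theta> (x, t)\<bar>)" if "t \<in> {0..T}" for t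
    using m_per[OF that] \<theta>_per[OF that] unfolding torus_periodic_def chw_def by auto
  obtain z where z: "\<And>y. y \<in> S \<Longrightarrow> \<bar>chw y * \<theta> y\<bar> \<le> \<bar>chw z * \<theta> z\<bar>"
    using closed_cyl_max[OF cont less_imp_le[OF T_pos] per] by blast
  show ?thesis
  proof (rule that)
    show "\<bar>chw z * \<theta> z\<bar> + 1 > 0" by linarith
    show "\<bar>chw y * \<theta> y\<bar> < \<bar>chw z * \<theta> z\<bar> + 1" if "y \<in> S" for y using z[OF that] by linarith
  qed
qed

text \<open>Spatial directions can be followed both ways inside \<open>S\<close>, even on the faces,
  so the spatial derivative vanishes at every maximum; in time only the inward direction is
  available on a face.\<close>

lemma max_dichotomy:
  assumes f: "\<And>z. z \<in> S \<Longrightarrow> (f has_derivative f1 z) (at z within S)"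
    and f2: "\<And>z V. z \<in> U \<Longrightarrow> ((\<lambda>z. f1 z V) has_derivative f2 z V) (at z)"
    and per: "\<And>t. t \<in> {0..T} \<Longrightarrow> torus_periodic (\<lambda>x. f (x, t))"
  obtains z where "z \<in> S" "\<And>y. y \<in> S \<Longrightarrow> f y \<le> f z" "\<And>v. f1 z (v, 0) = 0"
    "snd z = 0 \<and> f1 z (0, 1) \<le> 0 \<or> snd z = T \<and> f1 z (0, 1) \<ge> 0 \<or>
     z \<in> U \<and> f1 z = (\<lambda>W. 0) \<and> ellip z (f2 z) \<le> 0"
proof -
  obtain z where z: "z \<in> S" "\<And>y. y \<in> S \<Longrightarrow> f y \<le> f z"
    using closed_cyl_max[OF differentiable_continuous_on[OF f] less_imp_le[OF T_pos] per] by blast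
  have lin: "linear (f1 z)" using f[OF z(1)] has_derivative_linear by blast
  have le: "f1 z (v, 0) \<le> 0" for v
    by (rule derivative_nonpos_at_max_within[OF f[OF z(1)], of 1])
      (use z closed_cyl_shift in auto)
  have sp: "f1 z (v, 0) = 0" for v
    using le[of v] le[of "- v"] linear_neg[OF lin, of "(v, 0)"] by simp
  have t: "snd z = 0 \<or> snd z = T \<or> z \<in> U" using z(1) by (cases z) auto
  have "snd z = 0 \<and> f1 z (0, 1) \<le> 0 \<or> snd z = T \<and> f1 z (0, 1) \<ge> 0 \<or>
     z \<in> U \<and> f1 z = (\<lambda>W. 0) \<and> ellip z (f2 z) \<le> 0"
    using t
  proof (elim disjE)
    assume 0: "snd z = 0"
    have "f1 z (0, 1) \<le> 0"
      by (rule derivative_nonpos_at_max_within[OF f[OF z(1)] T_pos]) (use z 0 in \<open>cases z, auto\<close>)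
    then show ?thesis using 0 by simp
  next
    assume 0: "snd z = T"
    have "f1 z (- (0, 1)) \<le> 0"
      by (rule derivative_nonpos_at_max_within[OF f[OF z(1)] T_pos]) (use z 0 in \<open>cases z, auto\<close>)
    then show ?thesis using 0 linear_neg[OF lin, of "(0, 1)"] by simp
  next
    assume U: "z \<in> U"
    have f': "(f has_derivative f1 y) (at y)" if "y \<in> U" for y using f[OF U_S[OF that]] at_U[OF that] by simp
    have *: "f1 z W = 0" "f2 z W W \<le> 0" for W
      using interior_max_test[OF U_open U f' f2[OF U, of W]] z(2)[OF U_S] by blast+
    then show ?thesis using U ellip_nonpos[OF z(1), of "f2 z"] by auto
  qed
  then show ?thesis using that[OF z sp] by blast
qed

section \<open>Bounds for the density, the value function and subsolutions\<close>

lemma \<phi>_less: "0 < r \<Longrightarrow> r < s \<Longrightarrow> \<phi> r < \<phi> s"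
  by (rule DERIV_pos_imp_increasing[of r s \<phi>]) (meson \<phi>_deriv \<phi>1_pos less_le_trans | assumption)+

lemma G_less: "0 < r \<Longrightarrow> r < s \<Longrightarrow> G r < G s"
  by (rule DERIV_pos_imp_increasing[of r s G]) (meson G_deriv G1_pos less_le_trans | assumption)+

lemma \<phi>_le_iff: "0 < r \<Longrightarrow> 0 < s \<Longrightarrow> \<phi> r \<le> \<phi> s \<longleftrightarrow> r \<le> s"
  by (metis \<phi>_less linorder_not_le order_le_less)

lemma G_le_iff: "0 < r \<Longrightarrow> 0 < s \<Longrightarrow> G r \<le> G s \<longleftrightarrow> r \<le> s"
  by (metis G_less linorder_not_le order_le_less)

text \<open>The two signs of \<open>\<sigma>\<close> give the upper and the lower bounds.\<close>

lemma comparison: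
  assumes \<sigma>: "\<sigma> = 1 \<or> \<sigma> = - 1" and \<mu>: "\<mu> > 0" and m0: "\<And>x. \<sigma> * m0 x \<le> \<sigma> * \<mu>" and \<delta>: "\<delta> > 0"
    and k: "k = \<sigma> * (\<phi> \<mu> - h 0) + \<delta>"
  obtains x where "\<And>y. \<sigma> * m (y, T) \<le> \<sigma> * m (x, T)" "\<sigma> * \<phi> (m (x, T)) \<le> \<sigma> * \<phi> \<mu> + \<delta> * (1 + 2 * T)"
    "\<And>z. z \<in> S \<Longrightarrow> \<sigma> * u z + k * snd z + \<delta> * (snd z)\<^sup>2 \<le> \<sigma> * u (x, T) + k * T + \<delta> * T\<^sup>2"
proof -
  define f where "f z = \<sigma> * u z + k * snd z + \<delta> * (snd z)\<^sup>2" for z :: "(real ^ 'n) \<times> real"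
  define f1 where "f1 z W = \<sigma> * u1 z W + k * snd W + 2 * \<delta> * snd z * snd W" for z W :: "(real ^ 'n) \<times> real"
  define f2 where "f2 z V W = \<sigma> * u2 z V W + (2 * \<delta>) * (snd V * snd W)" for z V W :: "(real ^ 'n) \<times> real"
  have df: "(f has_derivative f1 z) (at z within S)" if "z \<in> S" for z
    unfolding f_def f1_def[abs_def]
    by (auto intro!: derivative_eq_intros u_deriv[OF that] simp: algebra_simps)
  have df1: "((\<lambda>z. f1 z V) has_derivative f2 z V) (at z)" if "z \<in> U" for z V
    using u1_deriv[OF U_S[OF that], of V] at_U[OF that]
    unfolding f1_def f2_def[abs_def] by (auto intro!: derivative_eq_intros simp: algebra_simps)
  have per: "torus_periodic (\<lambda>x. f (x, t))" if "t \<in> {0..T}" for t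
    using u_per[OF that] unfolding torus_periodic_def f_def by auto
  obtain z where z: "z \<in> S" "\<And>y. y \<in> S \<Longrightarrow> f y \<le> f z" "\<And>v. f1 z (v, 0) = 0" and
    d: "snd z = 0 \<and> f1 z (0, 1) \<le> 0 \<or> snd z = T \<and> f1 z (0, 1) \<ge> 0 \<or>
     z \<in> U \<and> f1 z = (\<lambda>W. 0) \<and> ellip z (f2 z) \<le> 0"
    using max_dichotomy[of f f1 f2, OF df df1 per] by blast
  have "u1 z (v, 0) = 0" for v using z(3)[of v] \<sigma> by (auto simp: f1_def)
  then have "P z = 0" by (simp add: P_def vec_eq_iff)
  then have w: "u1 z (0, 1) = h 0 - \<phi> (m z)" using w_\<phi>[OF z(1)] by (simp add: w_def)
  \<comment> \<open>The operator annihilates the Hessian of \<open>u\<close>, and the term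
    \<open>\<delta> * (snd z)\<^sup>2\<close> adds \<open>2 * \<delta>\<close>.\<close>
  have nU: "\<not> (z \<in> U \<and> ellip z (f2 z) \<le> 0)"
    using ellip_u2[of z] \<delta> unfolding f2_def ellip_add ellip_cmult ellip_time by auto
  \<comment> \<open>The slope \<open>k\<close> is chosen so that, at a maximum on
    \<open>t = 0\<close>, the time derivative of \<open>f\<close> would be at least
    \<delta>.\<close>
  have n0: "\<not> (snd z = 0 \<and> f1 z (0, 1) \<le> 0)"
  proof
    assume a: "snd z = 0 \<and> f1 z (0, 1) \<le> 0"
    then have e: "m z = m0 (fst z)" using initial by (metis prod.collapse)
    have p: "m0 (fst z) > 0" using m_pos[OF z(1)] e by simp
    have "\<sigma> * (h 0 - \<phi> (m0 (fst z))) + k \<le> 0" using conjunct1[OF a] conjunct2[OF a] w e by (simp add: f1_def)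
    then have "\<sigma> * \<phi> (m0 (fst z)) \<ge> \<sigma> * \<phi> \<mu> + \<delta>" unfolding k by (simp add: algebra_simps)
    moreover have "\<sigma> * \<phi> (m0 (fst z)) \<le> \<sigma> * \<phi> \<mu>"
      using \<sigma> m0[of "fst z"] \<phi>_le_iff[OF p \<mu>] \<phi>_le_iff[OF \<mu> p] by auto
    ultimately show False using \<delta> by linarith
  qed
  have zT: "snd z = T" "f1 z (0, 1) \<ge> 0" using d nU n0 by auto
  define x where "x = fst z"
  have zx: "z = (x, T)" using zT(1) x_def by (metis prod.collapse)
  show ?thesis
  proof (rule that)
    have "\<sigma> * (h 0 - \<phi> (m z)) + k + 2 * \<delta> * T \<ge> 0" using zT(2) w by (simp add: f1_def zx)
    then show "\<sigma> * \<phi> (m (x, T)) \<le> \<sigma> * \<phi> \<mu> + \<delta> * (1 + 2 * T)" unfolding k zx by (simp add: algebra_simps)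
    show "\<sigma> * u z + k * snd z + \<delta> * (snd z)\<^sup>2 \<le> \<sigma> * u (x, T) + k * T + \<delta> * T\<^sup>2" if "z \<in> S" for z
      using z(2)[OF that] by (simp add: f_def zx)
    fix y
    have yS: "(y, T) \<in> S" using T_pos by auto
    have "\<sigma> * G (m (y, T)) \<le> \<sigma> * G (m (x, T))" using z(2)[OF yS] by (simp add: f_def zx terminal)
    then show "\<sigma> * m (y, T) \<le> \<sigma> * m (x, T)"
      using \<sigma> G_le_iff[OF m_pos[OF yS] m_pos[OF z(1)]] G_le_iff[OF m_pos[OF z(1)] m_pos[OF yS]] by (auto simp: zx)
  qed
qed

text \<open>As \<open>g\<close> is increasing, the point found by \<open>comparison\<close> also
  maximizes \<open>\<sigma> * m\<close> at the terminal time, so the bound there holds everywhere;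
  then \<delta> tends to 0.\<close>

lemma terminal_density_bound:
  assumes \<sigma>: "\<sigma> = 1 \<or> \<sigma> = - 1" and \<mu>: "\<mu> > 0" and m0: "\<And>x. \<sigma> * m0 x \<le> \<sigma> * \<mu>"
  shows "\<sigma> * m (y, T) \<le> \<sigma> * \<mu>"
proof -
  have yS: "(x, T) \<in> S" for x using T_pos by auto
  have "\<sigma> * \<phi> (m (y, T)) \<le> \<sigma> * \<phi> \<mu>"
  proof (rule field_le_epsilon)
    fix e :: real assume e: "e > 0"
    define \<delta> where "\<delta> = e / (1 + 2 * T)"
    have \<delta>: "\<delta> > 0" "\<delta> * (1 + 2 * T) = e" using e T_pos by (auto simp: \<delta>_def)
    obtain x where x: "\<sigma> * m (y, T) \<le> \<sigma> * m (x, T)" "\<sigma> * \<phi> (m (x, T)) \<le> \<sigma> * \<phi> \<mu> + e"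
      using comparison[OF \<sigma> \<mu> m0 \<delta>(1) refl] \<delta>(2) by metis
    have "\<sigma> * \<phi> (m (y, T)) \<le> \<sigma> * \<phi> (m (x, T))"
      using \<sigma> x(1) \<phi>_le_iff[OF m_pos[OF yS] m_pos[OF yS]] by auto
    then show "\<sigma> * \<phi> (m (y, T)) \<le> \<sigma> * \<phi> \<mu> + e" using x(2) by linarith
  qed
  then show ?thesis
    using \<sigma> \<phi>_le_iff[OF m_pos[OF yS] \<mu>] \<phi>_le_iff[OF \<mu> m_pos[OF yS]] by auto
qed

text \<open>Here only uniformity matters, so \<open>comparison\<close> is used with \<delta> = 1 and
  the terms in time are estimated by powers of \<open>T\<close>.\<close>

lemma value_bound:
  assumes \<sigma>: "\<sigma> = 1 \<or> \<sigma> = - 1" and \<mu>: "\<mu> > 0" and m0: "\<And>x. \<sigma> * m0 x \<le> \<sigma> * \<mu>" and z: "z \<in> S"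
  shows "\<sigma> * u z \<le> \<sigma> * G \<mu> + (\<bar>\<phi> \<mu> - h 0\<bar> + 1) * T + T\<^sup>2"
proof -
  define k where "k = \<sigma> * (\<phi> \<mu> - h 0) + 1"
  obtain x where "\<And>y. \<sigma> * m (y, T) \<le> \<sigma> * m (x, T)" "\<sigma> * \<phi> (m (x, T)) \<le> \<sigma> * \<phi> \<mu> + 1 * (1 + 2 * T)"
    "\<And>z. z \<in> S \<Longrightarrow> \<sigma> * u z + k * snd z + 1 * (snd z)\<^sup>2 \<le> \<sigma> * u (x, T) + k * T + 1 * T\<^sup>2"
    by (rule comparison[OF \<sigma> \<mu> m0 zero_less_one k_def]) (rule that)
  from this(3)[OF z] have x: "\<sigma> * u z + k * snd z + (snd z)\<^sup>2 \<le> \<sigma> * u (x, T) + k * T + T\<^sup>2" by simp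
  have yS: "(x, T) \<in> S" using T_pos by auto
  have "\<sigma> * u (x, T) \<le> \<sigma> * G \<mu>"
    using \<sigma> terminal_density_bound[OF \<sigma> \<mu> m0, of x] G_le_iff[OF m_pos[OF yS] \<mu>] G_le_iff[OF \<mu> m_pos[OF yS]]
    by (auto simp: terminal)
  moreover have "k * (T - snd z) \<le> (\<bar>\<phi> \<mu> - h 0\<bar> + 1) * T"
  proof -
    have k: "k \<le> \<bar>\<phi> \<mu> - h 0\<bar> + 1" using \<sigma> unfolding k_def by (elim disjE) simp_all
    have "k * (T - snd z) \<le> (\<bar>\<phi> \<mu> - h 0\<bar> + 1) * (T - snd z)" using k z by (intro mult_right_mono) auto
    also have "\<dots> \<le> (\<bar>\<phi> \<mu> - h 0\<bar> + 1) * T" using z by (intro mult_left_mono) auto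
    finally show ?thesis .
  qed
  moreover have "(snd z)\<^sup>2 \<ge> 0" by simp
  ultimately show ?thesis using x by (simp only: right_diff_distrib)
qed

text \<open>
  The ellipticity may degenerate, but the coefficient of the second time derivative is \<open>1\<close>; this is why
  adding \<open>\<delta> exp (- \<alpha> t)\<close> makes a subsolution strict.
\<close>

lemma maximum_principle:
  assumes \<psi>: "\<And>z. z \<in> S \<Longrightarrow> (\<psi> has_derivative \<psi>1 z) (at z within S)"
    and \<psi>1: "\<And>z V. z \<in> U \<Longrightarrow> ((\<lambda>z. \<psi>1 z V) has_derivative \<psi>2 z V) (at z)"
    and per: "\<And>t. t \<in> {0..T} \<Longrightarrow> torus_periodic (\<lambda>x. \<psi> (x, t))"
    and \<alpha>: "\<alpha> > 0" "\<And>z. z \<in> S \<Longrightarrow> \<bar>chw z * \<theta> z\<bar> < \<alpha>" and \<delta>: "\<delta> > 0"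
  obtains z where "z \<in> S" "\<And>y. y \<in> S \<Longrightarrow> \<psi> y \<le> \<psi> z + \<delta>" "\<And>v. \<psi>1 z (v, 0) = 0"
    "snd z = 0 \<and> \<psi>1 z (0, 1) \<le> \<delta> * \<alpha> \<or> snd z = T \<and> \<psi>1 z (0, 1) > 0 \<or>
     z \<in> U \<and> ellip z (\<psi>2 z) < drift z (\<psi>1 z)"
proof -
  define E where "E z = \<delta> * exp (- \<alpha> * snd z)" for z :: "(real ^ 'n) \<times> real"
  have Epos: "E z > 0" for z using \<delta> by (simp add: E_def)
  have Ele: "E z \<le> \<delta>" if "z \<in> S" for z using \<delta> \<alpha>(1) that by (auto simp: E_def)
  define f where "f z = \<psi> z + E z" for z
  define f1 where "f1 z W = \<psi>1 z W - \<alpha> * E z * snd W" for z W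
  define f2 where "f2 z V W = \<psi>2 z V W + (\<alpha>\<^sup>2 * E z) * (snd V * snd W)" for z V W
  have dE: "(E has_derivative (\<lambda>W. - \<alpha> * E z * snd W)) (at z within A)" for z A
    unfolding E_def by (auto intro!: derivative_eq_intros)
  have df: "(f has_derivative f1 z) (at z within S)" if "z \<in> S" for z
    using has_derivative_add[OF \<psi>[OF that] dE[of z]] unfolding f_def[abs_def] f1_def[abs_def] by simp
  have df1: "((\<lambda>z. f1 z V) has_derivative f2 z V) (at z)" if "z \<in> U" for z V
    unfolding f1_def[abs_def] f2_def[abs_def]
    by (auto intro!: derivative_eq_intros \<psi>1[OF that] dE simp: power2_eq_square)
  have fper: "torus_periodic (\<lambda>x. f (x, t))" if "t \<in> {0..T}" for t
    using per[OF that] unfolding torus_periodic_def f_def E_def by auto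
  obtain z where z: "z \<in> S" "\<And>y. y \<in> S \<Longrightarrow> f y \<le> f z" "\<And>v. f1 z (v, 0) = 0" and
    d: "snd z = 0 \<and> f1 z (0, 1) \<le> 0 \<or> snd z = T \<and> f1 z (0, 1) \<ge> 0 \<or>
     z \<in> U \<and> f1 z = (\<lambda>W. 0) \<and> ellip z (f2 z) \<le> 0"
    using max_dichotomy[of f f1 f2, OF df df1 fper] by blast
  show ?thesis
  proof (rule that[OF z(1)])
    show "\<psi> y \<le> \<psi> z + \<delta>" if "y \<in> S" for y
      using z(2)[OF that] Epos[of y] Ele[OF z(1)] by (simp add: f_def)
    show "\<psi>1 z (v, 0) = 0" for v using z(3)[of v] by (simp add: f1_def)
    show "snd z = 0 \<and> \<psi>1 z (0, 1) \<le> \<delta> * \<alpha> \<or> snd z = T \<and> \<psi>1 z (0, 1) > 0 \<or>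
     z \<in> U \<and> ellip z (\<psi>2 z) < drift z (\<psi>1 z)"
      using d
    proof (elim disjE)
      assume a: "snd z = 0 \<and> f1 z (0, 1) \<le> 0"
      then have "E z = \<delta>" by (simp add: E_def)
      then show ?thesis using a by (simp add: f1_def mult.commute)
    next
      assume a: "snd z = T \<and> f1 z (0, 1) \<ge> 0"
      then show ?thesis using mult_pos_pos[OF \<alpha>(1) Epos[of z]] by (simp add: f1_def)
    next
      assume a: "z \<in> U \<and> f1 z = (\<lambda>W. 0) \<and> ellip z (f2 z) \<le> 0"
      have "\<psi>1 z = (\<lambda>W. \<alpha> * E z * snd W)" using a by (auto simp: f1_def fun_eq_iff)
      then have R: "drift z (\<psi>1 z) = \<alpha> * E z * (chw z * \<theta> z)" using drift_cmult[of z "\<alpha> * E z" snd] by (simp add: drift_time)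
      have "ellip z (\<psi>2 z) + \<alpha>\<^sup>2 * E z \<le> 0" using a unfolding f2_def ellip_add ellip_cmult ellip_time by simp
      moreover have "\<alpha> * E z * (chw z * \<theta> z) > \<alpha> * E z * (- \<alpha>)"
        using \<alpha>(2)[OF z(1)] Epos[of z] \<alpha>(1) by (intro mult_strict_left_mono) auto
      ultimately show ?thesis using a unfolding R by (simp add: power2_eq_square algebra_simps)
    qed
  qed
qed

text \<open>The interior alternative of \<open>maximum_principle\<close> contradicts
  \<open>sub\<close>, so up to \<delta> the maximum lies on a face.\<close>

lemma subsolution_bound:
  assumes \<psi>: "\<And>z. z \<in> S \<Longrightarrow> (\<psi> has_derivative \<psi>1 z) (at z within S)"
    and \<psi>1: "\<And>z V. z \<in> U \<Longrightarrow> ((\<lambda>z. \<psi>1 z V) has_derivative \<psi>2 z V) (at z)"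
    and per: "\<And>t. t \<in> {0..T} \<Longrightarrow> torus_periodic (\<lambda>x. \<psi> (x, t))"
    and sub: "\<And>z. z \<in> U \<Longrightarrow> ellip z (\<psi>2 z) \<ge> drift z (\<psi>1 z)"
    and bd: "\<And>x. \<psi> (x, 0) \<le> B" "\<And>x. \<psi> (x, T) \<le> B"
    and y: "y \<in> S"
  shows "\<psi> y \<le> B"
proof (rule field_le_epsilon)
  fix \<delta> :: real assume \<delta>: "\<delta> > 0"
  obtain \<alpha> where \<alpha>: "\<alpha> > 0" "\<And>z. z \<in> S \<Longrightarrow> \<bar>chw z * \<theta> z\<bar> < \<alpha>" using drift_bounded by blast
  obtain z where z: "\<psi> y \<le> \<psi> z + \<delta>" "snd z = 0 \<or> snd z = T \<or> z \<in> U \<and> ellip z (\<psi>2 z) < drift z (\<psi>1 z)"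
    using maximum_principle[of \<psi> \<psi>1 \<psi>2, OF \<psi> \<psi>1 per \<alpha> \<delta>] y by metis
  then have "\<psi> z \<le> B" using sub[of z] bd[of "fst z"] by (metis linorder_not_le prod.collapse)
  then show "\<psi> y \<le> B + \<delta>" using z(1) by linarith
qed

text \<open>Through \<open>w = \<phi>(m)\<close> this bounds the density by \<mu>. The argument has
  no counterpart from below, because the convexity term in \<open>ellip_w2\<close> has a
  sign.\<close>

lemma density_upper:
  assumes \<mu>: "\<mu> > 0" "\<And>x. m0 x \<le> \<mu>" and z: "z \<in> S"
  shows "w z \<le> \<phi> \<mu>"
proof (rule subsolution_bound[of w w1 w2, OF w_deriv w1_deriv_U w_per ellip_w2 _ _ z])
  have S: "(x, 0) \<in> S" "(x, T) \<in> S" for x using T_pos by auto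
  show "w (x, 0) \<le> \<phi> \<mu>" for x
    using w_\<phi>[OF S(1)] \<phi>_le_iff[OF m_pos[OF S(1)] \<mu>(1)] \<mu>(2)[of x] by (simp add: initial)
  show "w (x, T) \<le> \<phi> \<mu>" for x
    using w_\<phi>[OF S(2)] \<phi>_le_iff[OF m_pos[OF S(2)] \<mu>(1)] terminal_density_bound[of 1, OF _ \<mu>(1)] \<mu>(2) by simp
qed

lemma ut_upper:
  assumes bd: "\<And>x. u1 (x, 0) (0, 1) \<le> B" "\<And>x. u1 (x, T) (0, 1) \<le> B" and y: "y \<in> S"
  shows "u1 y (0, 1) \<le> B"
proof (rule subsolution_bound[of "\<lambda>z. u1 z (0, 1)" "\<lambda>z. u2 z (0, 1)" "\<lambda>z. u3 z (0, 1)", OF _ _ _ _ bd y])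
  show "((\<lambda>z. u2 z (0, 1) V) has_derivative u3 z (0, 1) V) (at z)" if "z \<in> U" for z V
    using u2_deriv[OF U_S[OF that]] at_U[OF that] by simp
  show "drift z (u2 z (0, 1)) \<le> ellip z (u3 z (0, 1))" if "z \<in> U" for z
    using ellip_u3[OF that, of "(0, 1)"] by (simp add: u3_rotate[OF that, of "(0, 1)", symmetric])
qed (use u1_deriv u1_per in auto)

section \<open>Quadratic estimates and boundary identities for the Bernstein argument\<close>

text \<open>Cauchy-Schwarz for the semidefinite form, read off its decomposition into
  squares.\<close>

lemma hpp_abs: "\<bar>hpp p v \<bullet> y\<bar> \<le> C0 * norm v * norm y"
proof -
  have "(hpp p v \<bullet> y)\<^sup>2 \<le> (hpp p v \<bullet> v) * (hpp p y \<bullet> y)"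
    unfolding hpp_squares[of p] using Cauchy_Schwarz_ineq_sum[of "\<lambda>k. snd (hpp_squares p) k \<bullet> v" "\<lambda>k. snd (hpp_squares p) k \<bullet> y"]
    by (simp add: power2_eq_square)
  also have "\<dots> \<le> (C0 * (v \<bullet> v)) * (C0 * (y \<bullet> y))"
    by (intro mult_mono hpp_upper hpp_psd) (use C0_pos in auto)
  also have "\<dots> = (C0 * norm v * norm y)\<^sup>2"
    by (simp add: power2_norm_eq_inner[symmetric] power_mult_distrib power2_eq_square)
  finally show ?thesis
    using C0_pos by (metis abs_le_square_iff abs_of_nonneg mult_nonneg_nonneg norm_ge_zero less_imp_le)
qed

definition "hess_sum z = (\<Sum>i\<in>UNIV. norm (\<beta> z (ex i)))"

lemma hess_sum_nonneg: "hess_sum z \<ge> 0" unfolding hess_sum_def by (intro sum_nonneg) auto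

lemma \<theta>_le: "\<bar>\<theta> z\<bar> \<le> C0 * hess_sum z"
proof -
  have "\<bar>\<theta> z\<bar> \<le> (\<Sum>i\<in>UNIV. \<bar>hpp (P z) (\<beta> z (ex i)) $ i\<bar>)" unfolding \<theta>_def by (rule sum_abs)
  also have "\<dots> \<le> (\<Sum>i\<in>UNIV. C0 * norm (\<beta> z (ex i)))"
  proof (rule sum_mono)
    fix i show "\<bar>hpp (P z) (\<beta> z (ex i)) $ i\<bar> \<le> C0 * norm (\<beta> z (ex i))"
      using hpp_abs[of "P z" "\<beta> z (ex i)" "axis i 1"] by (simp add: inner_axis)
  qed
  finally show ?thesis by (simp add: hess_sum_def sum_distrib_left)
qed

text \<open>The decay of the third derivative of the Hamiltonian like
  \<open>1 / (1 + norm p)\<close> compensates for the argument \<open>P z\<close>, so the bound does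
  not grow with the gradient.\<close>

lemma hppp_trace_le: "\<bar>\<Sum>i\<in>UNIV. hppp (P z) (\<beta> z (ex i)) (P z) $ i\<bar> \<le> C0 * hess_sum z"
proof -
  have "\<bar>\<Sum>i\<in>UNIV. hppp (P z) (\<beta> z (ex i)) (P z) $ i\<bar> \<le> (\<Sum>i\<in>UNIV. \<bar>hppp (P z) (\<beta> z (ex i)) (P z) $ i\<bar>)"
    by (rule sum_abs)
  also have "\<dots> \<le> (\<Sum>i\<in>UNIV. C0 * norm (\<beta> z (ex i)))"
  proof (rule sum_mono)
    fix i
    let ?x = "\<bar>hppp (P z) (\<beta> z (ex i)) (P z) $ i\<bar>"
    have "?x * (1 + norm (P z)) \<le> C0 * norm (\<beta> z (ex i)) * norm (P z)"
      using hppp_bound[of "P z" "\<beta> z (ex i)" "P z" "axis i 1"] by (simp add: inner_axis)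
    also have "\<dots> \<le> C0 * norm (\<beta> z (ex i)) * (1 + norm (P z))"
      using C0_pos by (intro mult_left_mono) auto
    finally show "?x \<le> C0 * norm (\<beta> z (ex i))"
      by (rule mult_right_le_imp_le) (smt (verit) norm_ge_zero)
  qed
  finally show ?thesis by (simp add: hess_sum_def sum_distrib_left)
qed

text \<open>This is the good term of the Bernstein argument. Exchanging the sum over squares with
  the sum over coordinates turns it into values of the form \<open>hpp\<close> on the columns of the
  Hessian, which are bounded below by \<open>1 / C0\<close>; the factor \<open>CARD('n)\<close>
  comes from Cauchy-Schwarz.\<close>

lemma dissipation:
  assumes z: "z \<in> S"
  shows "ellip z (\<lambda>V W. \<beta> z W \<bullet> \<beta> z V) \<ge> (norm (\<beta> z (X z)))\<^sup>2 + ch z / (C0 * CARD('n)) * (hess_sum z)\<^sup>2"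
proof -
  have b: "\<beta> z (sp v) $ i = v \<bullet> \<beta> z (ex i)" for v i
    using u2_sp[OF z, of v "ex i"] u2_sym[OF z, of "ex i" "sp v"] by (simp add: \<beta>_def)
  have bb: "\<beta> z (sp v) \<bullet> \<beta> z (sp v) = (\<Sum>i\<in>UNIV. (v \<bullet> \<beta> z (ex i)) * (v \<bullet> \<beta> z (ex i)))" for v
    unfolding inner_vec_def[of "\<beta> z (sp v)" "\<beta> z (sp v)"] b[of v] inner_real_def ..
  have "(\<Sum>k<dN z. \<beta> z (sp (db z k)) \<bullet> \<beta> z (sp (db z k)))
     = (\<Sum>k<dN z. \<Sum>i\<in>UNIV. (db z k \<bullet> \<beta> z (ex i)) * (db z k \<bullet> \<beta> z (ex i)))"
    unfolding bb ..
  also have "\<dots> = (\<Sum>i\<in>UNIV. hpp (P z) (\<beta> z (ex i)) \<bullet> \<beta> z (ex i))"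
    unfolding hpp_squares by (rule sum.swap)
  also have "\<dots> \<ge> (\<Sum>i\<in>UNIV. (norm (\<beta> z (ex i)))\<^sup>2 / C0)"
    by (intro sum_mono) (use hpp_lower in \<open>simp add: power2_norm_eq_inner\<close>)
  finally have 1: "(\<Sum>k<dN z. \<beta> z (sp (db z k)) \<bullet> \<beta> z (sp (db z k))) \<ge> (\<Sum>i\<in>UNIV. (norm (\<beta> z (ex i)))\<^sup>2) / C0"
    by (simp add: sum_divide_distrib)
  have "(hess_sum z)\<^sup>2 \<le> (\<Sum>i\<in>UNIV. (norm (\<beta> z (ex i)))\<^sup>2) * CARD('n)"
    unfolding hess_sum_def by (rule sum_squared_le_sum_of_squares)
  then have "(hess_sum z)\<^sup>2 / CARD('n) / C0 \<le> (\<Sum>i\<in>UNIV. (norm (\<beta> z (ex i)))\<^sup>2) / C0"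
    using C0_pos by (intro divide_right_mono) (auto simp: field_simps)
  with 1 have "(hess_sum z)\<^sup>2 / CARD('n) / C0 \<le> (\<Sum>k<dN z. \<beta> z (sp (db z k)) \<bullet> \<beta> z (sp (db z k)))" by linarith
  then have "ch z * ((hess_sum z)\<^sup>2 / CARD('n) / C0) \<le> ch z * (\<Sum>k<dN z. \<beta> z (sp (db z k)) \<bullet> \<beta> z (sp (db z k)))"
    using ch_pos[OF z] by (intro mult_left_mono) auto
  then show ?thesis by (simp add: ellip_def power2_norm_eq_inner mult.commute)
qed

text \<open>The price of switching the correction off by a function of \<open>w\<close>. Along
  \<open>X\<close> the continuity equation replaces the derivative of \<open>w\<close> by
  \<open>ch z * \<theta> z\<close>, and in space it is minus \<open>\<beta> z (X z)\<close>; both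
  are second derivatives of \<open>u\<close>, which \<open>dissipation\<close> controls.\<close>

lemma ellip_w1_square:
  assumes z: "z \<in> U"
  shows "ellip z (\<lambda>V W. w1 z V * w1 z W) \<le> (ch z * \<theta> z)\<^sup>2 + ch z * (C0 * (norm (\<beta> z (X z)))\<^sup>2)"
proof -
  have S: "z \<in> S" using z by (rule U_S)
  have "w1 z (sp v) = - (v \<bullet> \<beta> z (X z))" for v
    using u2_sp[OF S, of v "X z"] u2_sym[OF S, of "X z"] by (simp add: w1_def)
  then have "(\<Sum>k<dN z. w1 z (sp (db z k)) * w1 z (sp (db z k))) = hpp (P z) (\<beta> z (X z)) \<bullet> \<beta> z (X z)"
    unfolding hpp_squares by simp
  also have "\<dots> \<le> C0 * (norm (\<beta> z (X z)))\<^sup>2" using hpp_upper by (simp add: power2_norm_eq_inner)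
  finally show ?thesis
    using ch_pos[OF S] by (simp add: ellip_def w1_X[OF z] power2_eq_square)
qed

text \<open>A derivative within \<open>S\<close> yields two-sided derivatives in spatial directions
  even on the faces, so the initial and terminal conditions can be differentiated there.\<close>

lemma spatial_derivative:
  fixes f :: "(real ^ 'n) \<times> real \<Rightarrow> real"
  assumes "(f has_derivative f') (at z within S)" "z \<in> S"
  shows "((\<lambda>s. f (z + s *\<^sub>R (v, 0))) has_real_derivative f' (v, 0)) (at 0)"
proof -
  have "((\<lambda>s. z + s *\<^sub>R (v, 0)) has_derivative (\<lambda>h. h *\<^sub>R (v, 0))) (at 0)"
    by (auto intro!: derivative_eq_intros)
  moreover have "(f has_derivative f') (at (z + 0 *\<^sub>R (v, 0)) within ((\<lambda>s. z + s *\<^sub>R (v, 0)) ` UNIV))"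
    by (rule has_derivative_subset[of _ _ _ S]) (use assms closed_cyl_shift in \<open>auto simp: image_subset_iff\<close>)
  ultimately have "((\<lambda>s. f (z + s *\<^sub>R (v, 0))) has_derivative (\<lambda>h. f' (h *\<^sub>R (v, 0)))) (at 0)"
    by (rule has_derivative_in_compose)
  moreover have "f' (h *\<^sub>R (v, 0)) = f' (v, 0) * h" for h
    using linear_scale[OF has_derivative_linear[OF assms(1)], of h "(v, 0)"] by simp
  ultimately show ?thesis by (simp add: has_field_derivative_def)
qed

text \<open>This is how the gradient of \<open>m0\<close> enters the estimate at
  \<open>t = 0\<close>.\<close>

lemma w1_initial: "w1 (x, 0) (v, 0) = \<phi>1 (m0 x) * m01 x v"
proof -
  have S: "(x, 0) \<in> S" for x using T_pos by auto
  have "((\<lambda>s. w ((x, 0) + s *\<^sub>R (v, 0))) has_real_derivative w1 (x, 0) (v, 0)) (at 0)"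
    by (rule spatial_derivative[OF w_deriv[OF S] S])
  moreover have "w ((x, 0) + s *\<^sub>R (v, 0)) = \<phi> (m0 (x + s *\<^sub>R v))" for s
    using w_\<phi>[OF S, of "x + s *\<^sub>R v"] by (simp add: initial)
  ultimately have 1: "((\<lambda>s. \<phi> (m0 (x + s *\<^sub>R v))) has_real_derivative w1 (x, 0) (v, 0)) (at 0)" by simp
  have "((\<lambda>s. m0 (x + s *\<^sub>R v)) has_real_derivative m01 x v) (at 0)"
    by (rule has_real_derivative_along_line) (simp add: m0_deriv)
  moreover have "m0 x > 0" using m_pos[OF S, of x] by (simp add: initial)
  ultimately have "((\<lambda>s. \<phi> (m0 (x + s *\<^sub>R v))) has_real_derivative \<phi>1 (m0 x) * m01 x v) (at 0)"
    using DERIV_chain2[OF \<phi>_deriv, of "\<lambda>s. m0 (x + s *\<^sub>R v)" 0] by simp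
  from DERIV_unique[OF 1 this] show ?thesis .
qed

lemma w1_m1_S: assumes "z \<in> S" shows "w1 z (v, 0) = \<phi>1 (m z) * m1 z (v, 0)"
proof -
  have "((\<lambda>s. w (z + s *\<^sub>R (v, 0))) has_real_derivative w1 z (v, 0)) (at 0)"
    by (rule spatial_derivative[OF w_deriv[OF assms] assms])
  moreover have "w (z + s *\<^sub>R (v, 0)) = \<phi> (m (z + s *\<^sub>R (v, 0)))" for s
    using w_\<phi>[OF closed_cyl_shift[OF assms]] .
  ultimately have 1: "((\<lambda>s. \<phi> (m (z + s *\<^sub>R (v, 0)))) has_real_derivative w1 z (v, 0)) (at 0)" by simp
  show ?thesis
    using DERIV_unique[OF 1 spatial_derivative[OF \<phi>m_deriv[OF assms] assms]] .
qed

text \<open>Together with \<open>w1_m1_S\<close> it makes the spatial gradients of \<open>w\<close>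
  and \<open>u\<close> positive multiples of each other at \<open>t = T\<close>, the source of the
  good sign there.\<close>

lemma u1_terminal: "u1 (x, T) (v, 0) = G1 (m (x, T)) * m1 (x, T) (v, 0)"
proof -
  have S: "(x, T) \<in> S" for x using T_pos by auto
  have "((\<lambda>s. u ((x, T) + s *\<^sub>R (v, 0))) has_real_derivative u1 (x, T) (v, 0)) (at 0)"
    by (rule spatial_derivative[OF u_deriv[OF S] S])
  moreover have "u ((x, T) + s *\<^sub>R (v, 0)) = G (m ((x, T) + s *\<^sub>R (v, 0)))" for s
    using terminal[of "x + s *\<^sub>R v"] by simp
  ultimately have 1: "((\<lambda>s. G (m ((x, T) + s *\<^sub>R (v, 0)))) has_real_derivative u1 (x, T) (v, 0)) (at 0)" by simp
  have "((\<lambda>s. m ((x, T) + s *\<^sub>R (v, 0))) has_real_derivative m1 (x, T) (v, 0)) (at 0)"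
    by (rule spatial_derivative[OF m_deriv[OF S] S])
  then have "((\<lambda>s. G (m ((x, T) + s *\<^sub>R (v, 0)))) has_real_derivative G1 (m (x, T)) * m1 (x, T) (v, 0)) (at 0)"
    using DERIV_chain2[OF G_deriv, of "\<lambda>s. m ((x, T) + s *\<^sub>R (v, 0))" 0] m_pos[OF S] by simp
  from DERIV_unique[OF 1 this] show ?thesis .
qed

text \<open>
  Bernstein's method with \<open>V = |P|\<^sup>2 / 2 + c (Y\<^sub>+)\<^sup>3\<close>. The correction uses that \<open>- X u\<close> grows quadratically
  in \<open>P\<close>, so \<open>X V > 0\<close> at \<open>t = 0\<close> for large \<open>P\<close>. The term \<open>N0 (D z)\<^sup>3\<close> switches the correction off
  where \<open>m < \<mu>0 / 2\<close>, the region where the equation degenerates, without changing it at \<open>t = 0\<close>; the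
  term \<open>\<kappa> t\<close> switches it off at \<open>t = T\<close>.
\<close>

lemma gradient_bound:
  fixes \<mu>0 \<mu>1 Mu \<Lambda> l \<rho> c R :: real
  defines "Ym \<equiv> 2 * Mu + 1"
  defines "\<kappa> \<equiv> Ym / T" and "N0 \<equiv> Ym / \<rho> ^ 3" and "\<chi>1 \<equiv> \<mu>1 * \<Lambda>" and "Bd \<equiv> (\<Lambda> + \<mu>1 * \<Lambda>) / l"
  defines "x0 \<equiv> \<mu>0 / 2 * l / (C0 * CARD('n))"
    and "\<sigma> \<equiv> 3 * N0 * \<rho>\<^sup>2 * (\<chi>1 * C0)" and "K2 \<equiv> C0 * (2 + Bd + \<chi>1)"
    and "K3 \<equiv> 6 * N0 * \<rho> * ((\<chi>1 * C0)\<^sup>2 + \<chi>1 * C0)"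
  assumes \<mu>: "0 < \<mu>0" "\<And>x. \<mu>0 \<le> m0 x" "\<And>x. m0 x \<le> \<mu>1"
    and Mu: "\<And>z. z \<in> S \<Longrightarrow> \<bar>u z\<bar> \<le> Mu"
    and l: "l > 0"
    and \<phi>b: "\<And>s. \<mu>0 / 2 \<le> s \<Longrightarrow> s \<le> \<mu>1 \<Longrightarrow> \<bar>\<phi> s\<bar> \<le> \<Lambda> \<and> l \<le> \<phi>1 s \<and> \<phi>1 s \<le> \<Lambda> \<and> \<bar>\<phi>2 s\<bar> \<le> \<Lambda>"
    and m01: "\<And>x v. \<bar>m01 x v\<bar> \<le> \<Lambda> * norm v"
    and \<rho>: "\<rho> > 0" "\<rho> \<le> \<phi> \<mu>0 - \<phi> (\<mu>0 / 2)"
    and c: "c > 0" and k0: "k0 > 0" "k0 \<le> 1" "k0 \<le> x0"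
    and small: "24 * c * Ym * \<sigma>\<^sup>2 \<le> k0" "12 * c * Ym\<^sup>2 * K3 \<le> k0" "3 * c * Ym ^ 3 * K2\<^sup>2 \<le> k0"
    and R: "R \<ge> 0" "\<And>p. norm p \<ge> R \<Longrightarrow> h p - C0 - \<Lambda> - \<kappa> \<ge> 1 + norm p"
      "\<And>p. norm p \<ge> R \<Longrightarrow> 3 * c * (h p - C0 - \<Lambda> - \<kappa>) > \<Lambda>\<^sup>2 * norm p + 1"
    and y: "y \<in> S"
  shows "(norm (P y))\<^sup>2 \<le> R\<^sup>2 + 2 * c * Ym ^ 3 + 2"
proof -
  define w0 where "w0 = \<phi> \<mu>0"
  have \<mu>1: "\<mu>0 \<le> \<mu>1" using \<mu>(2,3) order_trans by blast
  have S0: "(0, 0) \<in> S" using T_pos by auto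
  have Mu0: "Mu \<ge> 0" using Mu[OF S0] by linarith
  have \<Lambda>0: "\<Lambda> > 0" using \<phi>b[of \<mu>1] \<mu>(1) \<mu>1 l by linarith
  have Ym: "Ym \<ge> 1" "Ym > 0" using Mu0 by (auto simp: Ym_def)
  \<comment> \<open>\<open>Ym\<close> bounds \<open>Mu + 1 - u z\<close>. With
    \<open>\<kappa> * T = Ym\<close> and \<open>N0 * \<rho> ^ 3 = Ym\<close>, each of the two
    switches suffices alone to make \<open>Y\<close> nonpositive.\<close>
  have \<kappa>0: "\<kappa> > 0" "\<kappa> * T = Ym" using Ym T_pos by (auto simp: \<kappa>_def)
  have N0: "N0 > 0" "N0 * \<rho> ^ 3 = Ym" using Ym \<rho>(1) by (auto simp: N0_def)
  define D where "D z = max 0 (w0 - w z)" for z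
  define kp where "kp z = 3 * N0 * (D z)\<^sup>2" for z
  define kpp where "kpp z = 6 * N0 * D z" for z
  define Y where "Y z = Mu + 1 - u z - \<kappa> * snd z - N0 * (D z) ^ 3" for z
  define Y1 where "Y1 z W = - u1 z W - \<kappa> * snd W + kp z * w1 z W" for z W
  define Y2 where "Y2 z V W = - u2 z V W + kp z * w2 z V W - kpp z * (w1 z V * w1 z W)" for z V W
  define Yp where "Yp z = max 0 (Y z)" for z
  define V where "V z = (P z \<bullet> P z) / 2 + c * (Yp z) ^ 3" for z
  define V1 where "V1 z W = P z \<bullet> \<beta> z W + 3 * c * (Yp z)\<^sup>2 * Y1 z W" for z W
  define V2 where "V2 z A W = (\<beta> z W \<bullet> \<beta> z A + P z \<bullet> \<gamma> z A W)
     + (6 * c * Yp z * (Y1 z A * Y1 z W) + 3 * c * (Yp z)\<^sup>2 * Y2 z A W)" for z A W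
  have comp: "((\<lambda>z. f (g z)) has_derivative (\<lambda>W. f' * g' W)) F'"
    if "(g has_derivative g') F'" "F' = at z within A" "(f has_real_derivative f') (at (g z))"
    for f :: "real \<Rightarrow> real" and g :: "(real^'n) \<times> real \<Rightarrow> real" and f' g' F' z A
    using has_derivative_compose[of g g' z A f "\<lambda>x. f' * x"] that
    by (simp add: has_field_derivative_def)
  have dw: "((\<lambda>z. w0 - w z) has_derivative (\<lambda>W. - w1 z W)) (at z within S)" if "z \<in> S" for z
    using w_deriv[OF that] by (auto intro!: derivative_eq_intros)
  have dD3: "((\<lambda>z. (D z) ^ 3) has_derivative (\<lambda>W. 3 * (D z)\<^sup>2 * - w1 z W)) (at z within S)" if "z \<in> S" for z
    unfolding D_def by (rule comp[OF dw[OF that] refl has_real_derivative_pos_cube])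
  have dD2: "((\<lambda>z. (D z)\<^sup>2) has_derivative (\<lambda>W. 2 * D z * - w1 z W)) (at z within S)" if "z \<in> S" for z
    unfolding D_def by (rule comp[OF dw[OF that] refl has_real_derivative_pos_square])
  have dY: "(Y has_derivative Y1 z) (at z within S)" if "z \<in> S" for z
  proof -
    have "((\<lambda>z. Mu + 1 - u z - \<kappa> * snd z - N0 * (D z) ^ 3) has_derivative
      (\<lambda>W. 0 - u1 z W - \<kappa> * snd W - N0 * (3 * (D z)\<^sup>2 * - w1 z W))) (at z within S)"
      by (intro has_derivative_diff has_derivative_mult_right has_derivative_const has_derivative_snd
          has_derivative_ident u_deriv[OF that] dD3[OF that])
    moreover have "(\<lambda>W. 0 - u1 z W - \<kappa> * snd W - N0 * (3 * (D z)\<^sup>2 * - w1 z W)) = Y1 z"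
      by (rule ext) (simp add: Y1_def kp_def)
    ultimately show ?thesis by (simp add: Y_def[abs_def])
  qed
  have dkp: "(kp has_derivative (\<lambda>W. - kpp z * w1 z W)) (at z)" if "z \<in> U" for z
    using has_derivative_mult_right[OF dD2[OF U_S[OF that]], of "3 * N0"] at_U[OF that]
    by (simp add: kp_def[abs_def] kpp_def mult.assoc)
  have dY1: "((\<lambda>z. Y1 z A) has_derivative Y2 z A) (at z)" if "z \<in> U" for z A
    using u1_deriv[OF U_S[OF that], of A] at_U[OF that] unfolding Y1_def Y2_def[abs_def]
    by (auto intro!: derivative_eq_intros dkp[OF that] w1_deriv_U[OF that] simp: algebra_simps)
  have dYp3: "((\<lambda>z. (Yp z) ^ 3) has_derivative (\<lambda>W. 3 * (Yp z)\<^sup>2 * Y1 z W)) (at z within S)" if "z \<in> S" for z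
    unfolding Yp_def by (rule comp[OF dY[OF that] refl has_real_derivative_pos_cube])
  have dYp2: "((\<lambda>z. (Yp z)\<^sup>2) has_derivative (\<lambda>W. 2 * Yp z * Y1 z W)) (at z within S)" if "z \<in> S" for z
    unfolding Yp_def by (rule comp[OF dY[OF that] refl has_real_derivative_pos_square])
  have dV: "(V has_derivative V1 z) (at z within S)" if "z \<in> S" for z
  proof -
    have "((\<lambda>z. P z \<bullet> P z) has_derivative (\<lambda>W. P z \<bullet> \<beta> z W + \<beta> z W \<bullet> P z)) (at z within S)"
      by (rule has_derivative_inner[OF P_deriv[OF that] P_deriv[OF that]])
    from has_derivative_add[OF has_derivative_mult_right[OF this, of "1 / 2"] has_derivative_mult_right[OF dYp3[OF that], of c]]
    show ?thesis by (simp add: V_def[abs_def] V1_def[abs_def] inner_commute[of "\<beta> z _"] mult.assoc mult.left_commute[of c])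
  qed
  have dV1: "((\<lambda>z. V1 z A) has_derivative V2 z A) (at z)" if "z \<in> U" for z A
  proof -
    have "((\<lambda>z. P z \<bullet> \<beta> z A) has_derivative (\<lambda>W. P z \<bullet> \<gamma> z A W + \<beta> z W \<bullet> \<beta> z A)) (at z)"
      using has_derivative_inner[OF P_deriv[OF U_S[OF that]] \<beta>_deriv[OF U_S[OF that]]] at_U[OF that] by simp
    moreover have "((\<lambda>z. (Yp z)\<^sup>2) has_derivative (\<lambda>W. 2 * Yp z * Y1 z W)) (at z)"
      using dYp2[OF U_S[OF that]] at_U[OF that] by simp
    ultimately have "((\<lambda>z. P z \<bullet> \<beta> z A + 3 * c * (Yp z)\<^sup>2 * Y1 z A) has_derivative
      (\<lambda>W. (P z \<bullet> \<gamma> z A W + \<beta> z W \<bullet> \<beta> z A) +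
        (3 * c * (Yp z)\<^sup>2 * Y2 z A W + 3 * c * (2 * Yp z * Y1 z W) * Y1 z A))) (at z)"
      by (intro has_derivative_add has_derivative_mult[of "\<lambda>z. 3 * c * (Yp z)\<^sup>2"] has_derivative_mult_right dY1[OF that])
    moreover have "(\<lambda>W. (P z \<bullet> \<gamma> z A W + \<beta> z W \<bullet> \<beta> z A) +
        (3 * c * (Yp z)\<^sup>2 * Y2 z A W + 3 * c * (2 * Yp z * Y1 z W) * Y1 z A)) = V2 z A"
      by (rule ext) (simp add: V2_def algebra_simps)
    ultimately show ?thesis by (simp add: V1_def)
  qed
  have per: "torus_periodic (\<lambda>x. V (x, t))" if "t \<in> {0..T}" for t
    using P_per[OF that] u_per[OF that] w_per[OF that]
    unfolding torus_periodic_def V_def Yp_def Y_def D_def by auto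
  \<comment> \<open>The derivative of \<open>Y\<close> along \<open>X\<close> without the
    contribution of the switch \<open>D\<close>.\<close>
  define q where "q z = - u1 z (X z) - \<kappa>" for z
  have w_up: "w z \<le> \<phi> \<mu>1" if "z \<in> S" for z by (rule density_upper) (use \<mu> \<mu>1 that in auto)
  \<comment> \<open>\<open>- u1 z (X z)\<close> equals
    \<open>hp (P z) \<bullet> P z - h (P z) + w z\<close>, and the growth condition leaves one full
    copy of \<open>h (P z)\<close>.\<close>
  have q_low: "q z \<ge> h (P z) - C0 - \<Lambda> - \<kappa>" if "z \<in> S" "w z \<ge> - \<Lambda>" for z
    using h_growth[of "P z"] that u1_split[OF that(1), of "- hp (P z)" 1]
    by (simp add: q_def X_def w_def inner_commute)
  have Ym_bd: "Mu + 1 - u z - \<kappa> * snd z \<le> Ym" if "z \<in> S" for z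
  proof -
    have "\<kappa> * snd z \<ge> 0" using \<kappa>0 that by auto
    then show ?thesis using Mu[OF that] unfolding Ym_def by linarith
  qed
  have Dnn: "D z \<ge> 0" for z by (simp add: D_def)
  have Yp_le: "Yp z \<le> Ym" "Yp z \<ge> 0" if "z \<in> S" for z
  proof -
    have "N0 * (D z) ^ 3 \<ge> 0" using N0 Dnn by simp
    then show "Yp z \<le> Ym" "Yp z \<ge> 0" using Ym_bd[OF that] Ym unfolding Yp_def Y_def by auto
  qed
  \<comment> \<open>At a maximum the spatial derivatives vanish, so the time derivative may be
    replaced by the one along \<open>X\<close>, where the equations give information.\<close>
  have V1X: "V1 z (X z) = V1 z (0, 1)" if "z \<in> S" "\<And>v. V1 z (v, 0) = 0" for z
  proof -
    have "V1 z (X z) = V1 z (- hp (P z), 0) + V1 z (0, 1)"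
      using linear_add[OF has_derivative_linear[OF dV[OF that(1)]], of "(- hp (P z), 0)" "(0, 1)"] by (simp add: X_def)
    then show ?thesis using that(2) by simp
  qed
  have PbX: "P z \<bullet> \<beta> z (X z) = - w1 z (P z, 0)" if "z \<in> S" for z
    using u2_sp[OF that, of "P z" "X z"] u2_sym[OF that, of "X z"] by (simp add: w1_def)
  have interior: "ellip z (V2 z) \<ge> drift z (V1 z)" if zU: "z \<in> U" and big: "norm (P z) \<ge> R" for z
  proof -
    have z: "z \<in> S" using zU by (rule U_S)
    define a where "a = norm (\<beta> z (X z))"
    define Gd where "Gd = ellip z (\<lambda>V W. \<beta> z W \<bullet> \<beta> z V)"
    define YY where "YY = ellip z (\<lambda>V W. Y1 z V * Y1 z W)"
    define ww where "ww = ellip z (\<lambda>V W. w1 z V * w1 z W)"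
    define r3 where "r3 = (\<Sum>i\<in>UNIV. hppp (P z) (\<beta> z (ex i)) (P z) $ i)"
    have G: "Gd \<ge> a\<^sup>2 + ch z / (C0 * CARD('n)) * (hess_sum z)\<^sup>2"
      unfolding Gd_def a_def by (rule dissipation[OF z])
    \<comment> \<open>With \<open>P z\<close> frozen this is the linearized equation along
      \<open>sp (P z)\<close>; the result cancels against the same term in
      \<open>drift z (V1 z)\<close>.\<close>
    have Pg: "ellip z (\<lambda>A W. P z \<bullet> \<gamma> z A W) = drift z (\<lambda>W. P z \<bullet> \<beta> z W)"
    proof -
      have "(\<lambda>A W. P z \<bullet> \<gamma> z A W) = (\<lambda>A W. u3 z A W (sp (P z)))"
        by (intro ext) (simp add: u3_sp[OF zU, symmetric] u3_rotate[OF zU, of "sp (P z)"])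
      moreover have "(\<lambda>W. P z \<bullet> \<beta> z W) = u2 z (sp (P z))" by (rule ext) (simp add: u2_sp[OF z])
      ultimately show ?thesis using ellip_u3[OF zU, of "sp (P z)"] by simp
    qed
    have Y2L: "ellip z (Y2 z) = kp z * ellip z (w2 z) - kpp z * ww"
    proof -
      have "Y2 z = (\<lambda>V W. ((-1) * u2 z V W + kp z * w2 z V W) - kpp z * (w1 z V * w1 z W))"
        by (simp add: Y2_def fun_eq_iff)
      then show ?thesis by (simp only: ellip_diff ellip_add ellip_cmult ellip_u2[OF zU] ww_def)
    qed
    have V2L: "ellip z (V2 z) = Gd + drift z (\<lambda>W. P z \<bullet> \<beta> z W) + (6 * c * Yp z * YY + 3 * c * (Yp z)\<^sup>2 * ellip z (Y2 z))"
      unfolding V2_def[abs_def] ellip_add ellip_cmult Pg YY_def Gd_def by simp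
    have Ru: "drift z (u1 z) = 2 * (hpp (P z) (P z) \<bullet> \<beta> z (X z)) + chw z * \<theta> z * u1 z (X z) - ch z * r3"
      unfolding drift_def r3_def by (simp add: P_def)
    have Y1R: "drift z (Y1 z) = - drift z (u1 z) - \<kappa> * (chw z * \<theta> z) + kp z * drift z (w1 z)"
    proof -
      have "Y1 z = (\<lambda>W. ((-1) * u1 z W + (- \<kappa>) * snd W) + kp z * w1 z W)"
        by (simp add: Y1_def fun_eq_iff)
      then show ?thesis by (simp only: drift_add drift_cmult drift_time)
    qed
    have V1R: "drift z (V1 z) = drift z (\<lambda>W. P z \<bullet> \<beta> z W) + 3 * c * (Yp z)\<^sup>2 * drift z (Y1 z)"
      unfolding V1_def[abs_def] drift_add drift_cmult by simp
    have YYX: "YY \<ge> (q z + kp z * (ch z * \<theta> z))\<^sup>2"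
    proof -
      have "Y1 z (X z) = q z + kp z * (ch z * \<theta> z)"
        by (simp add: Y1_def q_def w1_X[OF zU]) (simp add: X_def)
      then show ?thesis using ellip_ge_X[OF z, of "\<lambda>V W. Y1 z V * Y1 z W"] by (simp add: YY_def power2_eq_square)
    qed
    \<comment> \<open>\<open>r\<close> is \<open>drift\<close> applied to the differential of
      \<open>- u - \<kappa> t\<close>. The operator annihilates the Hessian of that function, so
      \<open>r\<close> is not compensated by a second-order term.\<close>
    define r where "r = chw z * \<theta> z * q z + ch z * r3 - 2 * (hpp (P z) (P z) \<bullet> \<beta> z (X z))"
    have "ellip z (V2 z) - drift z (V1 z) = Gd + 6 * c * Yp z * YY
        + 3 * c * (Yp z)\<^sup>2 * (kp z * (ellip z (w2 z) - drift z (w1 z)) - (kpp z * ww + r))"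
      unfolding V2L V1R Y2L Y1R Ru r_def q_def by (simp add: algebra_simps)
    also have "\<dots> \<ge> Gd + 6 * c * Yp z * (q z + kp z * (ch z * \<theta> z))\<^sup>2 - 3 * c * (Yp z)\<^sup>2 * (kpp z * ww + r)"
    proof -
      have "6 * c * Yp z * YY \<ge> 6 * c * Yp z * (q z + kp z * (ch z * \<theta> z))\<^sup>2"
        using YYX c Yp_le[OF z] by (intro mult_left_mono) auto
      moreover have "kp z * (ellip z (w2 z) - drift z (w1 z)) \<ge> 0"
        using ellip_w2[OF zU] N0 by (auto simp: kp_def)
      then have "3 * c * (Yp z)\<^sup>2 * (kp z * (ellip z (w2 z) - drift z (w1 z))) \<ge> 0" using c by simp
      ultimately show ?thesis by (simp only: right_diff_distrib)
    qed
    finally have low: "ellip z (V2 z) - drift z (V1 z) \<ge> Gd + 6 * c * Yp z * (q z + kp z * (ch z * \<theta> z))\<^sup>2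
        - 3 * c * (Yp z)\<^sup>2 * (kpp z * ww + r)" .
    show ?thesis
    proof (cases "Y z > 0")
      case False
      then have "Yp z = 0" by (simp add: Yp_def)
      moreover have "Gd \<ge> 0" using G ch_pos[OF z] C0_pos by (smt (verit) zero_le_power2 mult_nonneg_nonneg divide_nonneg_nonneg of_nat_0_le_iff)
      ultimately show ?thesis using low by simp
    next
      case True
      \<comment> \<open>Positivity of \<open>Y\<close> keeps the switch below its full strength.
        Hence \<open>w\<close> exceeds \<open>\<phi> (\<mu>0 / 2)\<close>, and the bounds
        \<open>\<phi>b\<close> are available.\<close>
      have "N0 * (D z) ^ 3 < N0 * \<rho> ^ 3" using True Ym_bd[OF z] N0(2) by (simp add: Y_def)
      then have "(D z) ^ 3 < \<rho> ^ 3" using N0(1) by simp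
      then have D\<rho>: "D z < \<rho>" using \<rho>(1) by (metis less_imp_le power_less_imp_less_base)
      then have "w z > \<phi> (\<mu>0 / 2)" using \<rho>(2) by (simp add: D_def w0_def)
      then have m_low: "\<mu>0 / 2 \<le> m z" using w_\<phi>[OF z] \<phi>_le_iff[OF m_pos[OF z], of "\<mu>0 / 2"] \<mu>(1) by auto
      have m_up: "m z \<le> \<mu>1" using w_up[OF z] w_\<phi>[OF z] \<phi>_le_iff[OF m_pos[OF z]] \<mu>(1) \<mu>1 by auto
      note \<phi>m = \<phi>b[OF m_low m_up]
      have qz: "q z \<ge> 1 + norm (P z)"
      proof -
        have "w z \<ge> - \<Lambda>" using \<phi>m w_\<phi>[OF z] by linarith
        then show ?thesis using q_low[OF z] R(2)[OF big] by linarith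
      qed
      have mz: "m z > 0" by (rule m_pos[OF z])
      have ch_low: "ch z \<ge> \<mu>0 / 2 * l" unfolding ch_def using m_low \<phi>m \<mu>(1) l by (intro mult_mono) auto
      have ch_up: "ch z \<le> \<chi>1" unfolding ch_def \<chi>1_def using m_up \<phi>m mz \<mu>(1) \<mu>1 l by (intro mult_mono) auto
      have \<chi>1: "\<chi>1 \<ge> 0" using ch_up ch_pos[OF z] by linarith
      have chw_up: "\<bar>chw z\<bar> \<le> Bd"
      proof -
        have "\<bar>\<phi>1 (m z) + m z * \<phi>2 (m z)\<bar> \<le> \<phi>1 (m z) + m z * \<bar>\<phi>2 (m z)\<bar>"
          using \<phi>1_pos[OF mz] mz by (simp add: abs_mult order_trans[OF abs_triangle_ineq])
        also have "\<dots> \<le> \<Lambda> + \<mu>1 * \<Lambda>" using \<phi>m m_up mz by (intro add_mono mult_mono) auto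
        finally have "\<bar>chw z\<bar> \<le> (\<Lambda> + \<mu>1 * \<Lambda>) / \<phi>1 (m z)"
          using \<phi>1_pos[OF mz] by (simp add: chw_def abs_divide divide_right_mono)
        also have "\<dots> \<le> Bd" unfolding Bd_def using \<phi>m l \<Lambda>0 \<mu>(1) \<mu>1 by (intro divide_left_mono) auto
        finally show ?thesis .
      qed
      have Bd0: "Bd \<ge> 0" using chw_up by linarith
      have a0: "a \<ge> 0" by (simp add: a_def)
      note U0 = hess_sum_nonneg[of z]
      have ch\<theta>: "\<bar>ch z * \<theta> z\<bar> \<le> \<chi>1 * C0 * hess_sum z"
      proof -
        have "\<bar>ch z * \<theta> z\<bar> \<le> \<chi>1 * (C0 * hess_sum z)"
          unfolding abs_mult using ch_up ch_pos[OF z] \<theta>_le \<chi>1 by (intro mult_mono) auto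
        then show ?thesis by simp
      qed
      have kp: "0 \<le> kp z" "kp z \<le> 3 * N0 * \<rho>\<^sup>2"
        using N0 D\<rho> Dnn by (auto simp: kp_def power_mono)
      have kpp: "0 \<le> kpp z" "kpp z \<le> 6 * N0 * \<rho>" using N0 D\<rho> Dnn by (auto simp: kpp_def)
      have s: "\<bar>kp z * (ch z * \<theta> z)\<bar> \<le> \<sigma> * hess_sum z"
      proof -
        have "\<bar>kp z * (ch z * \<theta> z)\<bar> \<le> 3 * N0 * \<rho>\<^sup>2 * (\<chi>1 * C0 * hess_sum z)"
          unfolding abs_mult[of "kp z"] using kp ch\<theta> N0 by (intro mult_mono) auto
        then show ?thesis by (simp add: \<sigma>_def)
      qed
      have e: "kpp z * ww \<le> K3 * (a\<^sup>2 + (hess_sum z)\<^sup>2)"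
      proof -
        have "ww \<le> (ch z * \<theta> z)\<^sup>2 + ch z * (C0 * a\<^sup>2)" unfolding ww_def a_def by (rule ellip_w1_square[OF zU])
        also have "\<dots> \<le> (\<chi>1 * C0 * hess_sum z)\<^sup>2 + \<chi>1 * (C0 * a\<^sup>2)"
        proof (intro add_mono mult_right_mono)
          show "(ch z * \<theta> z)\<^sup>2 \<le> (\<chi>1 * C0 * hess_sum z)\<^sup>2" using ch\<theta> by (metis abs_ge_zero power2_abs power_mono)
        qed (use ch_up C0_pos in auto)
        also have "\<dots> \<le> ((\<chi>1 * C0)\<^sup>2 + \<chi>1 * C0) * (a\<^sup>2 + (hess_sum z)\<^sup>2)"
          using \<chi>1 C0_pos by (simp add: power_mult_distrib algebra_simps)
        finally have "ww \<le> ((\<chi>1 * C0)\<^sup>2 + \<chi>1 * C0) * (a\<^sup>2 + (hess_sum z)\<^sup>2)" .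
        then have "kpp z * ww \<le> kpp z * (((\<chi>1 * C0)\<^sup>2 + \<chi>1 * C0) * (a\<^sup>2 + (hess_sum z)\<^sup>2))"
          using kpp by (intro mult_left_mono) auto
        also have "\<dots> \<le> 6 * N0 * \<rho> * (((\<chi>1 * C0)\<^sup>2 + \<chi>1 * C0) * (a\<^sup>2 + (hess_sum z)\<^sup>2))"
          using kpp \<chi>1 C0_pos by (intro mult_right_mono) auto
        finally show ?thesis by (simp add: K3_def)
      qed
      have r: "r \<le> K2 * (a + hess_sum z) * q z"
      proof -
        \<comment> \<open>These bounds turn every summand of \<open>r\<close> into a multiple of
          \<open>a * q z\<close> or \<open>hess_sum z * q z\<close>, the shape that can be
          absorbed.\<close>
        have q1: "q z \<ge> 1" "q z \<ge> norm (P z)" "q z \<ge> 0" using qz norm_ge_zero[of "P z"] by linarith+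
        have "chw z * \<theta> z * q z \<le> \<bar>chw z * \<theta> z\<bar> * q z" using q1 by (intro mult_right_mono) auto
        also have "\<dots> \<le> (Bd * (C0 * hess_sum z)) * q z"
          unfolding abs_mult using chw_up \<theta>_le Bd0 q1 by (intro mult_right_mono mult_mono) auto
        finally have 1: "chw z * \<theta> z * q z \<le> C0 * Bd * (hess_sum z * q z)" by (simp add: algebra_simps)
        have "ch z * r3 \<le> ch z * \<bar>r3\<bar>" using ch_pos[OF z] by (intro mult_left_mono) auto
        also have "\<dots> \<le> \<chi>1 * (C0 * hess_sum z)"
          using ch_up ch_pos[OF z] \<chi>1 hppp_trace_le[of z] unfolding r3_def by (intro mult_mono) auto
        also have "\<dots> \<le> \<chi>1 * (C0 * hess_sum z) * q z"
          using mult_left_mono[OF q1(1), of "\<chi>1 * (C0 * hess_sum z)"] \<chi>1 C0_pos U0 by simp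
        finally have 2: "ch z * r3 \<le> C0 * \<chi>1 * (hess_sum z * q z)" by (simp add: algebra_simps)
        have "- (hpp (P z) (P z) \<bullet> \<beta> z (X z)) \<le> C0 * norm (P z) * a"
          using hpp_abs[of "P z" "P z" "\<beta> z (X z)"] unfolding a_def by linarith
        also have "\<dots> \<le> C0 * q z * a"
          by (rule mult_right_mono[OF mult_left_mono[OF q1(2)] a0]) (use C0_pos in simp)
        also have "C0 * q z * a = C0 * (a * q z)" by simp
        finally have 3: "- 2 * (hpp (P z) (P z) \<bullet> \<beta> z (X z)) \<le> 2 * C0 * (a * q z)" by linarith
        have "0 \<le> C0 * Bd * (a * q z)" "0 \<le> C0 * \<chi>1 * (a * q z)" "0 \<le> 2 * C0 * (hess_sum z * q z)"
          using C0_pos Bd0 \<chi>1 a0 U0 q1 by auto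
        then have "C0 * Bd * (hess_sum z * q z) + C0 * \<chi>1 * (hess_sum z * q z) + 2 * C0 * (a * q z) \<le> K2 * (a + hess_sum z) * q z"
          by (simp add: K2_def algebra_simps)
        then show ?thesis using 1 2 3 unfolding r_def by linarith
      qed
      have x0: "ch z / (C0 * CARD('n)) \<ge> x0" unfolding x0_def using ch_low C0_pos by (intro divide_right_mono) auto
      have "0 \<le> a\<^sup>2 + x0 * (hess_sum z)\<^sup>2 + 6 * c * Yp z * (q z + kp z * (ch z * \<theta> z))\<^sup>2
         - 3 * c * (Yp z)\<^sup>2 * (kpp z * ww + r)"
      proof (rule bernstein_quadratic_nonneg[OF _ _ _ k0 a0 U0 _ _ _ s r e small])
        show "K2 \<ge> 0" "K3 \<ge> 0" using C0_pos Bd0 \<chi>1 N0 \<rho> by (auto simp: K2_def K3_def)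
        show "q z \<ge> 0" using qz norm_ge_zero[of "P z"] by linarith
      qed (use c Yp_le[OF z] in auto)
      moreover have "x0 * (hess_sum z)\<^sup>2 \<le> ch z / (C0 * CARD('n)) * (hess_sum z)\<^sup>2" using x0 by (intro mult_right_mono) auto
      ultimately show ?thesis using low G by linarith
    qed
  qed
  obtain \<alpha> where \<alpha>: "\<alpha> > 0" "\<And>z. z \<in> S \<Longrightarrow> \<bar>chw z * \<theta> z\<bar> < \<alpha>" using drift_bounded by blast
  \<comment> \<open>With \<open>\<delta> * \<alpha> \<le> 1\<close> and
    \<open>\<delta> \<le> 1\<close>, the nonuniform \<alpha> disappears from the final
    bound.\<close>
  define \<delta> where "\<delta> = 1 / (\<alpha> + 1)"
  have \<delta>: "\<delta> > 0" "\<delta> \<le> 1" "\<delta> * \<alpha> \<le> 1" using \<alpha>(1) by (auto simp: \<delta>_def field_simps)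
  obtain z where z: "z \<in> S" "\<And>y. y \<in> S \<Longrightarrow> V y \<le> V z + \<delta>" "\<And>v. V1 z (v, 0) = 0"
    "snd z = 0 \<and> V1 z (0, 1) \<le> \<delta> * \<alpha> \<or> snd z = T \<and> V1 z (0, 1) > 0 \<or>
     z \<in> U \<and> ellip z (V2 z) < drift z (V1 z)"
    using maximum_principle[of V V1 V2, OF dV dV1 per \<alpha> \<delta>(1)] by blast
  have PR: "norm (P z) \<le> R"
  proof (rule ccontr)
    assume "\<not> norm (P z) \<le> R"
    then have big: "norm (P z) \<ge> R" by simp
    show False using z(4)
    proof (elim disjE)
      assume 0: "snd z = 0 \<and> V1 z (0, 1) \<le> \<delta> * \<alpha>"
      define x where "x = fst z"
      have zx: "z = (x, 0)" using 0 by (simp add: x_def prod_eq_iff)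
      have mz: "m z = m0 x" by (simp add: zx initial)
      have pos: "0 < m0 x" using \<mu>(1) \<mu>(2)[of x] by linarith
      have ww: "w z = \<phi> (m0 x)" using w_\<phi>[OF z(1)] mz by simp
      have "w z \<ge> w0" unfolding ww w0_def using \<phi>_le_iff[OF \<mu>(1) pos] \<mu>(2) by simp
      then have D0: "D z = 0" by (simp add: D_def)
      have \<phi>x: "\<bar>\<phi> (m0 x)\<bar> \<le> \<Lambda>" "0 \<le> \<phi>1 (m0 x)" "\<phi>1 (m0 x) \<le> \<Lambda>"
        using \<phi>b[of "m0 x"] \<mu>(1) \<mu>(2)[of x] \<mu>(3)[of x] l by auto
      have qz: "q z \<ge> h (P z) - C0 - \<Lambda> - \<kappa>" using q_low[OF z(1)] \<phi>x(1) ww by auto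
      have "Y z \<ge> 1" using Mu[OF z(1)] D0 by (simp add: Y_def zx)
      then have "Yp z \<ge> 1" by (simp add: Yp_def)
      then have Y2: "(Yp z)\<^sup>2 \<ge> 1" by (metis one_le_power)
      have q0: "q z \<ge> 0" using qz R(2)[OF big] norm_ge_zero[of "P z"] by linarith
      have "Y1 z (X z) = q z" by (simp add: Y1_def q_def kp_def D0) (simp add: X_def)
      then have "V1 z (X z) = - (\<phi>1 (m0 x) * m01 x (P z)) + 3 * c * (Yp z)\<^sup>2 * q z"
        unfolding V1_def PbX[OF z(1)] using w1_initial[of x "P z"] by (simp add: zx)
      moreover have "\<phi>1 (m0 x) * m01 x (P z) \<le> \<Lambda>\<^sup>2 * norm (P z)"
      proof -
        have "\<phi>1 (m0 x) * m01 x (P z) \<le> \<phi>1 (m0 x) * (\<Lambda> * norm (P z))"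
          using m01[of x "P z"] \<phi>x by (intro mult_left_mono) auto
        also have "\<dots> \<le> \<Lambda> * (\<Lambda> * norm (P z))" using \<phi>x \<Lambda>0 by (intro mult_right_mono) auto
        finally show ?thesis by (simp add: power2_eq_square)
      qed
      moreover have "3 * c * (Yp z)\<^sup>2 * q z \<ge> 3 * c * (h (P z) - C0 - \<Lambda> - \<kappa>)"
      proof -
        have "3 * c * (h (P z) - C0 - \<Lambda> - \<kappa>) \<le> 3 * c * q z" using qz c by (intro mult_left_mono) auto
        also have "\<dots> \<le> 3 * c * (Yp z)\<^sup>2 * q z"
          using mult_left_mono[OF Y2, of "3 * c * q z"] c q0 by (simp add: algebra_simps)
        finally show ?thesis .
      qed
      \<comment> \<open>The summand 1 in the second growth condition on \<open>R\<close> is there to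
        contradict this.\<close>
      moreover have "V1 z (X z) \<le> 1" using V1X[OF z(1,3)] conjunct2[OF 0] \<delta>(3) by linarith
      ultimately show False using R(3)[OF big] by linarith
    next
      assume 0: "snd z = T \<and> V1 z (0, 1) > 0"
      define x where "x = fst z"
      have zx: "z = (x, T)" using 0 by (simp add: x_def prod_eq_iff)
      have "N0 * (D z) ^ 3 \<ge> 0" using N0 Dnn by simp
      moreover have "Mu + 1 - u z \<le> Ym" using Mu[OF z(1)] unfolding Ym_def by linarith
      ultimately have "Y z \<le> 0" using \<kappa>0(2) by (simp add: Y_def zx)
      then have "Yp z = 0" by (simp add: Yp_def)
      then have "V1 z (X z) = - (\<phi>1 (m z) * m1 z (P z, 0))"
        unfolding V1_def PbX[OF z(1)] w1_m1_S[OF z(1)] by simp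
      moreover have "m1 z (P z, 0) \<ge> 0"
      proof -
        have "G1 (m z) * m1 z (P z, 0) = P z \<bullet> P z"
          using u1_terminal[of x "P z"] u1_split[OF z(1), of "P z" 0] by (simp add: zx)
        then show ?thesis using G1_pos[OF m_pos[OF z(1)]] by (metis inner_ge_zero zero_le_mult_iff less_le_not_le)
      qed
      ultimately have "V1 z (X z) \<le> 0" using \<phi>1_pos[OF m_pos[OF z(1)]] by simp
      then show False using V1X[OF z(1,3)] 0 by simp
    next
      assume "z \<in> U \<and> ellip z (V2 z) < drift z (V1 z)"
      then show False using interior[of z] big by simp
    qed
  qed
  have "(P y \<bullet> P y) / 2 \<le> V y" using c Yp_le[OF y] by (simp add: V_def)
  also have "V y \<le> V z + \<delta>" by (rule z(2)[OF y])
  also have "V z \<le> R\<^sup>2 / 2 + c * Ym ^ 3"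
  proof -
    have "(norm (P z))\<^sup>2 \<le> R\<^sup>2" using PR by (intro power_mono) auto
    moreover have "c * (Yp z) ^ 3 \<le> c * Ym ^ 3" using c Yp_le[OF z(1)] by (intro mult_left_mono power_mono) auto
    ultimately show ?thesis unfolding V_def by (simp add: power2_norm_eq_inner)
  qed
  finally show ?thesis using \<delta>(2) by (simp add: power2_norm_eq_inner)
qed

text \<open>From below, the bound follows from \<open>density_upper\<close> everywhere. From above
  it would need a lower bound for \<open>w\<close>, which is at hand only on the two faces; the
  maximum principle for the time derivative of \<open>u\<close> carries it inside.\<close>

lemma time_derivative_bound:
  assumes \<mu>: "0 < \<mu>0" "\<And>x. \<mu>0 \<le> m0 x" "\<And>x. m0 x \<le> \<mu>1"
    and hB: "\<And>z. z \<in> S \<Longrightarrow> \<bar>h (P z)\<bar> \<le> B" and z: "z \<in> S"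
  shows "\<bar>u1 z (0, 1)\<bar> \<le> B + \<bar>\<phi> \<mu>0\<bar> + \<bar>\<phi> \<mu>1\<bar>"
proof -
  have \<mu>1: "\<mu>1 > 0" using \<mu> by (meson less_le_trans)
  have u1_w: "u1 z (0, 1) = h (P z) - w z" for z by (simp add: w_def)
  have "w z \<le> \<phi> \<mu>1" by (rule density_upper[OF \<mu>1 \<mu>(3) z])
  then have lo: "u1 z (0, 1) \<ge> - B - \<bar>\<phi> \<mu>1\<bar>" using hB[OF z] unfolding u1_w by linarith
  have up: "u1 z (0, 1) \<le> B + \<bar>\<phi> \<mu>0\<bar>"
  proof (rule ut_upper[OF _ _ z])
    have S: "(x, 0) \<in> S" "(x, T) \<in> S" for x using T_pos by auto
    have low: "w z \<ge> \<phi> \<mu>0" if "z \<in> S" "m z \<ge> \<mu>0" for z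
      using w_\<phi>[OF that(1)] \<phi>_le_iff[OF \<mu>(1) m_pos[OF that(1)]] that(2) by simp
    show "u1 (x, 0) (0, 1) \<le> B + \<bar>\<phi> \<mu>0\<bar>" for x
      using low[OF S(1), of x] \<mu>(2)[of x] hB[OF S(1), of x] unfolding u1_w by (simp add: initial)
    have "m (x, T) \<ge> \<mu>0" for x using terminal_density_bound[of "- 1" \<mu>0 x] \<mu> by simp
    then show "u1 (x, T) (0, 1) \<le> B + \<bar>\<phi> \<mu>0\<bar>" for x
      using low[OF S(2), of x] hB[OF S(2), of x] unfolding u1_w by simp
  qed
  show ?thesis using lo up by linarith
qed

end

section \<open>Uniform estimates and the limit\<close>

lemma dderiv_eqI_at:
  assumes "at z within S = at z" and "(\<phi> has_derivative D) (at z)"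
  shows "dderiv S v \<phi> z = D v"
  unfolding dderiv_def assms(1) using frechet_derivative_at[OF assms(2)] by simp

lemmas dderiv_eqI = dderiv_eqI_at[OF refl]

lemma dderiv_works:
  "\<phi> differentiable_on S \<Longrightarrow> z \<in> S \<Longrightarrow> (\<phi> has_derivative (\<lambda>v. dderiv S v \<phi> z)) (at z within S)"
  unfolding dderiv_def differentiable_on_def by (auto simp: frechet_derivative_works)

lemma Ck_Suc_dderiv:
  "Ck (Suc k) S \<phi> \<Longrightarrow> z \<in> S \<Longrightarrow> (\<phi> has_derivative (\<lambda>v. dderiv S v \<phi> z)) (at z within S)"
  by (simp add: dderiv_works)

lemma Ck_dderiv: "Ck (Suc k) S \<phi> \<Longrightarrow> Ck k S (dderiv S v \<phi>)"
  by simp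

lemma Ck_imp_continuous_on: "Ck k S \<phi> \<Longrightarrow> continuous_on S \<phi>"
  by (cases k) (auto intro: differentiable_imp_continuous_on)

section \<open>The Hamiltonian as a function of the momentum alone\<close>

locale hamiltonian =
  fixes H :: "(real ^ 'n) \<times> (real ^ 'n) \<Rightarrow> real" and C0 \<tau> :: real
  assumes C0_pos: "C0 > 0" and H: "assumption_H C0 \<tau> H" and indep: "x_independent H UNIV"
begin

definition "h p = H (0, p)"
definition "hp p = (\<chi> i. dderiv UNIV (0, axis i 1) H (0, p))"
definition "hpp p v = (\<chi> i. dderiv UNIV (0, v) (dderiv UNIV (0, axis i 1) H) (0, p))"
definition "hppp p v y = (\<chi> i. dderiv UNIV (0, y) (dderiv UNIV (0, v) (dderiv UNIV (0, axis i 1) H)) (0, p))"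

lemma slice_derivative:
  fixes \<psi> :: "(real ^ 'n) \<times> (real ^ 'n) \<Rightarrow> real"
  assumes "Ck (Suc k) UNIV \<psi>"
  shows "((\<lambda>p. \<psi> (0, p)) has_derivative (\<lambda>v. dderiv UNIV (0, v) \<psi> (0, p))) (at p)"
proof -
  have "((\<lambda>p. (0 :: real ^ 'n, p)) has_derivative (\<lambda>v. (0, v))) (at p)"
    by (auto intro!: derivative_eq_intros)
  from has_derivative_compose[OF this] show ?thesis
    using Ck_Suc_dderiv[OF assms, of "(0, p)"] by auto
qed

lemma Ck_H: "Ck (Suc (Suc (Suc (Suc 0)))) UNIV H"
  and Ck1: "Ck (Suc (Suc (Suc (Suc 0)))) UNIV (dderiv UNIV (0, v) H)"
  using H unfolding assumption_H_def by (simp_all add: numeral_eq_Suc del: Ck.simps)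


lemma h_deriv: "(h has_derivative (\<lambda>v. hp p \<bullet> v)) (at p)"
proof -
  from slice_derivative[OF Ck_H, of p]
  have d: "(h has_derivative (\<lambda>v. dderiv UNIV (0, v) H (0, p))) (at p)" by (simp add: h_def[abs_def])
  have "dderiv UNIV (0, v) H (0, p) = hp p \<bullet> v" for v
    using linear_expand[OF has_derivative_linear[OF d], of v] by (simp add: hp_def inner_vec_def mult.commute)
  then show ?thesis using d by simp
qed

lemma hp_deriv: "(hp has_derivative hpp p) (at p)"
  unfolding hp_def[abs_def] hpp_def[abs_def]
  by (intro has_derivative_vec slice_derivative[OF Ck1])

lemma hpp_deriv: "((\<lambda>p. hpp p v) has_derivative hppp p v) (at p)"
  unfolding hpp_def[abs_def] hppp_def[abs_def]
  by (intro has_derivative_vec slice_derivative[OF Ck_dderiv[OF Ck1]])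

lemma H_h: "H = (\<lambda>z. h (snd z))"
  using indep unfolding x_independent_def h_def by (auto simp: fun_eq_iff)

lemma snd_deriv:
  assumes "(f has_derivative f') (at (snd z))"
  shows "((\<lambda>z. f (snd z)) has_derivative (\<lambda>v. f' (snd v))) (at z)"
  by (rule has_derivative_compose[of snd snd z UNIV f f', OF _ assms]) (auto intro!: derivative_eq_intros)

lemma dderiv1: "dderiv UNIV (y, v) H = (\<lambda>z. hp (snd z) \<bullet> v)"
proof
  fix z :: "(real ^ 'n) \<times> (real ^ 'n)"
  have "(H has_derivative (\<lambda>v. hp (snd z) \<bullet> snd v)) (at z)"
    using snd_deriv[OF h_deriv, of z] unfolding H_h[symmetric] .
  from dderiv_eqI[OF this] show "dderiv UNIV (y, v) H z = hp (snd z) \<bullet> v" by simp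
qed

lemma dderiv2: "dderiv UNIV (y', w) (dderiv UNIV (y, v) H) = (\<lambda>z. hpp (snd z) w \<bullet> v)"
proof
  fix z :: "(real ^ 'n) \<times> (real ^ 'n)"
  have "((\<lambda>z. hp (snd z) \<bullet> v) has_derivative (\<lambda>w. hpp (snd z) (snd w) \<bullet> v)) (at z)"
    by (rule has_derivative_inner_left[OF snd_deriv[OF hp_deriv]])
  from dderiv_eqI[OF this] show "dderiv UNIV (y', w) (dderiv UNIV (y, v) H) z = hpp (snd z) w \<bullet> v"
    by (simp add: dderiv1)
qed

lemma dderiv3: "dderiv UNIV (y'', w') (dderiv UNIV (y', w) (dderiv UNIV (y, v) H)) = (\<lambda>z. hppp (snd z) w w' \<bullet> v)"
proof
  fix z :: "(real ^ 'n) \<times> (real ^ 'n)"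
  have "((\<lambda>z. hpp (snd z) w \<bullet> v) has_derivative (\<lambda>w'. hppp (snd z) w (snd w') \<bullet> v)) (at z)"
    by (rule has_derivative_inner_left[OF snd_deriv[OF hpp_deriv]])
  from dderiv_eqI[OF this] show "dderiv UNIV (y'', w') (dderiv UNIV (y', w) (dderiv UNIV (y, v) H)) z = hppp (snd z) w w' \<bullet> v"
    by (simp add: dderiv2)
qed

lemma DpH: "DpH H (x, p) = hp p"
  by (simp add: DpH_def dderiv1 vec_eq_iff inner_axis)

lemma hpp_sym: "hpp p v \<bullet> w = hpp p w \<bullet> v"
  using second_derivative_symmetric[of UNIV p h "\<lambda>p v. hp p \<bullet> v" "\<lambda>v w. hpp p w \<bullet> v" w v]
    h_deriv has_derivative_inner_left[OF hp_deriv] by simp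

lemma hpp_lower: "v \<bullet> v / C0 \<le> hpp p v \<bullet> v"
  and hpp_upper: "hpp p v \<bullet> v \<le> C0 * (v \<bullet> v)"
  using H unfolding assumption_H_def dderiv2 by auto

lemma h_growth: "hp p \<bullet> p \<ge> 2 * h p - C0"
  using H unfolding assumption_H_def DpH by (simp add: h_def)

lemma hppp_bound: "\<bar>hppp p v v' \<bullet> v''\<bar> * (1 + norm p) \<le> C0 * norm v * norm v' * norm v''"
proof -
  have "\<bar>hppp p v v' \<bullet> v''\<bar> \<le> C0 * (1 + norm p) powr (-1) * norm v'' * norm v * norm v'"
    using H unfolding assumption_H_def dderiv3 by auto
  moreover have p: "1 + norm p > 0" by (smt (verit) norm_ge_zero)
  ultimately have "\<bar>hppp p v v' \<bullet> v''\<bar> \<le> (C0 * norm v * norm v' * norm v'') / (1 + norm p)"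
    by (simp add: powr_minus field_simps)
  then show ?thesis using p by (simp add: pos_le_divide_eq)
qed

text \<open>The lower bound on the second derivative is integrated twice along the ray through
  \<open>p\<close>.\<close>

lemma h_lower: "h p \<ge> h 0 + hp 0 \<bullet> p + (norm p)\<^sup>2 / (2 * C0)"
proof -
  let ?c = "(norm p)\<^sup>2 / C0"
  have d1: "((\<lambda>s. h (s *\<^sub>R p)) has_real_derivative hp (s *\<^sub>R p) \<bullet> p) (at s)" for s
    using has_real_derivative_along_line[OF h_deriv, where z = 0 and s = s and v = p] by simp
  have d2: "((\<lambda>s. hp (s *\<^sub>R p) \<bullet> p) has_real_derivative hpp (s *\<^sub>R p) p \<bullet> p) (at s)" for s
    using has_real_derivative_along_line[OF has_derivative_inner_left[OF hp_deriv, of p], where z = 0 and s = s and v = p] by simp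
  have k1: "hp (s *\<^sub>R p) \<bullet> p - s * ?c \<ge> hp 0 \<bullet> p" if "s \<ge> 0" for s
  proof -
    have "hp (0 *\<^sub>R p) \<bullet> p - 0 * ?c \<le> hp (s *\<^sub>R p) \<bullet> p - s * ?c"
    proof (rule DERIV_nonneg_imp_nondecreasing[OF that, of "\<lambda>s. hp (s *\<^sub>R p) \<bullet> p - s * ?c"])
      fix x
      have "((\<lambda>s. hp (s *\<^sub>R p) \<bullet> p - s * ?c) has_real_derivative hpp (x *\<^sub>R p) p \<bullet> p - ?c) (at x)"
        using C0_pos by (auto intro!: derivative_eq_intros d2)
      moreover have "hpp (x *\<^sub>R p) p \<bullet> p - ?c \<ge> 0"
        using hpp_lower[of p "x *\<^sub>R p"] by (simp add: power2_norm_eq_inner)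
      ultimately show "\<exists>y. ((\<lambda>s. hp (s *\<^sub>R p) \<bullet> p - s * ?c) has_real_derivative y) (at x) \<and> 0 \<le> y" by blast
    qed
    then show ?thesis by simp
  qed
  let ?k = "\<lambda>s. h (s *\<^sub>R p) - s\<^sup>2 / 2 * ?c - s * (hp 0 \<bullet> p)"
  have "?k 0 \<le> ?k 1"
  proof (rule DERIV_nonneg_imp_nondecreasing[of 0 1 ?k])
    fix x :: real assume "0 \<le> x"
    have "(?k has_real_derivative hp (x *\<^sub>R p) \<bullet> p - x * ?c - hp 0 \<bullet> p) (at x)"
      using C0_pos by (auto intro!: derivative_eq_intros d1)
    then show "\<exists>y. (?k has_real_derivative y) (at x) \<and> 0 \<le> y" using k1[OF \<open>0 \<le> x\<close>] by force
  qed simp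
  then show ?thesis by simp
qed

lemma h_coercive:
  assumes A: "A \<ge> 0" "A' \<ge> 0"
  obtains R where "R \<ge> 0" "\<And>p. norm p \<ge> R \<Longrightarrow> h p \<ge> A * norm p + A'"
proof
  \<comment> \<open>For \<open>norm p \<ge> R\<close> the quadratic term of \<open>h_lower\<close>
    exceeds the sum of all the constants times \<open>norm p\<close>; the final 1 gives
    \<open>norm p \<ge> 1\<close>, so constants are dominated by their multiples with
    \<open>norm p\<close>.\<close>
  define R where "R = 2 * C0 * (A + A' + \<bar>h 0\<bar> + norm (hp 0)) + 1"
  have R: "R \<ge> 1" using C0_pos A by (simp add: R_def)
  then show "R \<ge> 0" by simp
  fix p :: "real ^ 'n" assume p: "norm p \<ge> R"
  define r where "r = norm p"
  have r: "r \<ge> R" "r \<ge> 1" using p R by (auto simp: r_def)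
  have "r / (2 * C0) \<ge> A + A' + \<bar>h 0\<bar> + norm (hp 0)"
    using r(1) C0_pos by (simp add: R_def field_simps)
  from mult_right_mono[OF this, of r] r
  have "r\<^sup>2 / (2 * C0) \<ge> (A + A' + \<bar>h 0\<bar> + norm (hp 0)) * r" by (simp add: power2_eq_square)
  moreover have "A' * r \<ge> A'" "\<bar>h 0\<bar> * r \<ge> \<bar>h 0\<bar>"
    using mult_left_mono[OF r(2), of A'] mult_left_mono[OF r(2), of "\<bar>h 0\<bar>"] A by auto
  moreover have "hp 0 \<bullet> p \<ge> - (norm (hp 0) * r)"
    using Cauchy_Schwarz_ineq2[of "hp 0" p] by (simp add: r_def abs_le_iff)
  ultimately show "h p \<ge> A * norm p + A'"
    using h_lower[of p] unfolding r_def[symmetric] by (simp add: algebra_simps)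
qed

lemma h_bounded:
  obtains B where "\<And>p. norm p \<le> R \<Longrightarrow> \<bar>h p\<bar> \<le> B"
proof -
  have "continuous_on (cball 0 R) h"
    using h_deriv by (meson continuous_at_imp_continuous_on has_derivative_continuous)
  then have "compact (h ` cball 0 R)" by (rule compact_continuous_image) simp
  then obtain B where "\<forall>y\<in>h ` cball 0 R. norm y \<le> B" using compact_imp_bounded bounded_iff by blast
  then show ?thesis by (intro that[of B]) auto
qed

end

section \<open>The couplings as functions of the density alone\<close>

locale coupling =
  fixes f :: "(real ^ 'n) \<times> real \<Rightarrow> ereal"
  assumes regular: "coupling_regular f" and indep: "x_independent f {0..}"
begin

definition "F s = real_of_ereal (f (0, s))"
definition "F1 s = D2 pos_half (\<lambda>z. real_of_ereal (f z)) (0, s)"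
definition "F2 s = D2 pos_half (D2 pos_half (\<lambda>z. real_of_ereal (f z))) (0, s)"

lemma f_F: "s > 0 \<Longrightarrow> f (x, s) = ereal (F s)"
proof -
  assume s: "s > 0"
  have "f (x, s) = f (0, s)" using indep s unfolding x_independent_def by (meson atLeast_iff less_imp_le)
  moreover have "f (0, s) \<noteq> \<infinity>" "f (0, s) \<noteq> - \<infinity>" using regular s unfolding coupling_regular_def by auto
  ultimately show ?thesis by (cases "f (0, s)") (simp_all add: F_def)
qed

lemma slice:
  fixes \<psi> :: "(real ^ 'n) \<times> real \<Rightarrow> real"
  assumes "Ck (Suc k) pos_half \<psi>" "s > 0"
  shows "((\<lambda>s. \<psi> (0, s)) has_real_derivative D2 pos_half \<psi> (0, s)) (at s)"
proof -
  have o: "open (pos_half :: ((real ^ 'n) \<times> real) set)" by (simp add: open_Times)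
  have "(\<psi> has_derivative (\<lambda>v. dderiv pos_half v \<psi> (0, s))) (at (0, s))"
    using Ck_Suc_dderiv[OF assms(1), of "(0, s)"] assms(2) at_within_open[OF _ o, of "(0, s)"] by auto
  then have "(\<psi> has_derivative (\<lambda>v. dderiv pos_half v \<psi> (0, s))) (at (0 + s *\<^sub>R (0, 1)))"
    by (simp add: zero_prod_def)
  from has_real_derivative_along_line[OF this] show ?thesis by (simp add: zero_prod_def D2_def)
qed

lemma Ck_F: "Ck (Suc (Suc (Suc (Suc 0)))) pos_half (\<lambda>z. real_of_ereal (f z))"
  using regular by (simp add: coupling_regular_def numeral_eq_Suc del: Ck.simps)

lemma D2_eq: "D2 S \<psi> = dderiv S (0, 1) \<psi>"
  by (simp add: D2_def fun_eq_iff)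

lemma F_deriv: "s > 0 \<Longrightarrow> (F has_real_derivative F1 s) (at s)"
  unfolding F_def[abs_def] F1_def by (rule slice[OF Ck_F])

lemma F1_deriv: "s > 0 \<Longrightarrow> (F1 has_real_derivative F2 s) (at s)"
  unfolding F1_def[abs_def] F2_def by (rule slice[of "Suc (Suc 0)"]) (use Ck_dderiv[OF Ck_F] in \<open>simp_all only: D2_eq\<close>)

lemma F1_pos: "s > 0 \<Longrightarrow> F1 s > 0"
  using regular by (simp add: coupling_regular_def F1_def)

lemma F2_cont: "continuous_on {0<..} F2"
proof -
  have "continuous_on (pos_half :: ((real ^ 'n) \<times> real) set) (D2 pos_half (D2 pos_half (\<lambda>z. real_of_ereal (f z))))"
    unfolding D2_eq by (rule Ck_imp_continuous_on[OF Ck_dderiv[OF Ck_dderiv[OF Ck_F]]])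
  then show ?thesis unfolding F2_def[abs_def]
    by (rule continuous_on_compose2) (auto intro!: continuous_intros)
qed

lemma F1_cont: "continuous_on {0<..} F1"
  by (meson DERIV_continuous_on F1_deriv greaterThan_iff has_field_derivative_at_within)

lemma F_cont: "continuous_on {0<..} F"
  by (meson DERIV_continuous_on F_deriv greaterThan_iff has_field_derivative_at_within)

lemma F1_lower:
  assumes "0 < a" "a \<le> b"
  obtains l where "l > 0" "\<And>s. s \<in> {a..b} \<Longrightarrow> l \<le> F1 s"
proof -
  have "continuous_on {a..b} F1" by (rule continuous_on_subset[OF F1_cont]) (use assms in auto)
  from continuous_attains_inf[OF compact_Icc _ this] assms
  obtain s where "s \<in> {a..b}" "\<forall>y\<in>{a..b}. F1 s \<le> F1 y" by auto
  then show ?thesis using that[of "F1 s"] F1_pos[of s] assms by auto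
qed

end

lemma continuous_Icc_bounded:
  fixes f :: "real \<Rightarrow> real"
  assumes "continuous_on {0<..} f" "0 < a"
  obtains B where "\<And>s. s \<in> {a..b} \<Longrightarrow> \<bar>f s\<bar> \<le> B"
proof -
  have "continuous_on {a..b} f" by (rule continuous_on_subset[OF assms(1)]) (use assms in auto)
  then have "compact (f ` {a..b})" by (rule compact_continuous_image) simp
  then obtain B where "\<forall>y\<in>f ` {a..b}. norm y \<le> B" using compact_imp_bounded bounded_iff by blast
  then show ?thesis by (intro that[of B]) auto
qed

section \<open>Bounds for the initial density\<close>

lemma periodic_bounded:
  fixes \<psi> :: "real ^ 'n \<Rightarrow> real"
  assumes "continuous_on UNIV \<psi>" "torus_periodic \<psi>"
  obtains x where "\<And>y. \<psi> y \<le> \<psi> x"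
proof -
  \<comment> \<open>A dummy time variable makes the compactness argument for the cylinder available
    on the torus.\<close>
  have "continuous_on (closed_cyl 1) (\<lambda>z :: (real ^ 'n) \<times> real. \<psi> (fst z))"
    by (intro continuous_on_compose2[OF assms(1)] continuous_intros) auto
  moreover have "torus_periodic (\<lambda>x. \<psi> (fst (x, t)))" for t :: real using assms(2) by simp
  ultimately obtain z :: "(real ^ 'n) \<times> real" where "\<And>y. y \<in> closed_cyl 1 \<Longrightarrow> \<psi> (fst y) \<le> \<psi> (fst z)"
    using closed_cyl_max[of 1 "\<lambda>z :: (real ^ 'n) \<times> real. \<psi> (fst z)", OF _ zero_le_one] by blast
  then have "\<psi> y \<le> \<psi> (fst z)" for y
    by (metis atLeastAtMost_iff fst_conv iso_tuple_UNIV_I mem_Times_iff order_refl snd_conv zero_le_one)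
  then show ?thesis by (rule that)
qed

lemma assumption_M_bounds:
  assumes M: "assumption_M m0"
  obtains \<mu>0 \<mu>1 where "0 < \<mu>0" "\<And>x. \<mu>0 \<le> m0 x" "\<And>x. m0 x \<le> \<mu>1"
proof -
  have c: "continuous_on UNIV m0" and p: "torus_periodic m0"
    using M Ck_imp_continuous_on by (auto simp: assumption_M_def)
  obtain x where x: "\<And>y. m0 y \<le> m0 x" using periodic_bounded[OF c p] by blast
  have "continuous_on UNIV (\<lambda>x. - m0 x)" "torus_periodic (\<lambda>x. - m0 x)"
    using c p by (auto intro: continuous_intros simp: torus_periodic_def)
  then obtain y where y: "\<And>z. - m0 z \<le> - m0 y" using periodic_bounded by blast
  show ?thesis by (rule that[of "m0 y" "m0 x"]) (use x y M in \<open>auto simp: assumption_M_def\<close>)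
qed

lemma assumption_M_Ck: "assumption_M m0 \<Longrightarrow> Ck (Suc (Suc (Suc (Suc 0)))) UNIV m0"
  by (simp add: assumption_M_def numeral_eq_Suc del: Ck.simps)

lemma assumption_M_derivative:
  assumes M: "assumption_M m0"
  shows "(m0 has_derivative (\<lambda>v. dderiv UNIV v m0 x)) (at x)"
  using Ck_Suc_dderiv[OF assumption_M_Ck[OF M], of x] by simp

lemma assumption_M_gradient_bound:
  fixes m0 :: "real ^ 'n \<Rightarrow> real"
  assumes M: "assumption_M m0"
  obtains B where "B \<ge> 0" "\<And>x v. \<bar>dderiv UNIV v m0 x\<bar> \<le> B * norm v"
proof -
  note d = assumption_M_derivative[OF M]
  have p: "torus_periodic m0" using M by (simp add: assumption_M_def)
  have per: "torus_periodic (\<lambda>x. \<bar>dderiv UNIV v m0 x\<bar>)" for v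
    unfolding torus_periodic_def
  proof (intro allI impI)
    fix x k :: "real ^ 'n" assume k: "\<forall>i. k $ i \<in> \<int>"
    have "(m0 has_derivative (\<lambda>v. dderiv UNIV v m0 (x + k))) (at x within UNIV)"
      by (rule has_derivative_translate_within[OF _ _ _ d]) (use p k in \<open>auto simp: torus_periodic_def\<close>)
    from dderiv_eqI[of m0, OF this] show "\<bar>dderiv UNIV v m0 (x + k)\<bar> = \<bar>dderiv UNIV v m0 x\<bar>" by simp
  qed
  have "continuous_on UNIV (dderiv UNIV v m0)" for v
    by (rule Ck_imp_continuous_on[OF Ck_dderiv[OF assumption_M_Ck[OF M]]])
  then have "\<exists>B. \<forall>x. \<bar>dderiv UNIV v m0 x\<bar> \<le> B" for v
    using periodic_bounded[OF continuous_on_rabs per[of v]] by metis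
  then obtain B where B: "\<And>v x. \<bar>dderiv UNIV v m0 x\<bar> \<le> B v" by metis
  define C where "C = (\<Sum>i\<in>UNIV. B (axis i 1))"
  have B0: "B v \<ge> 0" for v using B[of v 0] by linarith
  show ?thesis
  proof (rule that[of C])
    show "C \<ge> 0" unfolding C_def by (intro sum_nonneg B0)
    fix x v
    have "dderiv UNIV v m0 x = (\<Sum>i\<in>UNIV. v $ i * dderiv UNIV (axis i 1) m0 x)"
      using linear_expand[OF has_derivative_linear[OF d], of v x] by simp
    also have "\<bar>\<dots>\<bar> \<le> (\<Sum>i\<in>UNIV. \<bar>v $ i * dderiv UNIV (axis i 1) m0 x\<bar>)" by (rule sum_abs)
    also have "\<dots> \<le> (\<Sum>i\<in>UNIV. B (axis i 1) * norm v)"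
    proof (rule sum_mono)
      fix i
      have "\<bar>v $ i\<bar> * \<bar>dderiv UNIV (axis i 1) m0 x\<bar> \<le> norm v * B (axis i 1)"
        using component_le_norm_cart[of v i] B by (intro mult_mono) auto
      then show "\<bar>v $ i * dderiv UNIV (axis i 1) m0 x\<bar> \<le> B (axis i 1) * norm v" by (simp add: abs_mult mult.commute)
    qed
    finally show "\<bar>dderiv UNIV v m0 x\<bar> \<le> C * norm v" by (simp add: C_def sum_distrib_right)
  qed
qed

section \<open>Estimates uniform in \<epsilon>\<close>

locale mfg_problem =
  fixes H :: "(real ^ 'n) \<times> (real ^ 'n) \<Rightarrow> real"
    and f g :: "(real ^ 'n) \<times> real \<Rightarrow> ereal"
    and m0 :: "real ^ 'n \<Rightarrow> real"
    and C0 \<tau> T :: real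
  assumes T_pos: "T > 0" and C0_pos: "C0 > 0"
    and M: "assumption_M m0" and H: "assumption_H C0 \<tau> H"
    and f: "coupling_regular f" and g: "coupling_regular g"
    and indep: "x_independent H UNIV" "x_independent f {0..}" "x_independent g {0..}"
begin

sublocale ham: hamiltonian H C0 \<tau>
  by unfold_locales (fact C0_pos H indep(1))+

sublocale f: coupling f
  by unfold_locales (fact f indep(2))+

sublocale g: coupling g
  by unfold_locales (fact g indep(3))+

abbreviation "S \<equiv> closed_cyl T :: ((real ^ 'n) \<times> real) set"

text \<open>The logarithmic term is absorbed into the coupling: \<phi> and its derivatives carry all
  the dependence on \<epsilon>, and the a priori estimates apply unchanged.\<close>

lemma mfg_solution_of_classical:
  assumes \<epsilon>: "\<epsilon> > 0" and sol: "classical_solution \<epsilon> T H f g m0 u m"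
  shows "mfg_solution T C0 ham.h ham.hp ham.hpp ham.hppp
    (\<lambda>s. f.F s + \<epsilon> * ln s) (\<lambda>s. f.F1 s + \<epsilon> / s) (\<lambda>s. f.F2 s - \<epsilon> / s\<^sup>2) g.F g.F1 m0
    (\<lambda>x v. dderiv UNIV v m0 x) u m (\<lambda>z v. dderiv S v u z) (\<lambda>z v. dderiv S v m z)
    (\<lambda>z v w. dderiv S w (dderiv S v u) z) (\<lambda>z v w y. dderiv S y (dderiv S w (dderiv S v u)) z)"
proof -
  have "Ck 3 S u" "Ck 2 S m" using sol by (simp_all add: classical_solution_def del: Ck.simps)
  then have Cku: "Ck (Suc (Suc (Suc 0))) S u" and Ckm: "Ck (Suc (Suc 0)) S m"
    by (simp_all add: numeral_eq_Suc del: Ck.simps)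
  have u_per: "torus_periodic (\<lambda>x. u (x, t))" and m_per: "torus_periodic (\<lambda>x. m (x, t))" if "t \<in> {0..T}" for t
    using sol that by (auto simp: classical_solution_def)
  have mpos: "m z > 0" if "z \<in> S" for z using sol that by (auto simp: classical_solution_def)
  have u1: "(u has_derivative (\<lambda>v. dderiv S v u z)) (at z within S)" if "z \<in> S" for z
    by (rule Ck_Suc_dderiv[OF Cku that])
  have u2: "(dderiv S v u has_derivative (\<lambda>w. dderiv S w (dderiv S v u) z)) (at z within S)" if "z \<in> S" for z v
    by (rule Ck_Suc_dderiv[OF Ck_dderiv[OF Cku] that])
  have u3: "(dderiv S w (dderiv S v u) has_derivative (\<lambda>y. dderiv S y (dderiv S w (dderiv S v u)) z)) (at z within S)"
    if "z \<in> S" for z v w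
    by (rule Ck_Suc_dderiv[OF Ck_dderiv[OF Ck_dderiv[OF Cku]] that])
  have m1: "(m has_derivative (\<lambda>v. dderiv S v m z)) (at z within S)" if "z \<in> S" for z
    by (rule Ck_Suc_dderiv[OF Ckm that])
  let ?P = "\<lambda>z. \<chi> i. dderiv S (ex i) u z"
  have P: "?P z = Dx S u z" for z by (simp add: Dx_def)
  have hjb: "ham.h (?P z) - dderiv S (0, 1) u z = f.F (m z) + \<epsilon> * ln (m z)" if "z \<in> open_cyl T" for z
  proof -
    obtain x t where z: "z = (x, t)" and t: "t \<in> {0<..<T}" using \<open>z \<in> open_cyl T\<close> by (cases z) auto
    have zS: "z \<in> S" using t z by auto
    have "ereal (- D2 S u z + H (x, Dx S u z)) = f (x, m z) + ereal (\<epsilon> * ln (m z))"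
      using sol t unfolding classical_solution_def z by blast
    also have "f (x, m z) = ereal (f.F (m z))" by (rule f.f_F[OF mpos[OF zS]])
    finally have "- D2 S u z + H (x, Dx S u z) = f.F (m z) + \<epsilon> * ln (m z)" by simp
    moreover have "H (x, p) = ham.h p" for p using fun_cong[OF ham.H_h, of "(x, p)"] by simp
    ultimately show ?thesis by (simp add: P D2_def)
  qed
  \<comment> \<open>The divergence is expanded by the product rule. Its part with the gradient of
    \<open>m\<close> joins the time derivative to form the derivative along \<open>X\<close>, and
    the rest is \<open>m\<close> times \<theta>.\<close>
  have transport: "dderiv S (- ham.hp (?P z), 1) m z =
      m z * (\<Sum>i\<in>UNIV. ham.hpp (?P z) (\<chi> ia. dderiv S (ex i) (dderiv S (ex ia) u) z) $ i)"
    if "z \<in> open_cyl T" for z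
  proof -
    obtain x t where z: "z = (x, t)" and t: "t \<in> {0<..<T}" using \<open>z \<in> open_cyl T\<close> by (cases z) auto
    have zS: "z \<in> S" using t z by auto
    let ?\<beta> = "\<lambda>W. \<chi> ia. dderiv S W (dderiv S (ex ia) u) z"
    let ?V = "\<lambda>z. m z *\<^sub>R DpH H (fst z, Dx S u z)"
    have at: "at z within S = at z"
      by (rule at_within_open_subset[of z "open_cyl T"]) (use that in \<open>auto simp: open_Times\<close>)
    have V: "?V = (\<lambda>z. m z *\<^sub>R ham.hp (?P z))" by (simp add: P ham.DpH)
    have dP: "(?P has_derivative ?\<beta>) (at z within S)" by (intro has_derivative_vec u2 zS)
    have dhp: "((\<lambda>z. ham.hp (?P z)) has_derivative (\<lambda>W. ham.hpp (?P z) (?\<beta> W))) (at z within S)"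
      by (rule has_derivative_compose[OF dP ham.hp_deriv])
    have dV: "dderiv S (ex i) (\<lambda>y. ?V y $ i) z = m z * ham.hpp (?P z) (?\<beta> (ex i)) $ i + dderiv S (ex i) m z * ham.hp (?P z) $ i" for i
    proof -
      have "((\<lambda>y. m y * ham.hp (?P y) $ i) has_derivative
        (\<lambda>W. m z * ham.hpp (?P z) (?\<beta> W) $ i + dderiv S W m z * ham.hp (?P z) $ i)) (at z within S)"
        by (rule has_derivative_mult[OF m1[OF zS] bounded_linear.has_derivative[OF bounded_linear_vec_nth dhp]])
      then have "dderiv S (ex i) (\<lambda>y. m y * ham.hp (?P y) $ i) z
        = m z * ham.hpp (?P z) (?\<beta> (ex i)) $ i + dderiv S (ex i) m z * ham.hp (?P z) $ i"
        unfolding at by (rule dderiv_eqI_at[OF at])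
      moreover have "(\<lambda>y. ?V y $ i) = (\<lambda>y. m y * ham.hp (?P y) $ i)" unfolding fun_cong[OF V] by simp
      ultimately show ?thesis by (simp only:)
    qed
    have "D2 S m z - divx S ?V z = 0" using sol t unfolding classical_solution_def z by blast
    then have "dderiv S (0, 1) m z - (\<Sum>i\<in>UNIV. dderiv S (ex i) m z * ham.hp (?P z) $ i)
       = m z * (\<Sum>i\<in>UNIV. ham.hpp (?P z) (?\<beta> (ex i)) $ i)"
      unfolding divx_def dV D2_def by (simp add: sum.distrib sum_distrib_left)
    moreover have "dderiv S (- ham.hp (?P z), 1) m z = dderiv S (0, 1) m z - (\<Sum>i\<in>UNIV. dderiv S (ex i) m z * ham.hp (?P z) $ i)"
    proof -
      have lin: "linear (\<lambda>v. dderiv S v m z)" using has_derivative_linear[OF m1[OF zS]] .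
      have "dderiv S (- ham.hp (?P z), 1) m z = dderiv S (- ham.hp (?P z), 0) m z + dderiv S (0, 1) m z"
        using linear_add[OF lin, of "(- ham.hp (?P z), 0)" "(0, 1)"] by simp
      moreover have "dderiv S (- ham.hp (?P z), 0) m z = (\<Sum>i\<in>UNIV. (- ham.hp (?P z)) $ i * dderiv S (ex i) m z)"
        using linear_expand[OF linear_sp[OF lin], of "- ham.hp (?P z)"] by simp
      ultimately show ?thesis by (simp add: sum_negf mult.commute)
    qed
    ultimately show ?thesis by simp
  qed
  have terminal: "u (x, T) = g.F (m (x, T))" for x
  proof -
    have "(x, T) \<in> S" using T_pos by auto
    from g.f_F[OF mpos[OF this], of x] have "ereal (u (x, T)) = ereal (g.F (m (x, T)))"
      using sol unfolding classical_solution_def by metis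
    then show ?thesis by simp
  qed
  have \<phi>: "((\<lambda>s. f.F s + \<epsilon> * ln s) has_real_derivative f.F1 s + \<epsilon> / s) (at s)"
    "((\<lambda>s. f.F1 s + \<epsilon> / s) has_real_derivative f.F2 s - \<epsilon> / s\<^sup>2) (at s)"
    "f.F1 s + \<epsilon> / s > 0" if "s > 0" for s
    using that \<epsilon> f.F1_pos[OF that]
    by (auto intro!: derivative_eq_intros f.F_deriv f.F1_deriv add_pos_pos simp: power2_eq_square field_simps)
  have \<phi>2: "continuous_on {0<..} (\<lambda>s. f.F2 s - \<epsilon> / s\<^sup>2)"
    by (intro continuous_intros f.F2_cont) auto
  show ?thesis
  proof unfold_locales
    show "torus_periodic (\<lambda>x. dderiv S v u (x, t))" if "t \<in> {0..T}" for t v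
      by (rule dderiv_periodic[OF u_per that])
    show "torus_periodic (\<lambda>x. dderiv S w (dderiv S v u) (x, t))" if "t \<in> {0..T}" for t v w
      by (rule dderiv_periodic[OF dderiv_periodic[OF u_per] that])
    show "m (x, 0) = m0 x" for x using sol by (simp add: classical_solution_def)
  qed (fact T_pos C0_pos ham.h_deriv ham.hp_deriv ham.hpp_deriv ham.hpp_sym ham.hpp_lower ham.hpp_upper
      ham.h_growth ham.hppp_bound \<phi> \<phi>2 g.F_deriv g.F1_pos u1 u2 u3 m1 assumption_M_derivative[OF M]
      u_per m_per mpos hjb transport terminal | assumption
      | (rule ham.h_deriv ham.hp_deriv ham.hpp_deriv \<phi> g.F_deriv g.F1_pos u1 u2 u3 m1 u_per m_per mpos hjb transport, assumption))+
qed

text \<open>Every constant is fixed before \<epsilon> and the solution are introduced; the logarithm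
  is controlled by \<open>\<epsilon> \<le> 1\<close> on \<open>{\<mu>0 / 2..\<mu>1}\<close>, which
  stays away from 0.\<close>

lemma uniform_estimates:
  obtains C \<mu>0 \<mu>1 where "0 < \<mu>0" "\<And>\<epsilon> u m. 0 < \<epsilon> \<Longrightarrow> \<epsilon> \<le> 1 \<Longrightarrow> classical_solution \<epsilon> T H f g m0 u m \<Longrightarrow>
     (\<forall>z\<in>S. \<bar>u z\<bar> \<le> C \<and> norm (Dx S u z) \<le> C \<and> \<bar>D2 S u z\<bar> \<le> C) \<and>
     (\<forall>x. \<mu>0 \<le> m (x, T) \<and> m (x, T) \<le> \<mu>1)"
proof -
  obtain \<mu>0 \<mu>1 where \<mu>: "0 < \<mu>0" "\<And>x. \<mu>0 \<le> m0 x" "\<And>x. m0 x \<le> \<mu>1"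
    by (rule assumption_M_bounds[OF M]) (rule that)
  have \<mu>01: "\<mu>0 \<le> \<mu>1" using \<mu>(2,3) order_trans by blast
  have a: "0 < \<mu>0 / 2" "\<mu>0 / 2 \<le> \<mu>1" using \<mu>(1) \<mu>01 by auto
  obtain Bg where Bg: "\<And>x v. \<bar>dderiv UNIV v m0 x\<bar> \<le> Bg * norm v" by (rule assumption_M_gradient_bound[OF M]) (rule that)
  obtain l where l: "l > 0" "\<And>s. s \<in> {\<mu>0 / 2..\<mu>1} \<Longrightarrow> l \<le> f.F1 s" by (rule f.F1_lower[OF a]) (rule that)
  obtain B0 where B0: "\<And>s. s \<in> {\<mu>0 / 2..\<mu>1} \<Longrightarrow> \<bar>f.F s\<bar> \<le> B0" by (rule continuous_Icc_bounded[OF f.F_cont a(1)]) (rule that)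
  obtain B1 where B1: "\<And>s. s \<in> {\<mu>0 / 2..\<mu>1} \<Longrightarrow> \<bar>f.F1 s\<bar> \<le> B1" by (rule continuous_Icc_bounded[OF f.F1_cont a(1)]) (rule that)
  obtain B2 where B2: "\<And>s. s \<in> {\<mu>0 / 2..\<mu>1} \<Longrightarrow> \<bar>f.F2 s\<bar> \<le> B2" by (rule continuous_Icc_bounded[OF f.F2_cont a(1)]) (rule that)
  have "continuous_on {0<..} (ln :: real \<Rightarrow> real)" by (intro continuous_intros) auto
  then obtain B3 where B3: "\<And>s. s \<in> {\<mu>0 / 2..\<mu>1} \<Longrightarrow> \<bar>ln s\<bar> \<le> B3" using continuous_Icc_bounded[OF _ a(1)] by blast
  have "continuous_on {0<..} (\<lambda>s :: real. 1 / s)" by (intro continuous_intros) auto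
  then obtain B4 where B4: "\<And>s. s \<in> {\<mu>0 / 2..\<mu>1} \<Longrightarrow> \<bar>1 / s\<bar> \<le> B4" using continuous_Icc_bounded[OF _ a(1)] by blast
  have "continuous_on {0<..} (\<lambda>s :: real. 1 / s\<^sup>2)" by (intro continuous_intros) auto
  then obtain B5 where B5: "\<And>s. s \<in> {\<mu>0 / 2..\<mu>1} \<Longrightarrow> \<bar>1 / s\<^sup>2\<bar> \<le> B5" using continuous_Icc_bounded[OF _ a(1)] by blast
  have mem: "\<mu>1 \<in> {\<mu>0 / 2..\<mu>1}" "\<mu>0 \<in> {\<mu>0 / 2..\<mu>1}" using a \<mu>(1) \<mu>01 by auto
  \<comment> \<open>One constant for \<phi> and its two derivatives, for all
    \<open>0 < \<epsilon> \<le> 1\<close>, and for the gradient of \<open>m0\<close>.\<close>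
  define \<Lambda> where "\<Lambda> = B0 + B1 + B2 + B3 + B4 + B5 + \<bar>Bg\<bar>"
  have Bnn: "B0 \<ge> 0" "B1 \<ge> 0" "B2 \<ge> 0" "B3 \<ge> 0" "B4 \<ge> 0" "B5 \<ge> 0"
    using B0[OF mem(1)] B1[OF mem(1)] B2[OF mem(1)] B3[OF mem(1)] B4[OF mem(1)] B5[OF mem(1)] by linarith+
  have \<Lambda>0: "\<Lambda> > 0" using Bnn B1[OF mem(1)] l(2)[OF mem(1)] l(1) unfolding \<Lambda>_def by linarith
  \<comment> \<open>The gap of the coupling without the logarithm: adding the increasing term
    \<open>\<epsilon> * ln s\<close> only widens it, so \<rho> works for every \<epsilon>.\<close>
  define \<rho> where "\<rho> = f.F \<mu>0 - f.F (\<mu>0 / 2)"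
  have \<rho>0: "\<rho> > 0"
  proof -
    have "f.F (\<mu>0 / 2) < f.F \<mu>0"
    proof (rule DERIV_pos_imp_increasing[of _ _ f.F])
      fix s assume "\<mu>0 / 2 \<le> s"
      then have "s > 0" using a(1) by linarith
      then show "\<exists>y. (f.F has_real_derivative y) (at s) \<and> 0 < y" using f.F_deriv f.F1_pos by blast
    qed (use \<mu>(1) in simp)
    then show ?thesis by (simp add: \<rho>_def)
  qed
  define Mu where "Mu = \<bar>g.F \<mu>0\<bar> + \<bar>g.F \<mu>1\<bar> + (\<Lambda> + \<bar>ham.h 0\<bar> + 1) * T + T\<^sup>2"
  have Mu0: "Mu \<ge> 0" unfolding Mu_def using T_pos \<Lambda>0 by (intro add_nonneg_nonneg mult_nonneg_nonneg) auto
  define Ym where "Ym = 2 * Mu + 1"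
  define \<kappa> where "\<kappa> = Ym / T"
  define N0 where "N0 = Ym / \<rho> ^ 3"
  define \<chi>1 where "\<chi>1 = \<mu>1 * \<Lambda>"
  define Bd where "Bd = (\<Lambda> + \<mu>1 * \<Lambda>) / l"
  define x0 where "x0 = \<mu>0 / 2 * l / (C0 * CARD('n))"
  define \<sigma> where "\<sigma> = 3 * N0 * \<rho>\<^sup>2 * (\<chi>1 * C0)"
  define K2 where "K2 = C0 * (2 + Bd + \<chi>1)"
  define K3 where "K3 = 6 * N0 * \<rho> * ((\<chi>1 * C0)\<^sup>2 + \<chi>1 * C0)"
  define k0 where "k0 = min 1 x0"
  have k0: "k0 > 0" "k0 \<le> 1" "k0 \<le> x0" using \<mu>(1) l(1) C0_pos by (auto simp: k0_def x0_def)
  have Ym0: "Ym \<ge> 1" using Mu0 by (simp add: Ym_def)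
  have \<chi>10: "\<chi>1 \<ge> 0" unfolding \<chi>1_def using \<mu>(1) \<mu>01 \<Lambda>0 by simp
  have K30: "K3 \<ge> 0" unfolding K3_def N0_def using Ym0 \<rho>0 \<chi>10 C0_pos by simp
  \<comment> \<open>The denominator dominates each of the three expressions in the smallness
    conditions, and the 1 keeps it positive. None of them depends on \<open>c\<close>.\<close>
  define c where "c = k0 / (1 + 24 * Ym * \<sigma>\<^sup>2 + 12 * Ym\<^sup>2 * K3 + 3 * Ym ^ 3 * K2\<^sup>2)"
  have nn: "24 * Ym * \<sigma>\<^sup>2 \<ge> 0" "12 * Ym\<^sup>2 * K3 \<ge> 0" "3 * Ym ^ 3 * K2\<^sup>2 \<ge> 0" using Ym0 K30 by auto
  have tot: "1 + 24 * Ym * \<sigma>\<^sup>2 + 12 * Ym\<^sup>2 * K3 + 3 * Ym ^ 3 * K2\<^sup>2 > 0" using nn by linarith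
  have c0: "c > 0" unfolding c_def by (rule divide_pos_pos[OF k0(1) tot])
  have c_le: "c * t \<le> k0" if "t \<le> 24 * Ym * \<sigma>\<^sup>2 + 12 * Ym\<^sup>2 * K3 + 3 * Ym ^ 3 * K2\<^sup>2" for t
  proof -
    have "c * t \<le> c * (1 + 24 * Ym * \<sigma>\<^sup>2 + 12 * Ym\<^sup>2 * K3 + 3 * Ym ^ 3 * K2\<^sup>2)"
      by (rule mult_left_mono) (use that c0 in linarith)+
    also have "\<dots> = k0" unfolding c_def using tot by simp
    finally show ?thesis .
  qed
  have small: "24 * c * Ym * \<sigma>\<^sup>2 \<le> k0" "12 * c * Ym\<^sup>2 * K3 \<le> k0" "3 * c * Ym ^ 3 * K2\<^sup>2 \<le> k0"
  proof -
    have "c * (24 * Ym * \<sigma>\<^sup>2) \<le> k0" "c * (12 * Ym\<^sup>2 * K3) \<le> k0" "c * (3 * Ym ^ 3 * K2\<^sup>2) \<le> k0"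
      by (rule c_le; use nn in linarith)+
    then show "24 * c * Ym * \<sigma>\<^sup>2 \<le> k0" "12 * c * Ym\<^sup>2 * K3 \<le> k0" "3 * c * Ym ^ 3 * K2\<^sup>2 \<le> k0"
      by (simp_all only: mult_ac)
  qed
  \<comment> \<open>\<open>A\<close> and \<open>A'\<close> are read off from the two conditions on
    \<open>R\<close> below: the parts with \<open>3 * c\<close> serve \<open>R3\<close>, the others
    serve \<open>R2\<close>.\<close>
  define A where "A = 1 + \<Lambda>\<^sup>2 / (3 * c)"
  define A' where "A' = C0 + \<Lambda> + \<kappa> + 1 + 2 / (3 * c)"
  have \<kappa>0: "\<kappa> \<ge> 0" unfolding \<kappa>_def using Ym0 T_pos by simp
  have "A \<ge> 0" "A' \<ge> 0" using c0 C0_pos \<Lambda>0 \<kappa>0 by (auto simp: A_def A'_def)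
  then obtain R where R: "R \<ge> 0" "\<And>p. norm p \<ge> R \<Longrightarrow> ham.h p \<ge> A * norm p + A'"
    by (rule ham.h_coercive) (rule that)
  have R2: "ham.h p - C0 - \<Lambda> - \<kappa> \<ge> 1 + norm p" and R3: "3 * c * (ham.h p - C0 - \<Lambda> - \<kappa>) > \<Lambda>\<^sup>2 * norm p + 1"
    if "norm p \<ge> R" for p
  proof -
    have 1: "ham.h p - C0 - \<Lambda> - \<kappa> \<ge> norm p + 1 + (\<Lambda>\<^sup>2 / (3 * c) * norm p + 2 / (3 * c))"
      using R(2)[OF that] by (simp add: A_def A'_def algebra_simps)
    have "\<Lambda>\<^sup>2 / (3 * c) * norm p + 2 / (3 * c) \<ge> 0" using c0 by simp
    then show "ham.h p - C0 - \<Lambda> - \<kappa> \<ge> 1 + norm p" using 1 by linarith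
    have "\<Lambda>\<^sup>2 * norm p + 2 = 3 * c * (\<Lambda>\<^sup>2 / (3 * c) * norm p + 2 / (3 * c))"
      using c0 by (simp add: field_simps)
    also have "\<dots> \<le> 3 * c * (ham.h p - C0 - \<Lambda> - \<kappa>)"
      using 1 c0 norm_ge_zero[of p] by (intro mult_left_mono) linarith+
    finally show "3 * c * (ham.h p - C0 - \<Lambda> - \<kappa>) > \<Lambda>\<^sup>2 * norm p + 1" by linarith
  qed
  define R' where "R' = sqrt (R\<^sup>2 + 2 * c * Ym ^ 3 + 2)"
  obtain Bh where Bh: "\<And>p. norm p \<le> R' \<Longrightarrow> \<bar>ham.h p\<bar> \<le> Bh" by (rule ham.h_bounded) (rule that)
  define C where "C = max Mu (max R' (Bh + 2 * \<Lambda>))"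
  show ?thesis
  proof (rule that[OF \<mu>(1), of C \<mu>1])
    fix \<epsilon> :: real and u m
    assume \<epsilon>: "0 < \<epsilon>" "\<epsilon> \<le> 1" and sol: "classical_solution \<epsilon> T H f g m0 u m"
    interpret sol: mfg_solution T C0 ham.h ham.hp ham.hpp ham.hppp
      "\<lambda>s. f.F s + \<epsilon> * ln s" "\<lambda>s. f.F1 s + \<epsilon> / s" "\<lambda>s. f.F2 s - \<epsilon> / s\<^sup>2" g.F g.F1 m0
      "\<lambda>x v. dderiv UNIV v m0 x" u m "\<lambda>z v. dderiv S v u z" "\<lambda>z v. dderiv S v m z"
      "\<lambda>z v w. dderiv S w (dderiv S v u) z" "\<lambda>z v w y. dderiv S y (dderiv S w (dderiv S v u)) z"
      "\<lambda>z. \<chi> i. dderiv S (ex i) u z" "\<lambda>z W. \<chi> i. dderiv S W (dderiv S (ex i) u) z"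
      "\<lambda>z. \<Sum>i\<in>UNIV. ham.hpp (\<chi> j. dderiv S (ex j) u z) (\<chi> j. dderiv S (ex i) (dderiv S (ex j) u) z) $ i"
      by (rule mfg_solution_of_classical[OF \<epsilon>(1) sol]) (rule reflexive)+
    have e_le: "\<bar>\<epsilon> * x\<bar> \<le> \<bar>x\<bar>" for x using \<epsilon> by (simp add: abs_mult mult_left_le_one_le)
    have \<phi>b: "\<bar>f.F s + \<epsilon> * ln s\<bar> \<le> \<Lambda> \<and> l \<le> f.F1 s + \<epsilon> / s \<and> f.F1 s + \<epsilon> / s \<le> \<Lambda> \<and> \<bar>f.F2 s - \<epsilon> / s\<^sup>2\<bar> \<le> \<Lambda>"
      if "\<mu>0 / 2 \<le> s" "s \<le> \<mu>1" for s
    proof -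
      have s: "s \<in> {\<mu>0 / 2..\<mu>1}" "s > 0" using that a(1) by auto
      have e4: "\<epsilon> / s = \<epsilon> * (1 / s)" "\<epsilon> / s\<^sup>2 = \<epsilon> * (1 / s\<^sup>2)" by simp_all
      have "\<bar>f.F s + \<epsilon> * ln s\<bar> \<le> \<Lambda>" using B0[OF s(1)] B3[OF s(1)] e_le[of "ln s"] Bnn unfolding \<Lambda>_def by linarith
      moreover have "l \<le> f.F1 s + \<epsilon> / s" using l(2)[OF s(1)] s(2) \<epsilon>(1) by (simp add: add_increasing2)
      moreover have "f.F1 s + \<epsilon> / s \<le> \<Lambda>" using B1[OF s(1)] B4[OF s(1)] e_le[of "1 / s"] Bnn unfolding \<Lambda>_def e4 by linarith
      moreover have "\<bar>f.F2 s - \<epsilon> / s\<^sup>2\<bar> \<le> \<Lambda>" using B2[OF s(1)] B5[OF s(1)] e_le[of "1 / s\<^sup>2"] Bnn unfolding \<Lambda>_def e4 by linarith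
      ultimately show ?thesis by blast
    qed
    have \<mu>1: "\<mu>1 > 0" using \<mu>(1) \<mu>01 by linarith
    have Mu: "\<bar>u z\<bar> \<le> Mu" if "z \<in> S" for z
    proof -
      have k: "(\<bar>f.F \<mu> + \<epsilon> * ln \<mu> - ham.h 0\<bar> + 1) * T \<le> (\<Lambda> + \<bar>ham.h 0\<bar> + 1) * T" if "\<mu> \<in> {\<mu>0 / 2..\<mu>1}" for \<mu>
        using \<phi>b[of \<mu>] that T_pos by (intro mult_right_mono) auto
      have "u z \<le> g.F \<mu>1 + (\<bar>f.F \<mu>1 + \<epsilon> * ln \<mu>1 - ham.h 0\<bar> + 1) * T + T\<^sup>2"
        using sol.value_bound[of 1 \<mu>1 z] \<mu>1 \<mu>(3) that by simp
      moreover have "- u z \<le> - g.F \<mu>0 + (\<bar>f.F \<mu>0 + \<epsilon> * ln \<mu>0 - ham.h 0\<bar> + 1) * T + T\<^sup>2"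
        using sol.value_bound[of "- 1" \<mu>0 z] \<mu>(1,2) that by simp
      ultimately show ?thesis using k[OF mem(1)] k[OF mem(2)] unfolding Mu_def by linarith
    qed
    have grad0: "\<bar>dderiv UNIV v m0 x\<bar> \<le> \<Lambda> * norm v" for x v
    proof -
      have "Bg \<le> \<Lambda>" using Bnn unfolding \<Lambda>_def by linarith
      from order_trans[OF Bg mult_right_mono[OF this norm_ge_zero]] show ?thesis .
    qed
    have \<rho>': "\<rho> \<le> f.F \<mu>0 + \<epsilon> * ln \<mu>0 - (f.F (\<mu>0 / 2) + \<epsilon> * ln (\<mu>0 / 2))"
    proof -
      have "ln (\<mu>0 / 2) \<le> ln \<mu>0" using \<mu>(1) by simp
      then have "\<epsilon> * ln (\<mu>0 / 2) \<le> \<epsilon> * ln \<mu>0" using \<epsilon>(1) by (intro mult_left_mono) auto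
      then show ?thesis by (simp add: \<rho>_def)
    qed
    have P: "(\<chi> i. dderiv S (ex i) u z) = Dx S u z" for z by (simp add: Dx_def)
    have grad: "norm (Dx S u z) \<le> R'" if "z \<in> S" for z
    proof -
      have "(norm (Dx S u z))\<^sup>2 \<le> R\<^sup>2 + 2 * c * Ym ^ 3 + 2"
        unfolding P[symmetric] Ym_def
        by (rule sol.gradient_bound[OF \<mu> Mu l(1) \<phi>b grad0 \<rho>0 \<rho>' c0 k0(1,2) k0(3)[unfolded x0_def]
            small[unfolded \<sigma>_def K2_def K3_def N0_def \<chi>1_def Bd_def Ym_def] R(1)
            R2[unfolded \<kappa>_def Ym_def] R3[unfolded \<kappa>_def Ym_def] that])
      then show ?thesis unfolding R'_def by (simp add: real_le_rsqrt)
    qed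
    have time: "\<bar>D2 S u z\<bar> \<le> Bh + 2 * \<Lambda>" if "z \<in> S" for z
    proof -
      have "\<bar>dderiv S (0, 1) u z\<bar> \<le> Bh + \<bar>f.F \<mu>0 + \<epsilon> * ln \<mu>0\<bar> + \<bar>f.F \<mu>1 + \<epsilon> * ln \<mu>1\<bar>"
        by (rule sol.time_derivative_bound[OF \<mu> _ that]) (use Bh grad in \<open>auto simp: P\<close>)
      then show ?thesis using \<phi>b[of \<mu>0] \<phi>b[of \<mu>1] mem by (simp add: D2_def)
    qed
    have "\<mu>0 \<le> m (x, T) \<and> m (x, T) \<le> \<mu>1" for x
      using sol.terminal_density_bound[of "- 1" \<mu>0 x] sol.terminal_density_bound[of 1 \<mu>1 x] \<mu> \<mu>1 by simp
    then show "(\<forall>z\<in>S. \<bar>u z\<bar> \<le> C \<and> norm (Dx S u z) \<le> C \<and> \<bar>D2 S u z\<bar> \<le> C) \<and>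
       (\<forall>x. \<mu>0 \<le> m (x, T) \<and> m (x, T) \<le> \<mu>1)"
      using Mu grad time unfolding C_def by (meson max.coboundedI1 max.coboundedI2)
  qed
qed

text \<open>\<open>S\<close> is convex, so a bound on the derivative is a Lipschitz constant; one
  \<open>C\<close> pays for space and one for time.\<close>

lemma lipschitz_of_C1_bound:
  assumes sol: "classical_solution \<epsilon> T H f g m0 u m"
    and C: "\<forall>z\<in>S. \<bar>u z\<bar> \<le> C \<and> norm (Dx S u z) \<le> C \<and> \<bar>D2 S u z\<bar> \<le> C"
  shows "(2 * C)-lipschitz_on S u"
proof (rule lipschitz_onI)
  have "(0, 0) \<in> S" using T_pos by auto
  then have "\<bar>u (0, 0)\<bar> \<le> C" using C by blast
  then have Cn: "0 \<le> C" by linarith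
  then show "0 \<le> 2 * C" by simp
  have "Ck 3 S u" using sol by (simp add: classical_solution_def del: Ck.simps)
  then have "Ck (Suc 2) S u" by (simp add: numeral_eq_Suc del: Ck.simps)
  note d = Ck_Suc_dderiv[OF this]
  fix x y assume xy: "x \<in> S" "y \<in> S"
  have "norm (u x - u y) \<le> 2 * C * norm (x - y)"
  proof (rule differentiable_bound[OF _ d])
    show "convex S" by (intro convex_Times) auto
    fix z assume z: "z \<in> S"
    have lin: "linear (\<lambda>v. dderiv S v u z)" using has_derivative_linear[OF d[OF z]] .
    show "onorm (\<lambda>v. dderiv S v u z) \<le> 2 * C"
    proof (rule onorm_le)
      fix W :: "(real ^ 'n) \<times> real"
      obtain v s where W: "W = (v, s)" by (cases W)
      have "dderiv S W u z = dderiv S (v, 0) u z + dderiv S (0, s) u z"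
        using linear_add[OF lin, of "(v, 0)" "(0, s)"] by (simp add: W)
      also have "dderiv S (0, s) u z = s * D2 S u z"
        using linear_scale[OF lin, of s "(0, 1)"] by (simp add: D2_def)
      also have "dderiv S (v, 0) u z = Dx S u z \<bullet> v"
        using linear_expand[OF linear_sp[OF lin], of v] by (simp add: Dx_def inner_vec_def mult.commute)
      finally have "norm (dderiv S W u z) \<le> norm (Dx S u z) * norm v + \<bar>s\<bar> * \<bar>D2 S u z\<bar>"
        using Cauchy_Schwarz_ineq2[of "Dx S u z" v] abs_triangle_ineq[of "Dx S u z \<bullet> v" "s * D2 S u z"]
        by (simp add: abs_mult)
      also have "\<dots> \<le> C * norm W + norm W * C"
        using C z Cn norm_fst_le[of v s] norm_snd_le[of s v] by (intro add_mono mult_mono) (auto simp: W)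
      finally show "norm (dderiv S W u z) \<le> 2 * C * norm W" by simp
    qed
  qed (use xy in auto)
  then show "dist (u x) (u y) \<le> 2 * C * dist x y" by (simp add: dist_norm)
qed

text \<open>The constant \<open>l\<close> bounds the derivative of \<open>g\<close> from below
  between \<open>\<mu>0\<close> and \<open>\<mu>1\<close> and is chosen before the solution, so
  \<open>K / l\<close> is common to all \<epsilon>.\<close>

lemma terminal_density_lipschitz:
  assumes \<mu>: "0 < \<mu>0"
  obtains l where "l > 0" "\<And>\<epsilon> u m. classical_solution \<epsilon> T H f g m0 u m \<Longrightarrow> K-lipschitz_on S u \<Longrightarrow>
    (\<forall>x. \<mu>0 \<le> m (x, T) \<and> m (x, T) \<le> \<mu>1) \<Longrightarrow> (K / l)-lipschitz_on UNIV (\<lambda>x. m (x, T))"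
proof (cases "\<mu>0 \<le> \<mu>1")
  case False
  \<comment> \<open>No density satisfies the bounds in this case, so any \<open>l\<close> will
    do.\<close>
  show ?thesis by (rule that[of 1]) (use False order_trans in \<open>force+\<close>)
next
  case True
  obtain l where l: "l > 0" "\<And>s. s \<in> {\<mu>0..\<mu>1} \<Longrightarrow> l \<le> g.F1 s" by (rule g.F1_lower[OF \<mu> True]) (rule that)
  have less: "l * (b - a) \<le> g.F b - g.F a" if "\<mu>0 \<le> a" "a < b" "b \<le> \<mu>1" for a b
  proof -
    have "\<exists>z. a < z \<and> z < b \<and> g.F b - g.F a = (b - a) * g.F1 z"
      by (rule MVT2) (use that \<mu> g.F_deriv in auto)
    then obtain z where z: "a < z" "z < b" "g.F b - g.F a = (b - a) * g.F1 z" by blast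
    then show ?thesis using mult_left_mono[OF l(2)[of z], of "b - a"] that by (simp add: mult.commute)
  qed
  have abs: "l * \<bar>b - a\<bar> \<le> \<bar>g.F b - g.F a\<bar>" if "\<mu>0 \<le> a" "a \<le> \<mu>1" "\<mu>0 \<le> b" "b \<le> \<mu>1" for a b
  proof (cases a b rule: linorder_cases)
    case less
    then show ?thesis using \<open>\<And>b a. \<mu>0 \<le> a \<Longrightarrow> a < b \<Longrightarrow> b \<le> \<mu>1 \<Longrightarrow> l * (b - a) \<le> g.F b - g.F a\<close>[of a b] that by simp
  next
    case greater
    then show ?thesis using less[of b a] that by (simp add: abs_minus_commute)
  qed simp
  show ?thesis
  proof (rule that[OF l(1)])
    fix \<epsilon> u m
    assume sol: "classical_solution \<epsilon> T H f g m0 u m" and K: "K-lipschitz_on S u"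
      and b: "\<forall>x. \<mu>0 \<le> m (x, T) \<and> m (x, T) \<le> \<mu>1"
    have uG: "u (x, T) = g.F (m (x, T))" for x
    proof -
      have "m (x, T) > 0" using b \<mu> less_le_trans by blast
      from g.f_F[OF this, of x] have "ereal (u (x, T)) = ereal (g.F (m (x, T)))"
        using sol unfolding classical_solution_def by metis
      then show ?thesis by simp
    qed
    show "(K / l)-lipschitz_on UNIV (\<lambda>x. m (x, T))"
    proof (rule lipschitz_onI)
      show "0 \<le> K / l" using lipschitz_on_nonneg[OF K] l(1) by simp
      fix x y :: "real ^ 'n"
      have "l * dist (m (x, T)) (m (y, T)) \<le> dist (u (x, T)) (u (y, T))"
        using abs[of "m (y, T)" "m (x, T)"] b by (simp add: uG dist_real_def)
      also have "\<dots> \<le> K * dist (x, T) (y, T)" by (rule lipschitz_onD[OF K]) (use T_pos in auto)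
      also have "\<dots> = K * dist x y" by (simp add: dist_Pair_Pair)
      finally show "dist (m (x, T)) (m (y, T)) \<le> K / l * dist x y" using l(1) by (simp add: field_simps)
    qed
  qed
qed

end

theorem theorem5p5:
  fixes H :: "(real ^ 'n) \<times> (real ^ 'n) \<Rightarrow> real"
    and f g :: "(real ^ 'n) \<times> real \<Rightarrow> ereal"
    and m0 :: "real ^ 'n \<Rightarrow> real"
    and C0 \<tau> T :: real
    and u_eps m_eps :: "real \<Rightarrow> (real ^ 'n) \<times> real \<Rightarrow> real"
  assumes "T > 0" and "C0 > 0" and "0 \<le> \<tau>" and "\<tau> < 1"
    and "assumption_M m0"
    and "assumption_H C0 \<tau> H"
    and "assumption_F C0 \<tau> f"
    and "assumption_G g"
    and "degenerate_ellipticity f g"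
    and "x_independent H UNIV" and "x_independent f {0..}" and "x_independent g {0..}"
    and "\<And>\<epsilon>. \<epsilon> > 0 \<Longrightarrow> classical_solution \<epsilon> T H f g m0 (u_eps \<epsilon>) (m_eps \<epsilon>)"
  shows "(\<exists>C. \<forall>\<^sub>F \<epsilon> in at_right 0. \<forall>z \<in> closed_cyl T.
            \<bar>u_eps \<epsilon> z\<bar> \<le> C \<and> norm (Dx (closed_cyl T) (u_eps \<epsilon>) z) \<le> C \<and>
            \<bar>D2 (closed_cyl T) (u_eps \<epsilon>) z\<bar> \<le> C) \<and>
         (\<forall>(e :: nat \<Rightarrow> real) u m.
            (\<forall>k. e k > 0) \<and> e \<longlonglongrightarrow> 0 \<and>
            converges_ae T (\<lambda>k. u_eps (e k)) u \<and> converges_ae T (\<lambda>k. m_eps (e k)) m \<and>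
            weak_solution T H f g m0 u m \<longrightarrow>
            lipschitz_representative (open_cyl T) (closed_cyl T) u \<and>
            lipschitz_representative UNIV UNIV (\<lambda>x. m (x, T)))"
proof -
  note sol = assms(13)
  interpret mfg_problem H f g m0 C0 \<tau> T
    by unfold_locales (use assms in \<open>auto simp: assumption_F_def assumption_G_def Let_def\<close>)
  obtain C \<mu>0 \<mu>1 where \<mu>0: "0 < \<mu>0" and est: "\<And>\<epsilon> u m. 0 < \<epsilon> \<Longrightarrow> \<epsilon> \<le> 1 \<Longrightarrow> classical_solution \<epsilon> T H f g m0 u m \<Longrightarrow>
     (\<forall>z\<in>S. \<bar>u z\<bar> \<le> C \<and> norm (Dx S u z) \<le> C \<and> \<bar>D2 S u z\<bar> \<le> C) \<and>
     (\<forall>x. \<mu>0 \<le> m (x, T) \<and> m (x, T) \<le> \<mu>1)"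
    by (rule uniform_estimates) (rule that)
  note est = est[OF _ _ sol]
  obtain l where l: "\<And>\<epsilon> u m. classical_solution \<epsilon> T H f g m0 u m \<Longrightarrow> (2 * C)-lipschitz_on S u \<Longrightarrow>
    (\<forall>x. \<mu>0 \<le> m (x, T) \<and> m (x, T) \<le> \<mu>1) \<Longrightarrow> (2 * C / l)-lipschitz_on UNIV (\<lambda>x. m (x, T))"
    by (rule terminal_density_lipschitz[OF \<mu>0]) (rule that)
  have "\<forall>\<^sub>F \<epsilon> in at_right (0 :: real). 0 < \<epsilon> \<and> \<epsilon> \<le> 1"
    unfolding eventually_at_right_field by (intro exI[of _ 1]) auto
  then have "\<forall>\<^sub>F \<epsilon> in at_right 0. \<forall>z \<in> closed_cyl T.
            \<bar>u_eps \<epsilon> z\<bar> \<le> C \<and> norm (Dx (closed_cyl T) (u_eps \<epsilon>) z) \<le> C \<and>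
            \<bar>D2 (closed_cyl T) (u_eps \<epsilon>) z\<bar> \<le> C"
    by eventually_elim (use est in blast)
  moreover have "lipschitz_representative (open_cyl T) (closed_cyl T) u \<and>
            lipschitz_representative UNIV UNIV (\<lambda>x. m (x, T))"
    if e: "\<forall>k. e k > 0" "e \<longlonglongrightarrow> 0" and u: "converges_ae T (\<lambda>k. u_eps (e k)) u"
      and m: "converges_ae T (\<lambda>k. m_eps (e k)) m" for e :: "nat \<Rightarrow> real" and u m
  proof
    \<comment> \<open>The estimates hold for \<open>\<epsilon> \<le> 1\<close>, hence for all but
      finitely many members of the sequence.\<close>
    have e1: "\<forall>\<^sub>F k in sequentially. e k \<le> 1"
      using order_tendstoD(2)[OF e(2), of 1] by (auto elim: eventually_mono)
    have lu: "(2 * C)-lipschitz_on S (u_eps (e k))" if "e k \<le> 1" for k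
      using lipschitz_of_C1_bound[OF sol] est e(1) that by blast
    show "lipschitz_representative (open_cyl T) (closed_cyl T) u"
    proof (rule lipschitz_representative_limit)
      show "open (open_cyl T :: ((real ^ 'n) \<times> real) set)" by (simp add: open_Times)
      show "closed_cyl T \<subseteq> closure (open_cyl T :: ((real ^ 'n) \<times> real) set)"
        using closed_cyl_subset_closure_open_cyl[OF assms(1)] .
      show "\<forall>\<^sub>F k in sequentially. (2 * C)-lipschitz_on S (u_eps (e k))"
        using e1 by eventually_elim (rule lu)
      show "AE z in lebesgue_on (open_cyl T). (\<lambda>k. u_eps (e k) z) \<longlonglongrightarrow> u z"
        using u by (simp add: converges_ae_def)
    qed auto
    show "lipschitz_representative UNIV UNIV (\<lambda>x. m (x, T))"
    proof (rule lipschitz_representative_limit)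
      show "\<forall>\<^sub>F k in sequentially. (2 * C / l)-lipschitz_on UNIV (\<lambda>x. m_eps (e k) (x, T))"
        using e1
      proof eventually_elim
        case (elim k)
        show ?case by (rule l[OF sol lu]) (use elim e(1) est in blast)+
      qed
      show "AE x in lebesgue_on UNIV. (\<lambda>k. m_eps (e k) (x, T)) \<longlonglongrightarrow> m (x, T)"
        using m unfolding converges_ae_def lebesgue_on_UNIV_eq by (rule conjunct2)
    qed auto
  qed
  ultimately show ?thesis by blast
qed

end
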